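(* Let $K$ be a number field with ring of integers $\mathcal{O}_K$. Let $\mathfrak{p},\mathfrak{q}$ be non-zero prime ideals of $\mathcal{O}_K$, neither lying over $(2)\subset\mathbb{Z}$, such that $\mathcal{O}_K/\mathfrak{p}\cong\mathbb{F}_p$ and $\mathcal{O}_K/\mathfrak{q}\cong\mathbb{F}_q$ for rational primes $p,q$ with $q>p+1+2\sqrt{p}$. Let $0\neq d\in\mathcal{O}_K$ be such that (i) $K=\mathbb{Q}(d)$; (ii) $16(4+27d^4)\notin\mathfrak{p}$; (iii) $d\in\mathfrak{q}$. Then: (1) $P=(0,d)$ is a point of infinite order in $E(K)$, where $E$ is the elliptic curve $y^2=x^3+x+d^2$ over $K$; (2) neither $E$ nor $P$ can be defined over any proper subfield of $K$; (3) for $d,d'\in\mathcal{O}_K$ (for which $y^2=x^3+x+d^2$ and $y^2=x^3+x+d'^2$ are elliptic curves), these two curves are isomorphic over $\overline{\mathbb{Q}}$ if and only if $d=d'\zeta_4$ for some fourth root of unity $\zeta_4$; (4) in particular, if $d\neq d'\zeta_4$ for every fourth root of unity $\zeta_4$, then the corresponding curves are not twists of each other.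
   Formalization: In (2), "E cannot be defined over a proper subfield F" is claimed only when d^4 is not in F; if d^4 lies in F, E has a model over F (e.g. K=Q(√2), d=17√2, E: y^2=x^3+x+578 over Q). For P, the claim is that its coordinates do not lie in F. *)

theory Defs
  imports Complex_Main
    "HOL-Computational_Algebra.Polynomial"
    "HOL-Algebra.IntRing"
    "HOL-Algebra.Generated_Fields"
    "HOL-Algebra.Algebraic_Closure_Type"
begin

section \<open>Number fields and their rings of integers\<close>

definition number_field :: "'k::field_char_0 itself \<Rightarrow> bool" where
  "number_field _ \<longleftrightarrow>
     (\<exists>B. finite_dimensional_vector_space (\<lambda>(r::rat) (x::'k). of_rat r * x) B)"

text \<open>The type \<open>'k\<close> viewed as a ring in the sense of HOL-Algebra is
  \<^const>\<open>ring_of_type_algebra\<close>; subfields and ideals are subsets of its carrier.\<close>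

definition ring_of_integers :: "'k::field_char_0 ring" where
  "ring_of_integers = ring_of_type_algebra\<lparr>carrier := {x. algebraic_int x}\<rparr>"

text \<open>\<open>\<pp>\<close> lies over an ideal of the integers if that ideal is \<open>\<pp> \<inter> \<int>\<close>.\<close>

definition lies_over :: "'k::field_char_0 set \<Rightarrow> int set \<Rightarrow> bool" where
  "lies_over \<pp> I \<longleftrightarrow> {n. of_int n \<in> \<pp>} = I"


section \<open>Weierstrass curves\<close>

text \<open>The equation is
  \<open>y\<^sup>2 + a\<^sub>1 x y + a\<^sub>3 y = x\<^sup>3 + a\<^sub>2 x\<^sup>2 + a\<^sub>4 x + a\<^sub>6\<close>.\<close>

datatype 'a weierstrass =
  Weierstrass (a1: 'a) (a2: 'a) (a3: 'a) (a4: 'a) (a6: 'a)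

definition weierstrass_discriminant :: "'a::field weierstrass \<Rightarrow> 'a" where
  "weierstrass_discriminant W =
    (let b2 = (a1 W)\<^sup>2 + 4 * a2 W;
         b4 = 2 * a4 W + a1 W * a3 W;
         b6 = (a3 W)\<^sup>2 + 4 * a6 W;
         b8 = (a1 W)\<^sup>2 * a6 W + 4 * a2 W * a6 W - a1 W * a3 W * a4 W
              + a2 W * (a3 W)\<^sup>2 - (a4 W)\<^sup>2
     in - b2\<^sup>2 * b8 - 8 * b4 ^ 3 - 27 * b6\<^sup>2 + 9 * b2 * b4 * b6)"

definition elliptic_curve :: "'a::field weierstrass \<Rightarrow> bool" where
  "elliptic_curve W \<longleftrightarrow> weierstrass_discriminant W \<noteq> 0"

definition affine_points :: "'a::field weierstrass \<Rightarrow> ('a \<times> 'a) set" where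
  "affine_points W = {(x, y).
     y\<^sup>2 + a1 W * x * y + a3 W * y = x ^ 3 + a2 W * x\<^sup>2 + a4 W * x + a6 W}"


section \<open>The group of rational points\<close>

datatype 'a point = Infinity | Affine 'a 'a

text \<open>The chord-tangent law.  The first case is \<open>P + (-P)\<close>, where
  \<open>-(x, y) = (x, -y - a\<^sub>1 x - a\<^sub>3)\<close>; the last alternative for the slope is the tangent.\<close>

fun point_add :: "'a::field weierstrass \<Rightarrow> 'a point \<Rightarrow> 'a point \<Rightarrow> 'a point" where
  "point_add W Infinity Q = Q"
| "point_add W (Affine x1 y1) Infinity = Affine x1 y1"
| "point_add W (Affine x1 y1) (Affine x2 y2) =
    (if x1 = x2 \<and> y1 + y2 + a1 W * x2 + a3 W = 0 then Infinity
     else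
       let l = (if x1 \<noteq> x2 then (y2 - y1) / (x2 - x1)
                else (3 * x1\<^sup>2 + 2 * a2 W * x1 + a4 W - a1 W * y1)
                     / (2 * y1 + a1 W * x1 + a3 W));
           x3 = l\<^sup>2 + a1 W * l - a2 W - x1 - x2
       in Affine x3 (- (l * (x3 - x1) + y1) - a1 W * x3 - a3 W))"

definition rational_points :: "'a::field weierstrass \<Rightarrow> 'a point monoid" where
  "rational_points W =
    \<lparr>carrier = insert Infinity {Affine x y | x y. (x, y) \<in> affine_points W},
     monoid.mult = point_add W,
     one = Infinity\<rparr>"

definition infinite_order :: "('a, 'b) monoid_scheme \<Rightarrow> 'a \<Rightarrow> bool" where
  "infinite_order G P \<longleftrightarrow> (\<forall>n::nat. n > 0 \<longrightarrow> P [^]\<^bsub>G\<^esub> n \<noteq> \<one>\<^bsub>G\<^esub>)"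


section \<open>Isomorphisms and fields of definition\<close>

definition eval2 :: "'a::comm_semiring_1 poly poly \<Rightarrow> 'a \<times> 'a \<Rightarrow> 'a" where
  "eval2 p z = poly (poly p [:snd z:]) (fst z)"

text \<open>An isomorphism of elliptic curves is an isomorphism of the projective curves that
  maps the point at infinity to the point at infinity.  Removing that point, it is the
  same as an isomorphism of the affine varieties given by the two Weierstrass equations.
  Over an algebraically closed field a morphism of these is a polynomial map between their
  sets of points; over other fields this description would be wrong, hence the sort
  constraint.\<close>

definition isomorphic_curves ::
    "'a::alg_closed_field weierstrass \<Rightarrow> 'a weierstrass \<Rightarrow> bool" where
  "isomorphic_curves V W \<longleftrightarrow>
    (\<exists>f g f' g' :: 'a poly poly.
       let \<phi> = (\<lambda>z. (eval2 f z, eval2 g z));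
           \<psi> = (\<lambda>z. (eval2 f' z, eval2 g' z))
       in \<phi> ` affine_points V \<subseteq> affine_points W \<and>
          \<psi> ` affine_points W \<subseteq> affine_points V \<and>
          (\<forall>z\<in>affine_points V. \<psi> (\<phi> z) = z) \<and>
          (\<forall>z\<in>affine_points W. \<phi> (\<psi> z) = z))"

text \<open>Over a number field \<open>K\<close>, the algebraic closure \<^typ>\<open>'k alg_closure\<close> of \<open>K\<close> is an
  algebraic closure of the rationals.\<close>

definition isomorphic_over_closure ::
    "'k::field weierstrass \<Rightarrow> 'k weierstrass \<Rightarrow> bool" where
  "isomorphic_over_closure V W \<longleftrightarrow>
     isomorphic_curves (map_weierstrass to_ac V) (map_weierstrass to_ac W)"

definition is_twist_of :: "'k::field weierstrass \<Rightarrow> 'k weierstrass \<Rightarrow> bool" where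
  "is_twist_of V W \<longleftrightarrow> elliptic_curve V \<and> elliptic_curve W \<and> isomorphic_over_closure V W"

text \<open>The model over \<open>F\<close> is only required to become isomorphic to \<open>W\<close> over the algebraic
  closure.  This is weaker than an isomorphism over \<open>K\<close>, so not being definable over \<open>F\<close>
  in this sense implies not being definable over \<open>F\<close> up to isomorphism over \<open>K\<close>.\<close>

definition curve_definable_over :: "'k::field set \<Rightarrow> 'k weierstrass \<Rightarrow> bool" where
  "curve_definable_over F W \<longleftrightarrow>
     (\<exists>V. elliptic_curve V \<and> set_weierstrass V \<subseteq> F \<and> isomorphic_over_closure V W)"

definition point_defined_over :: "'k set \<Rightarrow> 'k point \<Rightarrow> bool" where
  "point_defined_over F P \<longleftrightarrow> set_point P \<subseteq> F"


section \<open>The family\<close>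

definition curve :: "'k::field \<Rightarrow> 'k weierstrass" where
  "curve d = Weierstrass 0 0 0 1 (d\<^sup>2)"

lemma weierstrass_discriminant_curve:
  "weierstrass_discriminant (curve d) = - (16 * (4 + 27 * d ^ 4))"
  by (simp add: weierstrass_discriminant_def curve_def Let_def algebra_simps
      power_mult_distrib flip: power_mult)

text \<open>For \<open>d \<noteq> 0\<close> the substitution \<open>(x, y) \<mapsto> (d\<^sup>2 x, d\<^sup>3 y)\<close> is an isomorphism, already over
  \<open>K\<close>, onto the curve \<open>y\<^sup>2 = x\<^sup>3 + d\<^sup>4 x + d\<^sup>8\<close>, and it maps \<open>(0, d)\<close> to \<open>(0, d\<^sup>4)\<close>.  So the curve
  is definable over every subfield that contains \<open>d\<^sup>4\<close>, even if that subfield is proper.\<close>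

lemma curve_definable_over_if_power4_mem:
  fixes d :: "'k::field_char_0"
  assumes "subfield F ring_of_type_algebra" and "d ^ 4 \<in> F" and "d \<noteq> 0"
    and "elliptic_curve (curve d)"
  shows "curve_definable_over F (curve d)"
proof -
  define V where "V = Weierstrass 0 0 0 (d ^ 4) (d ^ 8)"
  have F0: "0 \<in> F" and F_mult: "x * y \<in> F" if "x \<in> F" "y \<in> F" for x y
    using subringE(2,6)[of F ring_of_type_algebra] assms(1) that
    by (auto simp: subfield_def subdomain_def subcring_def ring_of_type_algebra_def)
  have F0: "0 \<in> F"
    using F0 assms(2) by blast
  have "d ^ 8 = d ^ 4 * d ^ 4"
    by (simp flip: power_add)
  with F_mult assms(2) have "d ^ 8 \<in> F"
    by metis
  with F0 assms(2) have sub: "set_weierstrass V \<subseteq> F"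
    by (auto simp: V_def)
  have "weierstrass_discriminant V = d ^ 12 * weierstrass_discriminant (curve d)"
    by (simp add: V_def weierstrass_discriminant_def curve_def Let_def)
      (simp add: algebra_simps flip: power_add)
  with assms(3,4) have ell: "elliptic_curve V"
    by (simp add: elliptic_curve_def)
  define c where "c = to_ac d"
  have c: "c \<noteq> 0"
    using assms(3) by (simp add: c_def)
  have pts: "affine_points (map_weierstrass to_ac V) = {(x, y). y\<^sup>2 = x ^ 3 + c ^ 4 * x + c ^ 8}"
      "affine_points (map_weierstrass to_ac (curve d)) = {(x, y). y\<^sup>2 = x ^ 3 + x + c\<^sup>2}"
    by (simp_all add: affine_points_def V_def curve_def c_def)
  have down: "(y / c ^ 3)\<^sup>2 = (x / c\<^sup>2) ^ 3 + x / c\<^sup>2 + c\<^sup>2"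
    if "y\<^sup>2 = x ^ 3 + c ^ 4 * x + c ^ 8" for x y
  proof -
    define u v where "u = x / c\<^sup>2" and "v = y / c ^ 3"
    have xy: "x = c\<^sup>2 * u" "y = c ^ 3 * v"
      using c by (simp_all add: u_def v_def)
    have "c ^ 6 * v\<^sup>2 = y\<^sup>2"
      by (simp add: xy power_mult_distrib flip: power_mult)
    also have "\<dots> = c ^ 6 * (u ^ 3 + u + c\<^sup>2)"
      unfolding that unfolding xy
      by (simp add: power_mult_distrib distrib_left mult.assoc[symmetric]
          flip: power_mult power_add)
    finally show ?thesis
      using c by (simp add: u_def v_def)
  qed
  have up: "(c ^ 3 * y)\<^sup>2 = (x * c\<^sup>2) ^ 3 + c ^ 4 * (x * c\<^sup>2) + c ^ 8"
    if "y\<^sup>2 = x ^ 3 + x + c\<^sup>2" for x y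
    unfolding power_mult_distrib that
    by (simp add: distrib_left mult.left_commute mult.commute flip: power_mult power_add)
  have "isomorphic_over_closure V (curve d)"
    unfolding isomorphic_over_closure_def isomorphic_curves_def Let_def pts
    by (rule exI[of _ "[:[:0, 1 / c\<^sup>2:]:]"], rule exI[of _ "[:0, [:1 / c ^ 3:]:]"],
        rule exI[of _ "[:[:0, c\<^sup>2:]:]"], rule exI[of _ "[:0, [:c ^ 3:]:]"])
      (use c down up in \<open>auto simp: eval2_def\<close>)
  with sub ell show ?thesis
    by (auto simp: curve_definable_over_def)
qed

end

theory Submission
  imports Defs "Jordan_Normal_Form.Char_Poly" "Berlekamp_Zassenhaus.Finite_Field"
begin

text \<open>If \<open>P = (0, d)\<close> were torsion, compare its reductions at \<open>\<pp>\<close> and \<open>\<qq>\<close>.  A torsion point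
  in the kernel of reduction at a prime over \<open>\<ell>\<close> has \<open>\<ell>\<close>-power order, because the formal
  parameter \<open>z = - x / y\<close> satisfies \<open>z(n S) = (n + m) z(S)\<close> with \<open>m\<close> in the maximal ideal.  As
  \<open>d \<in> \<qq>\<close>, the point \<open>2 P\<close> is in the kernel at \<open>\<qq>\<close>, so the order of \<open>P\<close> divides \<open>2 q\<^sup>k\<close>.  By
  Hasse's bound at \<open>\<pp>\<close>, some \<open>r P\<close> with \<open>0 < r \<le> p + 1 + 2 \<surd>p < q\<close> is in the kernel at \<open>\<pp>\<close>, so the
  order divides \<open>r p\<^sup>j\<close>.  Hence \<open>2 P = 0\<close>, which contradicts \<open>d \<noteq> 0\<close>.  Hasse's bound is proved by
  Manin's elementary method, on the quadratic twist of the curve by \<open>t\<^sup>3 + a t + b\<close> over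
  \<open>\<bbbF>\<^sub>p(t)\<close>.  An isomorphism of short Weierstrass curves has the form \<open>(u\<^sup>2 x, u\<^sup>3 y)\<close>, since it
  preserves the pole orders of the coordinates at infinity; so \<open>d\<^sup>4\<close> is an invariant.\<close>


section \<open>The chord-tangent law\<close>

text \<open>The obstacle in the group law is associativity. It is a computation when the third point
  is generic, so that every sum involving it is a chord; the exceptions are removed by adding and
  cancelling an auxiliary point. This needs infinitely many points, hence the detour through the
  algebraic closure. Over \<bbbF>_p(t) only the cancellation law \<open>(A + B) - B = A\<close> is
  used. Reduction is never a map to a second curve. A point reduces to infinity if its abscissa is
  not integral, and points with congruent integral coordinates differ by such a point. The
  localization at a prime enters only as a subring that contains \<open>x\<close> or
  \<open>1 / x\<close> for every \<open>x\<close>. The gap between \<open>q\<close> and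
  \<open>p + 1 + 2 sqrt p\<close> makes both \<open>r\<close> and \<open>p\<close> smaller than
  \<open>q\<close>, hence coprime to it; so \<open>r p^j\<close> and \<open>2 q^k\<close> share no
  factor beyond those of 2. The invariant behind \<open>d^4\<close> is \<open>B^2 / A^3\<close> for
  \<open>y^2 = x^3 + A x + B\<close>: an isomorphism multiplies \<open>A\<close> by
  \<open>u^4\<close> and \<open>B\<close> by \<open>u^6\<close>.\<close>

abbreviation short_weierstrass :: "'a::zero \<Rightarrow> 'a \<Rightarrow> 'a weierstrass" where
  "short_weierstrass a b \<equiv> Weierstrass 0 0 0 a b"

lemmas diff_eq_0 = iffD1[OF eq_iff_diff_eq_0]

fun on_curve :: "'a::field \<Rightarrow> 'a \<Rightarrow> 'a point \<Rightarrow> bool" where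
  "on_curve a b Infinity \<longleftrightarrow> True"
| "on_curve a b (Affine x y) \<longleftrightarrow> y\<^sup>2 = x ^ 3 + a * x + b"

fun point_neg :: "'a::field point \<Rightarrow> 'a point" where
  "point_neg Infinity = Infinity"
| "point_neg (Affine x y) = Affine x (- y)"

text \<open>Vieta's relations for the abscissae of the intersections of the line \<open>y = l x + c\<close>
  with the curve.\<close>

definition line_meets :: "'a::field \<Rightarrow> 'a \<Rightarrow> 'a \<Rightarrow> 'a \<Rightarrow> 'a \<Rightarrow> 'a \<Rightarrow> 'a \<Rightarrow> bool" where
  "line_meets a b l c x1 x2 x3 \<longleftrightarrow>
     l\<^sup>2 = x1 + x2 + x3 \<and> a - 2 * l * c = x1 * x2 + x1 * x3 + x2 * x3 \<and> c\<^sup>2 - b = x1 * x2 * x3"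

lemma line_meetsD:
  assumes "line_meets a b l c x1 x2 x3"
  shows "l\<^sup>2 - (x1 + x2 + x3) = 0" "a - 2 * l * c - (x1 * x2 + x1 * x3 + x2 * x3) = 0"
    "c\<^sup>2 - b - x1 * x2 * x3 = 0"
  using assms by (simp_all add: line_meets_def)

lemma line_meets_swap:
  "line_meets a b l c x1 x2 x3 \<Longrightarrow> line_meets a b l c x3 x2 x1"
  "line_meets a b l c x1 x2 x3 \<Longrightarrow> line_meets a b l c x1 x3 x2"
  by (auto simp: line_meets_def algebra_simps)

lemma line_meets_minus:
  "line_meets a b l c x1 x2 x3 \<Longrightarrow> line_meets a b (- l) (- c) x1 x2 x3"
  by (auto simp: line_meets_def)

lemma line_meets_eval:
  assumes "line_meets a b l c x1 x2 x3"
  shows "t ^ 3 + a * t + b - (l * t + c)\<^sup>2 = (t - x1) * (t - x2) * (t - x3)"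
  using line_meetsD[OF assms] by Groebner_Basis.algebra

lemma line_meets_on_curve:
  assumes "line_meets a b l c x1 x2 x3"
  shows "on_curve a b (Affine x3 (l * x3 + c))" "on_curve a b (Affine x3 (- (l * x3 + c)))"
proof -
  have "(l * x3 + c)\<^sup>2 = x3 ^ 3 + a * x3 + b"
    using line_meets_eval[OF assms, of x3] by simp
  then show "on_curve a b (Affine x3 (l * x3 + c))" "on_curve a b (Affine x3 (- (l * x3 + c)))"
    by (simp_all only: on_curve.simps power2_minus)
qed

locale nonsingular_cubic =
  fixes a b :: "'a::field"
  assumes two: "(2 :: 'a) \<noteq> 0" and disc: "4 * a ^ 3 + 27 * b\<^sup>2 \<noteq> 0"
begin

abbreviation add :: "'a point \<Rightarrow> 'a point \<Rightarrow> 'a point" (infixl "\<^bold>+" 65) where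
  "P \<^bold>+ Q \<equiv> point_add (short_weierstrass a b) P Q"

abbreviation on :: "'a point \<Rightarrow> bool" where
  "on P \<equiv> on_curve a b P"

lemma double_eq_0 [simp]: "(y :: 'a) + y = 0 \<longleftrightarrow> y = 0"
proof -
  have "y + y = 2 * y" by simp
  then show ?thesis using two by (simp del: mult_2)
qed

text \<open>The discriminant is a combination of the cubic and its derivative with coefficients in
  \<int>[a, b, x]. As the identity is integral, it serves again modulo the maximal ideal of a
  valuation ring and modulo a prime polynomial.\<close>

lemma no_double_root:
  assumes "x ^ 3 + a * x + b = 0" "3 * x\<^sup>2 + a = 0"
  shows False
proof -
  have "4 * a ^ 3 + 27 * b\<^sup>2 = (6 * a * x\<^sup>2 - 9 * b * x + 4 * a\<^sup>2) * (3 * x\<^sup>2 + a)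
      + (27 * b - 18 * a * x) * (x ^ 3 + a * x + b)"
    by Groebner_Basis.algebra
  with assms disc show False by simp
qed

lemma add_Infinity [simp]: "P \<^bold>+ Infinity = P"
  by (cases P) auto

lemma point_neg_neg [simp]: "point_neg (point_neg P) = P" for P :: "'a point"
  by (cases P) auto

lemma on_neg [simp]: "on (point_neg P) \<longleftrightarrow> on P"
  by (cases P) auto

lemma add_eq_Infinity_iff:
  "P \<^bold>+ Q = Infinity \<longleftrightarrow> Q = point_neg P"
  by (cases P; cases Q) (auto simp: Let_def add_eq_0_iff)

lemma add_neg [simp]: "P \<^bold>+ point_neg P = Infinity"
  by (simp add: add_eq_Infinity_iff)

lemma neg_add [simp]: "point_neg P \<^bold>+ P = Infinity"
  by (simp add: add_eq_Infinity_iff)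

lemma add_tangent:
  assumes "y \<noteq> 0" "l * (2 * y) = 3 * x\<^sup>2 + a" "l\<^sup>2 = x + x + x'"
  shows "Affine x y \<^bold>+ Affine x y = Affine x' (- (l * (x' - x) + y))"
proof -
  have "(3 * x\<^sup>2 + a) / (2 * y) = l"
    using assms(1) two by (simp add: assms(2)[symmetric])
  then show ?thesis using assms(1,3) two by (simp add: Let_def)
qed

lemma add_chord:
  assumes "x1 \<noteq> x2" "l * (x2 - x1) = y2 - y1" "l\<^sup>2 = x1 + x2 + x3"
  shows "Affine x1 y1 \<^bold>+ Affine x2 y2 = Affine x3 (- (l * (x3 - x1) + y1))"
proof -
  have "(y2 - y1) / (x2 - x1) = l"
    using assms(1) by (simp add: assms(2)[symmetric])
  then show ?thesis using assms(1,3) by (simp add: Let_def)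
qed

text \<open>Chord and tangent are treated together: both points lie on the line, so
  \<open>x1 = x2\<close> makes them equal, and Vieta's relations with a repeated root force the
  slope to be that of the tangent. What \<open>ne\<close> excludes is doubling a point of order two,
  where the tangent is vertical.\<close>

lemma add_line:
  assumes "line_meets a b l c x1 x2 x3"
    and ne: "\<not> (x1 = x2 \<and> l * x1 + c = 0)"
  shows "Affine x1 (l * x1 + c) \<^bold>+ Affine x2 (l * x2 + c) = Affine x3 (- (l * x3 + c))"
proof -
  have eq: "l * x3 + c = l * (x3 - x1) + (l * x1 + c)"
    by (simp add: right_diff_distrib)
  have sq: "l\<^sup>2 = x1 + x2 + x3"
    using assms(1) by (simp add: line_meets_def)
  show ?thesis
  proof (cases "x1 = x2")
    case True
    have "l * (2 * (l * x1 + c)) - (3 * x1\<^sup>2 + a) = 0"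
      using line_meetsD[OF assms(1)[unfolded True]] unfolding True by Groebner_Basis.algebra
    then show ?thesis
      using add_tangent[of "l * x1 + c" l x1 x3] ne sq unfolding eq True by simp
  next
    case False
    show ?thesis
      unfolding eq by (rule add_chord[OF False _ sq]) (simp add: right_diff_distrib)
  qed
qed

lemma line_through:
  assumes "on (Affine x1 y1)" "on (Affine x2 y2)" "\<not> (x1 = x2 \<and> y1 + y2 = 0)"
  obtains l c x3 where "line_meets a b l c x1 x2 x3" "y1 = l * x1 + c" "y2 = l * x2 + c"
    "x1 = x2 \<Longrightarrow> l * (2 * y1) = 3 * x1\<^sup>2 + a" "x1 \<noteq> x2 \<Longrightarrow> l = (y2 - y1) / (x2 - x1)"
proof (cases "x1 = x2")
  case True
  have "(y1 - y2) * (y1 + y2) = 0"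
    using assms(1,2) True by (simp add: algebra_simps power2_eq_square)
  then have [simp]: "y2 = y1" and y: "y1 \<noteq> 0"
    using assms(3) True by auto
  define l where "l = (3 * x1\<^sup>2 + a) / (2 * y1)"
  have l: "l * (2 * y1) = 3 * x1\<^sup>2 + a"
    using y two by (simp add: l_def)
  show ?thesis
  proof
    have "y1\<^sup>2 = x1 ^ 3 + a * x1 + b" using assms(1) by simp
    note eqs = diff_eq_0[OF this] diff_eq_0[OF l]
    show "line_meets a b l (y1 - l * x1) x1 x2 (l\<^sup>2 - x1 - x2)"
      unfolding line_meets_def True[symmetric]
    proof (intro conjI)
      show "l\<^sup>2 = x1 + x1 + (l\<^sup>2 - x1 - x1)" by simp
      show "a - 2 * l * (y1 - l * x1) = x1 * x1 + x1 * (l\<^sup>2 - x1 - x1) + x1 * (l\<^sup>2 - x1 - x1)"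
        using eqs(2) by Groebner_Basis.algebra
      show "(y1 - l * x1)\<^sup>2 - b = x1 * x1 * (l\<^sup>2 - x1 - x1)"
        using eqs by Groebner_Basis.algebra
    qed
  qed (use True l in auto)
next
  case False
  define l where "l = (y2 - y1) / (x2 - x1)"
  have l: "l * (x2 - x1) = y2 - y1"
    using False by (simp add: l_def)
  show ?thesis
  proof
    have 1: "y1\<^sup>2 = x1 ^ 3 + a * x1 + b" and 2: "y2\<^sup>2 = x2 ^ 3 + a * x2 + b"
      using assms(1,2) by simp_all
    define c where "c = y1 - l * x1"
    have c: "y1 = l * x1 + c" "y2 = l * x2 + c" using l by (auto simp: c_def algebra_simps)
    \<comment> \<open>The difference of the two curve equations is divisible by
      \<open>x2 - x1\<close>; cancelling this factor leaves Vieta's second relation.\<close>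
    have "(x2 - x1) * (a - 2 * l * c - (x1 * x2 + x1 * (l\<^sup>2 - x1 - x2) + x2 * (l\<^sup>2 - x1 - x2))) = 0"
      using diff_eq_0[OF 1] diff_eq_0[OF 2] unfolding c by Groebner_Basis.algebra
    then have e2: "a - 2 * l * c = x1 * x2 + x1 * (l\<^sup>2 - x1 - x2) + x2 * (l\<^sup>2 - x1 - x2)"
      using False by simp
    moreover have "c\<^sup>2 - b = x1 * x2 * (l\<^sup>2 - x1 - x2)"
      using diff_eq_0[OF 1] diff_eq_0[OF e2] unfolding c by Groebner_Basis.algebra
    ultimately show "line_meets a b l (y1 - l * x1) x1 x2 (l\<^sup>2 - x1 - x2)"
      by (simp add: line_meets_def c_def)
    show "y2 = l * x2 + (y1 - l * x1)" using l by (simp add: algebra_simps)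
    show "l = (y2 - y1) / (x2 - x1)" by (simp add: l_def)
  qed (use False in auto)
qed

text \<open>The case split for all statements about sums. Outside the degenerate cases the two
  points are given by parameters of a common line, with no separate tangent case.\<close>

lemma add_cases:
  assumes "on P" "on Q"
  obtains "P = Infinity" | "Q = Infinity" | "Q = point_neg P"
  | l c x1 x2 x3 where "P = Affine x1 (l * x1 + c)" "Q = Affine x2 (l * x2 + c)"
    "line_meets a b l c x1 x2 x3" "\<not> (x1 = x2 \<and> l * x1 + c = 0)"
    "P \<^bold>+ Q = Affine x3 (- (l * x3 + c))"
proof (cases P)
  case P: (Affine x1 y1)
  show ?thesis
  proof (cases Q)
    case Q: (Affine x2 y2)
    show ?thesis
    proof (cases "x1 = x2 \<and> y1 + y2 = 0")
      case True
      then have "Q = point_neg P" using P Q by (simp add: add_eq_0_iff)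
      then show ?thesis using that(3) by blast
    next
      case False
      obtain l c x3 where *: "line_meets a b l c x1 x2 x3" "y1 = l * x1 + c" "y2 = l * x2 + c"
        using line_through[of x1 y1 x2 y2] False assms P Q by metis
      then have ne: "\<not> (x1 = x2 \<and> l * x1 + c = 0)" using False by (metis add_0)
      from that(4)[OF _ _ *(1) ne] add_line[OF *(1) ne] P Q * show ?thesis by blast
    qed
  qed (use that in blast)
qed (use that in blast)

lemma on_add:
  assumes "on P" "on Q"
  shows "on (P \<^bold>+ Q)"
  using assms
proof (cases rule: add_cases)
  case (4 l c x1 x2 x3)
  then show ?thesis using line_meets_on_curve by metis
qed (use assms in auto)

lemma add_commute:
  assumes "on P" "on Q"
  shows "P \<^bold>+ Q = Q \<^bold>+ P"
  using assms
proof (cases rule: add_cases)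
  case (4 l c x1 x2 x3)
  have "line_meets a b l c x2 x1 x3"
    using 4(3) line_meets_swap by blast
  from add_line[OF this] 4 show ?thesis by auto
qed auto

lemma neg_add_distrib:
  assumes "on P" "on Q"
  shows "point_neg (P \<^bold>+ Q) = point_neg P \<^bold>+ point_neg Q"
  using assms
proof (cases rule: add_cases)
  case (4 l c x1 x2 x3)
  have ne: "\<not> (x1 = x2 \<and> - l * x1 + - c = 0)"
    using 4(4) by (metis add.inverse_neutral minus_add_distrib minus_minus mult_minus_left)
  show ?thesis
    using add_line[OF line_meets_minus[OF 4(3)] ne] unfolding 4(5) unfolding 4(1,2) by simp
qed auto

text \<open>The mirror image of the line through \<open>P\<close> and \<open>Q\<close> passes
  through \<open>P + Q\<close>, \<open>- Q\<close> and \<open>- P\<close>, so it computes the left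
  side. This fragment of the group law does not depend on associativity.\<close>

lemma add_diff_cancel:
  assumes "on P" "on Q"
  shows "(P \<^bold>+ Q) \<^bold>+ point_neg Q = P"
  using assms
proof (cases rule: add_cases)
  case (4 l c x1 x2 x3)
  have *: "line_meets a b (- l) (- c) x3 x2 x1"
    using line_meets_swap(1)[OF line_meets_minus[OF 4(3)]] .
  \<comment> \<open>In the excluded configuration a non-vertical line would be tangent at a point
    with ordinate 0, which makes \<open>x2\<close> a double root of the cubic.\<close>
  have "\<not> (x3 = x2 \<and> (- l) * x3 + - c = 0)"
  proof
    assume **: "x3 = x2 \<and> (- l) * x3 + - c = 0"
    then have c: "c = - (l * x2)" by (metis ** add_eq_0_iff minus_equation_iff mult_minus_left)
    have "x2 ^ 3 + a * x2 + b = 0"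
      using assms(2) 4(2) by (simp add: c)
    moreover have "3 * x2\<^sup>2 + a = 0"
      using line_meetsD[OF *] ** unfolding c by Groebner_Basis.algebra
    ultimately show False by (rule no_double_root)
  qed
  from add_line[OF * this] show ?thesis unfolding 4(5) unfolding 4(1,2) by simp
qed auto

section \<open>Associativity for generic points\<close>

lemma same_abscissa:
  assumes "on (Affine x y)" "on (Affine x y')"
  shows "Affine x y' \<in> {Affine x y, point_neg (Affine x y)}"
proof -
  have "(y' - y) * (y' + y) = 0"
    using assms by (simp add: algebra_simps power2_eq_square)
  then show ?thesis by (auto simp: add_eq_0_iff)
qed

text \<open>The parabola \<open>y = l x + c + \<alpha> (x - x\<^sub>1) (x - x\<^sub>2)\<close> through the three points meets the curve in
  one further point, namely \<open>- (A + B + T)\<close>.  The slopes of the chords used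
  to compute \<open>(A + B) + T\<close> add up to \<open>1 / \<alpha>\<close>, and so do those used for \<open>A + (B + T)\<close>.\<close>

lemma add_assoc_chords:
  assumes line: "line_meets a b l c x1 x2 x4" and ne: "\<not> (x1 = x2 \<and> l * x1 + c = 0)"
    and T: "on (Affine x3 y3)" and x3: "x3 \<noteq> x1" "x3 \<noteq> x2" "x3 \<noteq> x4"
    and BT: "Affine x2 (l * x2 + c) \<^bold>+ Affine x3 y3 = Affine x5 y5" and x5: "x5 \<noteq> x1"
  shows "(Affine x1 (l * x1 + c) \<^bold>+ Affine x2 (l * x2 + c)) \<^bold>+ Affine x3 y3 =
    Affine x1 (l * x1 + c) \<^bold>+ (Affine x2 (l * x2 + c) \<^bold>+ Affine x3 y3)"
proof -
  define d where "d = (x3 - x1) * (x3 - x2)"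
  have d: "d \<noteq> 0" using x3 by (simp add: d_def)
  define \<alpha> where "\<alpha> = (y3 - (l * x3 + c)) / d"
  have y3: "y3 - (l * x3 + c) = \<alpha> * d"
    using d by (simp add: \<alpha>_def)
  have "d * (\<alpha> * (y3 + (l * x3 + c))) = y3\<^sup>2 - (l * x3 + c)\<^sup>2"
    using diff_eq_0[OF y3] by Groebner_Basis.algebra
  also have "\<dots> = d * (x3 - x4)"
    using line_meets_eval[OF line, of x3] T by (simp add: d_def)
  finally have x4: "\<alpha> * (y3 + (l * x3 + c)) = x3 - x4"
    using d by simp
  then have \<alpha>: "\<alpha> \<noteq> 0" using x3 by auto
  define \<beta> where "\<beta> = 1 / \<alpha>"
  have \<beta>: "\<alpha> * \<beta> - 1 = 0" using \<alpha> by (simp add: \<beta>_def)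
  \<comment> \<open>Along the parabola the ordinate changes by
    \<open>l (x3 - x2) + \<alpha> (x3 - x1) (x3 - x2)\<close> from \<open>x2\<close> to
    \<open>x3\<close>, so \<open>k\<close> is the slope of the chord from \<open>B\<close> to
    \<open>T\<close>. The slopes \<open>m\<close> and \<open>n\<close> below are the complements of
    \<open>l\<close> and \<open>k\<close> to \<beta>.\<close>
  define k where "k = l + \<alpha> * (x3 - x1)"
  note eqs = line_meetsD(1)[OF line] diff_eq_0[OF y3] diff_eq_0[OF x4] \<beta>
  have BT': "Affine x2 (l * x2 + c) \<^bold>+ Affine x3 y3 =
      Affine (k\<^sup>2 - x2 - x3) (- (k * (k\<^sup>2 - x2 - x3 - x2) + (l * x2 + c)))"
  proof (rule add_chord)
    show "k * (x3 - x2) = y3 - (l * x2 + c)"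
      using eqs(2) unfolding k_def d_def by Groebner_Basis.algebra
  qed (use x3 in auto)
  have x5_eq: "x5 = k\<^sup>2 - x2 - x3" using BT BT' by simp
  have AB: "Affine x1 (l * x1 + c) \<^bold>+ Affine x2 (l * x2 + c) = Affine x4 (- (l * x4 + c))"
    by (rule add_line[OF line ne])
  define m where "m = \<beta> - l"
  have ABT: "Affine x4 (- (l * x4 + c)) \<^bold>+ Affine x3 y3 =
      Affine (m\<^sup>2 - x4 - x3) (- (m * (m\<^sup>2 - x4 - x3 - x4) + - (l * x4 + c)))"
  proof (rule add_chord)
    show "m * (x3 - x4) = y3 - - (l * x4 + c)"
      using eqs(3,4) unfolding m_def by Groebner_Basis.algebra
  qed (use x3 in auto)
  define n where "n = \<beta> - k"
  have "Affine x1 (l * x1 + c) \<^bold>+ Affine (k\<^sup>2 - x2 - x3) (- (k * (k\<^sup>2 - x2 - x3 - x2) + (l * x2 + c))) =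
      Affine (n\<^sup>2 - x1 - (k\<^sup>2 - x2 - x3)) (- (n * (n\<^sup>2 - x1 - (k\<^sup>2 - x2 - x3) - x1) + (l * x1 + c)))"
  proof (rule add_chord)
    show "n * (k\<^sup>2 - x2 - x3 - x1) = - (k * (k\<^sup>2 - x2 - x3 - x2) + (l * x2 + c)) - (l * x1 + c)"
      using eqs unfolding n_def k_def d_def by Groebner_Basis.algebra
  qed (use x5 x5_eq in auto)
  moreover have "n\<^sup>2 - x1 - (k\<^sup>2 - x2 - x3) = m\<^sup>2 - x4 - x3"
    using eqs unfolding n_def k_def d_def m_def by Groebner_Basis.algebra
  moreover have "n * (m\<^sup>2 - x4 - x3 - x1) + (l * x1 + c) = m * (m\<^sup>2 - x4 - x3 - x4) + - (l * x4 + c)"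
    using eqs unfolding n_def k_def d_def m_def by Groebner_Basis.algebra
  ultimately show ?thesis
    unfolding AB ABT BT' by simp
qed

text \<open>The degenerate cases for \<open>A\<close> and \<open>B\<close> need no exceptions.
  Otherwise the chord computation applies as soon as \<open>T\<close> avoids finitely many
  points.\<close>

lemma add_assoc_off_finite:
  assumes A: "on A" and B: "on B"
  obtains Z where "finite Z" "\<And>T. on T \<Longrightarrow> T \<notin> Z \<Longrightarrow> (A \<^bold>+ B) \<^bold>+ T = A \<^bold>+ (B \<^bold>+ T)"
  using A B
proof (cases rule: add_cases)
  case 1
  then show ?thesis using that[of "{}"] by simp
next
  case 2
  then show ?thesis using that[of "{}"] by simp
next
  case 3
  have "A \<^bold>+ (point_neg A \<^bold>+ T) = T" if "on T" for T
    using add_diff_cancel[OF that, of "point_neg A"] add_commute on_add on_neg A that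
    by (metis point_neg_neg)
  then show ?thesis using that[of "{}"] 3 by simp
next
  case (4 l c x1 x2 x4)
  \<comment> \<open>The first seven points keep the abscissa of \<open>T\<close> apart from those of
    \<open>A\<close>, \<open>B\<close> and \<open>A + B\<close>, and \<open>B + T\<close> finite.
    The last two are the solutions \<open>T\<close> of \<open>B + T = A\<close> and
    \<open>B + T = - A\<close>.\<close>
  let ?Z = "{Infinity, A, point_neg A, B, point_neg B, A \<^bold>+ B, point_neg (A \<^bold>+ B),
    A \<^bold>+ point_neg B, point_neg A \<^bold>+ point_neg B}"
  have "(A \<^bold>+ B) \<^bold>+ T = A \<^bold>+ (B \<^bold>+ T)" if T: "on T" "T \<notin> ?Z" for T
  proof -
    obtain x3 y3 where T': "T = Affine x3 y3" using T by (cases T) auto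
    have "x3 \<noteq> x1" "x3 \<noteq> x2"
      using same_abscissa T A B unfolding T' 4(1,2) by blast+
    moreover have "x3 \<noteq> x4"
      using same_abscissa T on_add[OF A B] unfolding T' 4(5) by blast
    moreover have "B \<^bold>+ T \<noteq> Infinity"
      using T by (auto simp: add_eq_Infinity_iff)
    then obtain x5 y5 where BT: "B \<^bold>+ T = Affine x5 y5" by (cases "B \<^bold>+ T") auto
    have "x5 \<noteq> x1"
    proof
      assume "x5 = x1"
      then have "B \<^bold>+ T \<in> {A, point_neg A}"
        using same_abscissa on_add[OF B T(1)] A unfolding BT 4(1) by blast
      moreover have "T = (B \<^bold>+ T) \<^bold>+ point_neg B"
        using add_diff_cancel[OF T(1) B] add_commute[OF B T(1)] by simp
      ultimately have "T \<in> {A \<^bold>+ point_neg B, point_neg A \<^bold>+ point_neg B}" by force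
      with T show False by blast
    qed
    ultimately show ?thesis
      using add_assoc_chords[OF 4(3,4), of x3 y3] T(1) BT unfolding T' 4(1,2) by blast
  qed
  then show ?thesis by (intro that[of ?Z]) auto
qed

text \<open>For generic \<open>T\<close>, both sides plus \<open>T\<close> agree by way of
  \<open>(A + B) + (C + T)\<close>, \<open>A + (B + (C + T))\<close> and
  \<open>A + ((B + C) + T)\<close>; then \<open>T\<close> is cancelled.\<close>

lemma add_assoc_if_infinite:
  assumes inf: "infinite {P. on P}" and on: "on A" "on B" "on C"
  shows "(A \<^bold>+ B) \<^bold>+ C = A \<^bold>+ (B \<^bold>+ C)"
proof -
  note on_add [simp] on [simp]
  obtain Z1 where Z1: "finite Z1" "\<And>T. on T \<Longrightarrow> T \<notin> Z1 \<Longrightarrow> ((A \<^bold>+ B) \<^bold>+ C) \<^bold>+ T = (A \<^bold>+ B) \<^bold>+ (C \<^bold>+ T)"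
    using add_assoc_off_finite[of "A \<^bold>+ B" C] by auto
  obtain Z2 where Z2: "finite Z2" "\<And>T. on T \<Longrightarrow> T \<notin> Z2 \<Longrightarrow> (A \<^bold>+ B) \<^bold>+ T = A \<^bold>+ (B \<^bold>+ T)"
    using add_assoc_off_finite[of A B] by auto
  obtain Z3 where Z3: "finite Z3" "\<And>T. on T \<Longrightarrow> T \<notin> Z3 \<Longrightarrow> (B \<^bold>+ C) \<^bold>+ T = B \<^bold>+ (C \<^bold>+ T)"
    using add_assoc_off_finite[of B C] by auto
  obtain Z4 where Z4: "finite Z4" "\<And>T. on T \<Longrightarrow> T \<notin> Z4 \<Longrightarrow> (A \<^bold>+ (B \<^bold>+ C)) \<^bold>+ T = A \<^bold>+ ((B \<^bold>+ C) \<^bold>+ T)"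
    using add_assoc_off_finite[of A "B \<^bold>+ C"] by auto
  \<comment> \<open>The second use of generic associativity has \<open>C + T\<close> as its third
    point, so its exceptional set is shifted back by \<open>C\<close>.\<close>
  define Z where "Z = Z1 \<union> Z3 \<union> Z4 \<union> (\<lambda>S. S \<^bold>+ point_neg C) ` Z2"
  have "finite Z" using Z1 Z2 Z3 Z4 by (simp add: Z_def)
  then have "\<not> {P. on P} \<subseteq> Z" using inf finite_subset by blast
  then obtain T where T [simp]: "on T" and "T \<notin> Z" by blast
  then have T1: "T \<notin> Z1" "T \<notin> Z3" "T \<notin> Z4" and "C \<^bold>+ T \<notin> Z2"
    using add_diff_cancel[OF T on(3)] add_commute[OF on(3) T] unfolding Z_def by
      (auto simp: image_iff)
  then have "((A \<^bold>+ B) \<^bold>+ C) \<^bold>+ T = (A \<^bold>+ (B \<^bold>+ C)) \<^bold>+ T"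
    using Z1(2) Z2(2)[of "C \<^bold>+ T"] Z3(2) Z4(2) by simp
  then show ?thesis
    using add_diff_cancel[of _ T] by (metis T on on_add)
qed

end

section \<open>Descent of associativity from the algebraic closure\<close>

lemma map_point_add:
  "map_point to_ac (point_add (short_weierstrass a b) P Q) =
    point_add (short_weierstrass (to_ac a) (to_ac b)) (map_point to_ac P) (map_point to_ac Q)"
  for P Q :: "'k::field point"
proof (cases P; cases Q)
  fix x1 y1 x2 y2 assume *: "P = Affine x1 y1" "Q = Affine x2 y2"
  have "to_ac y1 + to_ac y2 = 0 \<longleftrightarrow> y1 + y2 = 0"
    by (metis to_ac_add to_ac_eq_0_iff)
  then show ?thesis unfolding * by (simp add: Let_def)
qed auto

lemma on_curve_map_point:
  "on_curve (to_ac a) (to_ac b) (map_point to_ac P) \<longleftrightarrow> on_curve a b P" for P :: "'k::field point"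
proof (cases P)
  case (Affine x y)
  have "(to_ac y)\<^sup>2 = to_ac x ^ 3 + to_ac a * to_ac x + to_ac b \<longleftrightarrow> to_ac (y\<^sup>2) = to_ac (x ^ 3 + a * x + b)"
    by simp
  then show ?thesis unfolding Affine by (simp del: to_ac_power to_ac_add to_ac_mult)
qed simp

lemma infinite_on_curve:
  assumes "infinite (UNIV :: 'a::alg_closed_field set)"
  shows "infinite {P. on_curve (a :: 'a) b P}"
proof
  assume fin: "finite {P. on_curve a b P}"
  have "\<exists>y. on_curve a b (Affine x y)" for x
    using nth_root_exists[of 2 "x ^ 3 + a * x + b"] by auto
  then obtain f where f: "on_curve a b (Affine x (f x))" for x by metis
  have "inj (\<lambda>x. Affine x (f x))" by (auto intro: injI)
  moreover have "range (\<lambda>x. Affine x (f x)) \<subseteq> {P. on_curve a b P}" using f by auto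
  ultimately show False using assms fin finite_subset finite_imageD by metis
qed

lemma infinite_alg_closure: "infinite (UNIV :: 'k::field_char_0 alg_closure set)"
proof -
  have "infinite (range (to_ac :: 'k \<Rightarrow> 'k alg_closure))"
    by (simp add: finite_image_iff inj_to_ac infinite_UNIV_char_0)
  then show ?thesis
    by (rule contrapos_nn) (rule finite_subset[OF subset_UNIV])
qed

text \<open>The curve may have few points over the ground field. Over the algebraic closure every
  abscissa occurs, so generic associativity suffices there, and the embedding is injective and
  compatible with addition.\<close>

lemma point_add_assoc:
  fixes a b :: "'k::field_char_0"
  assumes "4 * a ^ 3 + 27 * b\<^sup>2 \<noteq> 0" and on: "on_curve a b P" "on_curve a b Q" "on_curve a b R"
  shows "point_add (short_weierstrass a b) (point_add (short_weierstrass a b) P Q) R =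
    point_add (short_weierstrass a b) P (point_add (short_weierstrass a b) Q R)"
proof -
  interpret nonsingular_cubic "to_ac a" "to_ac b"
  proof
    show "(2 :: 'k alg_closure) \<noteq> 0"
      using to_ac_eq_0_iff[of "2 :: 'k"] by (simp del: to_ac_eq_0_iff)
    have "to_ac (4 * a ^ 3 + 27 * b\<^sup>2) \<noteq> 0" using assms(1) by
      (simp only: to_ac_eq_0_iff not_False_eq_True)
    then show "4 * to_ac a ^ 3 + 27 * (to_ac b)\<^sup>2 \<noteq> 0" by simp
  qed
  have "inj (map_point (to_ac :: 'k \<Rightarrow> _))"
    using inj_to_ac by (rule point.inj_map)
  then show ?thesis
    using add_assoc_if_infinite[OF infinite_on_curve[OF infinite_alg_closure], of "map_point to_ac P" "map_point to_ac Q" "map_point to_ac R"] on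
    by (simp add: on_curve_map_point flip: map_point_add) (simp add: inj_def)
qed

lemma mem_rational_points: "P \<in> carrier (rational_points (short_weierstrass a b)) \<longleftrightarrow> on_curve a b P"
  by (cases P) (auto simp: rational_points_def affine_points_def)

lemma comm_group_rational_points:
  fixes a b :: "'k::field_char_0"
  assumes "4 * a ^ 3 + 27 * b\<^sup>2 \<noteq> 0"
  shows "comm_group (rational_points (short_weierstrass a b))"
proof -
  interpret nonsingular_cubic a b
    using assms by unfold_locales simp_all
  have [simp]: "monoid.mult (rational_points (short_weierstrass a b)) = point_add (short_weierstrass a b)"
     "\<one>\<^bsub>rational_points (short_weierstrass a b)\<^esub> = Infinity"
    by (simp_all add: rational_points_def)
  show ?thesis
  proof (rule comm_groupI, goal_cases)
    case (3 P Q R)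
    then show ?case using point_add_assoc[OF assms] by (simp add: mem_rational_points)
  next
    case (6 P)
    then show ?case
      by (intro bexI[of _ "point_neg P"]) (simp_all add: mem_rational_points)
  qed (simp_all add: mem_rational_points on_add add_commute)
qed

section \<open>Isomorphisms of short Weierstrass curves\<close>

lemma eval2_add: "eval2 (p + q) z = eval2 p z + eval2 q z"
  and eval2_mult: "eval2 (p * q) z = eval2 p z * eval2 q z"
  and eval2_const: "eval2 [:[:r:]:] z = r"
  and eval2_pCons: "eval2 (pCons c p) z = poly c (fst z) + snd z * eval2 p z"
  for p q :: "'a::comm_ring_1 poly poly"
  by (simp_all add: eval2_def)

lemma eval2_compose: "\<exists>k. \<forall>z. eval2 k z = eval2 f (eval2 g z, eval2 h z)"
  for f g h :: "'a::comm_ring_1 poly poly"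
proof (induction f)
  case 0
  show ?case by (intro exI[of _ 0]) (simp add: eval2_def)
next
  case (pCons c f)
  have "\<exists>k. \<forall>z. eval2 k z = poly c (eval2 g z)" for c
  proof (induction c)
    case 0
    show ?case by (intro exI[of _ 0]) (simp add: eval2_def)
  next
    case (pCons r c)
    then obtain k where "\<forall>z. eval2 k z = poly c (eval2 g z)" by blast
    then show ?case
      by (intro exI[of _ "[:[:r:]:] + g * k"]) (simp add: eval2_add eval2_mult eval2_const)
  qed
  moreover from pCons obtain k where "\<forall>z. eval2 k z = eval2 f (eval2 g z, eval2 h z)" by blast
  moreover obtain k' where "\<forall>z. eval2 k' z = poly c (eval2 g z)" using calculation(1) by blast
  ultimately show ?case
    by (intro exI[of _ "k' + h * k"]) (simp add: eval2_add eval2_mult eval2_pCons)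
qed

definition polynomial_map :: "('a::comm_semiring_1 \<times> 'a \<Rightarrow> 'a \<times> 'a) \<Rightarrow> bool" where
  "polynomial_map \<phi> \<longleftrightarrow> (\<exists>f g. \<phi> = (\<lambda>z. (eval2 f z, eval2 g z)))"

definition inverse_maps :: "('a \<Rightarrow> 'b) \<Rightarrow> ('b \<Rightarrow> 'a) \<Rightarrow> 'a set \<Rightarrow> 'b set \<Rightarrow> bool" where
  "inverse_maps \<phi> \<psi> A B \<longleftrightarrow>
    \<phi> ` A \<subseteq> B \<and> \<psi> ` B \<subseteq> A \<and> (\<forall>z\<in>A. \<psi> (\<phi> z) = z) \<and> (\<forall>z\<in>B. \<phi> (\<psi> z) = z)"

lemma isomorphic_curves_iff:
  "isomorphic_curves V W \<longleftrightarrow>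
    (\<exists>\<phi> \<psi>. polynomial_map \<phi> \<and> polynomial_map \<psi> \<and>
      inverse_maps \<phi> \<psi> (affine_points V) (affine_points W))"
proof -
  have "isomorphic_curves V W \<longleftrightarrow> (\<exists>f g f' g'. inverse_maps (\<lambda>z. (eval2 f z, eval2 g z))
      (\<lambda>z. (eval2 f' z, eval2 g' z)) (affine_points V) (affine_points W))"
    unfolding isomorphic_curves_def inverse_maps_def Let_def by (rule refl)
  then show ?thesis unfolding polynomial_map_def by auto
qed

lemma isomorphic_curves_sym: "isomorphic_curves V W \<Longrightarrow> isomorphic_curves W V"
  unfolding isomorphic_curves_iff inverse_maps_def by auto

lemma isomorphic_curves_trans:
  assumes "isomorphic_curves U V" "isomorphic_curves V W"
  shows "isomorphic_curves U W"
proof -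
  have comp: "polynomial_map (\<psi> \<circ> \<phi>)"
    if maps: "polynomial_map \<phi>" "polynomial_map \<psi>" for \<phi> \<psi> :: "'a \<times> 'a \<Rightarrow> 'a \<times> 'a"
  proof -
    obtain f g f' g' where *: "\<phi> = (\<lambda>z. (eval2 f z, eval2 g z))" "\<psi> = (\<lambda>z. (eval2 f' z, eval2 g' z))"
      using maps unfolding polynomial_map_def by blast
    obtain k k' where "\<forall>z. eval2 k z = eval2 f' (eval2 f z, eval2 g z)"
        "\<forall>z. eval2 k' z = eval2 g' (eval2 f z, eval2 g z)"
      using eval2_compose[of f' f g] eval2_compose[of g' f g] by blast
    then have "\<psi> \<circ> \<phi> = (\<lambda>z. (eval2 k z, eval2 k' z))" by (simp add: * fun_eq_iff)
    then show ?thesis unfolding polynomial_map_def by blast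
  qed
  obtain \<phi>1 \<psi>1 where 1: "polynomial_map \<phi>1" "polynomial_map \<psi>1"
      "inverse_maps \<phi>1 \<psi>1 (affine_points U) (affine_points V)"
    using assms(1) unfolding isomorphic_curves_iff by auto
  obtain \<phi>2 \<psi>2 where 2: "polynomial_map \<phi>2" "polynomial_map \<psi>2"
      "inverse_maps \<phi>2 \<psi>2 (affine_points V) (affine_points W)"
    using assms(2) unfolding isomorphic_curves_iff by auto
  have "inverse_maps (\<phi>2 \<circ> \<phi>1) (\<psi>1 \<circ> \<psi>2) (affine_points U) (affine_points W)"
    using 1(3) 2(3) by (simp add: inverse_maps_def image_subset_iff)
  with comp[OF 1(1) 2(1)] comp[OF 2(2) 1(2)] show ?thesis
    unfolding isomorphic_curves_iff by blast
qed

section \<open>Pole orders of functions on the curve\<close>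

abbreviation deg :: "'a::zero poly \<Rightarrow> nat" where
  "deg \<equiv> Polynomial.degree"

abbreviation cubic :: "'a::comm_ring_1 \<Rightarrow> 'a \<Rightarrow> 'a poly" where
  "cubic a b \<equiv> [:b, a, 0, 1:]"

text \<open>The pole order of \<open>p(x) + q(x) y\<close> at infinity, where \<open>x\<close> has a double pole and \<open>y\<close> a triple one.\<close>

definition pole_order :: "'a::zero poly \<Rightarrow> 'a poly \<Rightarrow> nat" where
  "pole_order p q = max (2 * deg p) (if q = 0 then 0 else 2 * deg q + 3)"

lemma degree_cubic [simp]: "deg (cubic a b) = 3"
  by simp

text \<open>\<open>p^2 - cubic * q^2\<close> is the norm of \<open>p + q y\<close> over the
  polynomials in \<open>x\<close>. The degree of \<open>p^2\<close> is even and that of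
  \<open>cubic * q^2\<close> is odd, so leading terms never cancel.\<close>

lemma degree_norm:
  fixes p q :: "'a::field poly"
  assumes "p \<noteq> 0 \<or> q \<noteq> 0"
  shows "p\<^sup>2 - cubic a b * q\<^sup>2 \<noteq> 0"
    and "deg (p\<^sup>2 - cubic a b * q\<^sup>2) = pole_order p q"
proof -
  have 1: "deg (p\<^sup>2) = 2 * deg p"
    by (cases "p = 0") (simp_all add: power2_eq_square Polynomial.degree_mult_eq)
  have 2: "deg (cubic a b * q\<^sup>2) = 2 * deg q + 3" if "q \<noteq> 0"
    using that degree_cubic[of a b]
    by (simp add: power2_eq_square Polynomial.degree_mult_eq del: mult_pCons_left degree_pCons_eq_if)
  have odd: "2 * deg p \<noteq> 2 * deg q + 3" by presburger
  have main: "p\<^sup>2 - cubic a b * q\<^sup>2 \<noteq> 0 \<and> deg (p\<^sup>2 - cubic a b * q\<^sup>2) = pole_order p q"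
  proof (cases "q = 0")
    case True
    then show ?thesis using assms 1 by (simp add: pole_order_def)
  next
    case False
    have "deg (p\<^sup>2) \<noteq> deg (cubic a b * q\<^sup>2)"
      using 1 2[OF False] odd by simp
    then consider "deg (p\<^sup>2) < deg (cubic a b * q\<^sup>2)"
      | "deg (cubic a b * q\<^sup>2) < deg (p\<^sup>2)" by linarith
    then have "deg (p\<^sup>2 - cubic a b * q\<^sup>2) = max (deg (p\<^sup>2)) (deg (cubic a b * q\<^sup>2))"
    proof cases
      case 1
      then show ?thesis
        using degree_add_eq_right[of "p\<^sup>2" "- (cubic a b * q\<^sup>2)"] by (simp del: mult_pCons_left)
    next
      case 2
      then show ?thesis
        using degree_add_eq_left[of "- (cubic a b * q\<^sup>2)" "p\<^sup>2"] by (simp del: mult_pCons_left)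
    qed
    then have "deg (p\<^sup>2 - cubic a b * q\<^sup>2) = pole_order p q"
      using 1 2[OF False] False by (simp add: pole_order_def)
    moreover from this have "deg (p\<^sup>2 - cubic a b * q\<^sup>2) \<noteq> 0"
      using False by (simp add: pole_order_def)
    ultimately show ?thesis by force
  qed
  from main show "p\<^sup>2 - cubic a b * q\<^sup>2 \<noteq> 0" by blast
  from main show "deg (p\<^sup>2 - cubic a b * q\<^sup>2) = pole_order p q" by blast
qed

lemma pole_order_add:
  fixes p q r s :: "'a::field poly"
  assumes "pole_order r s < pole_order p q"
  shows "pole_order (p + r) (q + s) = pole_order p q"
proof -
  have le: "deg (p + r) \<le> max (deg p) (deg r)"
      "deg (q + s) \<le> max (deg q) (deg s)"
    by (auto intro: degree_add_le_max)
  show ?thesis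
  proof (cases "2 * deg p \<le> (if q = 0 then 0 else 2 * deg q + 3)")
    case True
    then have "q \<noteq> 0" using assms by (auto simp: pole_order_def split: if_splits)
    then have *: "pole_order p q = 2 * deg q + 3" using True by (simp add: pole_order_def)
    have "s = 0 \<or> deg s < deg q"
      using assms unfolding * by (auto simp: pole_order_def split: if_splits)
    then have "deg (q + s) = deg q \<and> q + s \<noteq> 0"
    proof
      assume "deg s < deg q"
      then have "deg (q + s) = deg q" by (rule degree_add_eq_left)
      moreover from this have "q + s \<noteq> 0" using \<open>deg s < deg q\<close> by auto
      ultimately show ?thesis by blast
    qed (use \<open>q \<noteq> 0\<close> in simp)
    moreover have "2 * deg r < 2 * deg q + 3"
      using assms unfolding * by (auto simp: pole_order_def)
    ultimately show ?thesis
      using le True \<open>q \<noteq> 0\<close> unfolding * by (auto simp: pole_order_def)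
  next
    case False
    then have *: "pole_order p q = 2 * deg p" by (simp add: pole_order_def)
    have "2 * deg r < 2 * deg p"
      using assms unfolding * by (auto simp: pole_order_def)
    then have "deg (p + r) = deg p" by (intro degree_add_eq_left) simp
    moreover have "q + s = 0 \<or> 2 * deg (q + s) + 3 \<le> 2 * deg p"
      using assms le False unfolding * by (auto simp: pole_order_def max_def split: if_splits)
    ultimately show ?thesis unfolding * by (auto simp: pole_order_def)
  qed
qed

text \<open>\<open>p + q y\<close> is the normal form of an element of the coordinate ring. The
  comparison is pointwise because a morphism is given only as a map on points.\<close>

definition represents :: "'a::field \<Rightarrow> 'a \<Rightarrow> ('a \<Rightarrow> 'a \<Rightarrow> 'a) \<Rightarrow> 'a poly \<Rightarrow> 'a poly \<Rightarrow> bool" where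
  "represents a b h p q \<longleftrightarrow>
    (\<forall>x y. y\<^sup>2 = x ^ 3 + a * x + b \<longrightarrow> h x y = poly p x + poly q x * y)"

text \<open>The zero function is left without a pole order. Uniqueness of \<open>n\<close> is proved
  later, over an infinite algebraically closed field, where functions determine their normal
  forms.\<close>

definition has_pole_order :: "'a::field \<Rightarrow> 'a \<Rightarrow> ('a \<Rightarrow> 'a \<Rightarrow> 'a) \<Rightarrow> nat \<Rightarrow> bool" where
  "has_pole_order a b h n \<longleftrightarrow>
    (\<exists>p q. represents a b h p q \<and> (p \<noteq> 0 \<or> q \<noteq> 0) \<and> pole_order p q = n)"

lemma poly_cubic: "poly (cubic a b) x = x ^ 3 + a * x + b"
  by (simp add: power3_eq_cube algebra_simps)

lemma represents_mult:
  assumes "represents a b h p q" "represents a b g r s"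
  shows "represents a b (\<lambda>x y. h x y * g x y) (p * r + cubic a b * q * s) (p * s + q * r)"
proof -
  have "(P + Q * y) * (R + S * y) = P * R + (x ^ 3 + a * x + b) * Q * S + (P * S + Q * R) * y"
    if "y\<^sup>2 = x ^ 3 + a * x + b" for P Q R S x y
    using diff_eq_0[OF that] by Groebner_Basis.algebra
  with assms show ?thesis
    by (simp add: represents_def poly_cubic del: mult_pCons_left poly_pCons)
qed

lemma represents_add:
  "represents a b h p q \<Longrightarrow> represents a b g r s \<Longrightarrow>
    represents a b (\<lambda>x y. h x y + g x y) (p + r) (q + s)"
  by (simp add: represents_def algebra_simps)

text \<open>The norm is multiplicative and its degree is the pole order, so no case distinction on
  the leading terms of the product is needed.\<close>

lemma has_pole_order_mult:
  assumes "has_pole_order a b h m" "has_pole_order a b g n"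
  shows "has_pole_order a b (\<lambda>x y. h x y * g x y) (m + n)"
proof -
  obtain p q where 1: "represents a b h p q" "p \<noteq> 0 \<or> q \<noteq> 0" "pole_order p q = m"
    using assms(1) unfolding has_pole_order_def by blast
  obtain r s where 2: "represents a b g r s" "r \<noteq> 0 \<or> s \<noteq> 0" "pole_order r s = n"
    using assms(2) unfolding has_pole_order_def by blast
  let ?P = "p * r + cubic a b * q * s" and ?Q = "p * s + q * r"
  have N: "?P\<^sup>2 - cubic a b * ?Q\<^sup>2 = (p\<^sup>2 - cubic a b * q\<^sup>2) * (r\<^sup>2 - cubic a b * s\<^sup>2)"
    by (simp add: power2_eq_square algebra_simps del: mult_pCons_left mult_pCons_right)
  then have "?P\<^sup>2 - cubic a b * ?Q\<^sup>2 \<noteq> 0"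
    using degree_norm(1)[OF 1(2)] degree_norm(1)[OF 2(2)] by (simp del: mult_pCons_left)
  then have ne: "?P \<noteq> 0 \<or> ?Q \<noteq> 0" by (auto simp del: mult_pCons_left)
  have "pole_order ?P ?Q = m + n"
    using degree_norm[OF ne, of b a] degree_norm[OF 1(2), of b a] degree_norm[OF 2(2), of b a] 1(3) 2(3)
    unfolding N by (simp add: Polynomial.degree_mult_eq del: mult_pCons_left)
  with ne represents_mult[OF 1(1) 2(1)] show ?thesis
    unfolding has_pole_order_def by blast
qed

lemma has_pole_order_add:
  assumes "has_pole_order a b h m" "has_pole_order a b g n" "n < m"
  shows "has_pole_order a b (\<lambda>x y. h x y + g x y) m"
proof -
  obtain p q where 1: "represents a b h p q" "p \<noteq> 0 \<or> q \<noteq> 0" "pole_order p q = m"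
    using assms(1) unfolding has_pole_order_def by blast
  obtain r s where 2: "represents a b g r s" "r \<noteq> 0 \<or> s \<noteq> 0" "pole_order r s = n"
    using assms(2) unfolding has_pole_order_def by blast
  have *: "pole_order (p + r) (q + s) = m"
    using pole_order_add 1 2 assms(3) by metis
  moreover have "p + r \<noteq> 0 \<or> q + s \<noteq> 0"
    using * assms(3) by (auto simp: pole_order_def)
  ultimately show ?thesis
    using represents_add[OF 1(1) 2(1)] unfolding has_pole_order_def by blast
qed

lemma has_pole_order_const: "c \<noteq> 0 \<Longrightarrow> has_pole_order a b (\<lambda>_ _. c) 0"
  unfolding has_pole_order_def represents_def
  by (intro exI[of _ "[:c:]"] exI[of _ 0]) (simp add: pole_order_def)

lemma has_pole_order_x: "has_pole_order a b (\<lambda>x _. x) 2"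
  unfolding has_pole_order_def represents_def
  by (intro exI[of _ "[:0, 1:]"] exI[of _ 0]) (simp add: pole_order_def)

lemma has_pole_order_y: "has_pole_order a b (\<lambda>_ y. y) 3"
  unfolding has_pole_order_def represents_def
  by (intro exI[of _ 0] exI[of _ 1]) (simp add: pole_order_def)

text \<open>As \<open>m > 0\<close>, the powers of \<open>h\<close> have distinct pole orders and
  the highest one prevails.\<close>

lemma has_pole_order_poly:
  assumes "has_pole_order a b h m" "m > 0" "A \<noteq> 0"
  shows "has_pole_order a b (\<lambda>x y. poly A (h x y)) (m * deg A)"
  using assms(3)
proof (induction A)
  case (pCons c A)
  show ?case
  proof (cases "A = 0")
    case True
    then show ?thesis using pCons has_pole_order_const[of c] by simp
  next
    case False
    then have *: "has_pole_order a b (\<lambda>x y. h x y * poly A (h x y)) (m + m * deg A)"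
      using pCons has_pole_order_mult[OF assms(1)] by blast
    show ?thesis
    proof (cases "c = 0")
      case True
      then show ?thesis using * False by simp
    next
      case False
      from has_pole_order_add[OF * has_pole_order_const[OF False]] show ?thesis
        using assms(2) \<open>A \<noteq> 0\<close> by (simp add: add.commute)
    qed
  qed
qed simp

lemma represents_exists: "\<exists>p q. represents a b (\<lambda>x y. eval2 f (x, y)) p q"
proof (induction f)
  case 0
  show ?case
    by (intro exI[of _ 0]) (simp add: represents_def eval2_def)
next
  case (pCons c f)
  then obtain p q where "represents a b (\<lambda>x y. eval2 f (x, y)) p q" by blast
  moreover have "represents a b (\<lambda>x y. y) 0 1" by (simp add: represents_def)
  ultimately have "\<exists>p q. represents a b (\<lambda>x y. y * eval2 f (x, y)) p q"
    using represents_mult by blast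
  moreover have "represents a b (\<lambda>x y. poly c x) c 0" by (simp add: represents_def)
  ultimately show ?case
    using represents_add[of a b "\<lambda>x y. poly c x" c 0] unfolding eval2_pCons fst_conv snd_conv
    by blast
qed

lemma infinite_poly_eq_0:
  assumes "infinite (UNIV :: 'a::idom set)" "\<And>x. poly p x = 0"
  shows "p = (0 :: 'a poly)"
  using assms poly_roots_finite[of p] by auto

context
  fixes a b :: "'a::alg_closed_field"
  assumes inf: "infinite (UNIV :: 'a set)"
begin

lemma exists_ordinate: "\<exists>y :: 'a. y\<^sup>2 = x ^ 3 + a * x + b"
  using nth_root_exists[of 2 "x ^ 3 + a * x + b"] by auto

text \<open>If \<open>p + q y\<close> vanishes on the curve, so does its product with
  \<open>p - q y\<close>, the norm. Every \<open>x\<close> is the abscissa of a point, so the norm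
  has infinitely many zeros, whereas it is nonzero for a nonzero pair.\<close>

lemma represents_zero:
  assumes "represents a b (\<lambda>_ _. 0) p q"
  shows "p = 0 \<and> q = 0"
proof (rule ccontr)
  assume "\<not> (p = 0 \<and> q = 0)"
  then have "p\<^sup>2 - cubic a b * q\<^sup>2 \<noteq> 0" using degree_norm by blast
  moreover have "poly (p\<^sup>2 - cubic a b * q\<^sup>2) x = 0" for x
  proof -
    obtain y where y: "y\<^sup>2 = x ^ 3 + a * x + b" using exists_ordinate by blast
    then have "poly p x + poly q x * y = 0"
      using assms by (auto simp: represents_def)
    then have "(poly p x)\<^sup>2 - y\<^sup>2 * (poly q x)\<^sup>2 = 0"
      by Groebner_Basis.algebra
    then show ?thesis
      by (simp add: poly_cubic y del: poly_pCons mult_pCons_left)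
  qed
  ultimately show False using infinite_poly_eq_0[OF inf] by blast
qed

lemma represents_unique:
  assumes "represents a b h p q" "represents a b h r s"
  shows "p = r \<and> q = s"
proof -
  have "0 = poly (p - r) x + poly (q - s) x * y" if "y\<^sup>2 = x ^ 3 + a * x + b" for x y
  proof -
    have "poly p x + poly q x * y = poly r x + poly s x * y"
      using assms that unfolding represents_def by metis
    then show ?thesis by (simp add: algebra_simps)
  qed
  then show ?thesis
    using represents_zero[of "p - r" "q - s"] by (simp add: represents_def)
qed

lemma has_pole_order_unique:
  assumes "has_pole_order a b h m" "has_pole_order a b h n"
  shows "m = n"
  using assms represents_unique unfolding has_pole_order_def by blast

lemma not_has_pole_order_zero:
  assumes "represents a b h 0 0"
  shows "\<not> has_pole_order a b h n"
proof
  assume "has_pole_order a b h n"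
  then obtain p q where "represents a b h p q" "p \<noteq> 0 \<or> q \<noteq> 0"
    unfolding has_pole_order_def by blast
  with represents_unique[OF assms] show False by metis
qed

lemma has_pole_order_cong:
  assumes "\<And>x y. y\<^sup>2 = x ^ 3 + a * x + b \<Longrightarrow> h x y = g x y"
  shows "has_pole_order a b h n \<longleftrightarrow> has_pole_order a b g n"
proof -
  have "represents a b h p q \<longleftrightarrow> represents a b g p q" for p q
    unfolding represents_def by (intro iff_allI imp_cong refl) (drule assms, simp)
  then show ?thesis unfolding has_pole_order_def by (intro iff_exI) (simp only:)
qed

text \<open>A polynomial map into another cubic, composed with a function there, multiplies pole
  orders by a constant \<open>k\<close>; for an isomorphism \<open>k = 1\<close> because the pole orders 2 and 3 occur.\<close>

lemma polynomial_map_pole_orders: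
  assumes cub: "\<And>x y. y\<^sup>2 = x ^ 3 + a * x + b \<Longrightarrow> (G x y)\<^sup>2 = (F x y) ^ 3 + a' * F x y + b'"
    and F: "represents a b F p1 q1" and G: "represents a b G p2 q2"
    and inv: "\<And>x y. y\<^sup>2 = x ^ 3 + a * x + b \<Longrightarrow>
      poly A (F x y) + poly B (F x y) * G x y = x \<and> poly C (F x y) + poly D (F x y) * G x y = y"
  shows "has_pole_order a b F 2" "has_pole_order a b G 3"
proof -
  define m where "m = pole_order p1 q1"
  have m0: "m \<noteq> 0"
  proof
    assume "m = 0"
    then have "q1 = 0" "deg p1 = 0" by (auto simp: m_def pole_order_def split: if_splits)
    then obtain c where F_c: "F x y = c" if "y\<^sup>2 = x ^ 3 + a * x + b" for x y
      using F by (auto simp: represents_def elim!: degree_eq_zeroE)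
    \<comment> \<open>If \<open>F\<close> were a constant \<open>c\<close>, then \<open>G^2\<close>
      would be the constant \<open>e\<close>, and \<open>x = A(c) + B(c) G\<close> would give a
      quadratic equation satisfied by every \<open>x\<close>.\<close>
    define e where "e = c ^ 3 + a' * c + b'"
    have "poly ([:- poly A c, 1:]\<^sup>2 - [:e * (poly B c)\<^sup>2:]) x = 0" for x
    proof -
      obtain y where y: "y\<^sup>2 = x ^ 3 + a * x + b" using exists_ordinate by blast
      have "poly A c + poly B c * G x y = x" "(G x y)\<^sup>2 = e"
        using inv[OF y] cub[OF y] F_c[OF y] by (auto simp: e_def)
      moreover from this have "(x - poly A c)\<^sup>2 = e * (poly B c)\<^sup>2"
        by (metis add_diff_cancel_left' mult.commute power_mult_distrib)
      ultimately show ?thesis by simp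
    qed
    then have "[:- poly A c, 1:]\<^sup>2 = [:e * (poly B c)\<^sup>2:]"
      using infinite_poly_eq_0[OF inf] by (metis eq_iff_diff_eq_0)
    then have "deg ([:- poly A c, 1:]\<^sup>2) = 0" by simp
    then show False by (simp add: Polynomial.degree_power_eq)
  qed
  then have F_ord: "has_pole_order a b F m"
    using F unfolding has_pole_order_def m_def
    by (intro exI[of _ p1] exI[of _ q1]) (auto simp: pole_order_def)
  have "has_pole_order a b (\<lambda>x y. poly (cubic a' b') (F x y)) (m * deg (cubic a' b'))"
    using m0 by (intro has_pole_order_poly[OF F_ord]) auto
  then have rhs: "has_pole_order a b (\<lambda>x y. G x y * G x y) (m * 3)"
    using has_pole_order_cong[of "\<lambda>x y. G x y * G x y" "\<lambda>x y. poly (cubic a' b') (F x y)"] cub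
    by (simp add: poly_cubic power2_eq_square degree_cubic del: poly_pCons degree_pCons_eq_if)
  define n where "n = pole_order p2 q2"
  have "p2 \<noteq> 0 \<or> q2 \<noteq> 0"
  proof (rule ccontr)
    assume "\<not> ?thesis"
    then have "represents a b (\<lambda>x y. G x y * G x y) 0 0"
      using G by (simp add: represents_def)
    with rhs not_has_pole_order_zero show False by blast
  qed
  then have G_ord: "has_pole_order a b G n"
    using G unfolding has_pole_order_def n_def by blast
  have "n + n = m * 3"
    using has_pole_order_unique[OF has_pole_order_mult[OF G_ord G_ord] rhs] .
  then have "m = 2 * (m div 2) \<and> n = 3 * (m div 2)" by presburger
  then obtain k where k: "m = 2 * k" "n = 3 * k" by (elim conjE) (rule that)
  have k_dvd: "k dvd r"
    if rep: "\<And>x y. y\<^sup>2 = x ^ 3 + a * x + b \<Longrightarrow> poly P (F x y) + poly Q (F x y) * G x y = h x y"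
      and h: "has_pole_order a b h r" for P Q h r
  proof -
    have P: "has_pole_order a b (\<lambda>x y. poly P (F x y)) (m * deg P)" if "P \<noteq> 0"
      using that m0 by (intro has_pole_order_poly[OF F_ord]) auto
    have Q: "has_pole_order a b (\<lambda>x y. poly Q (F x y) * G x y) (m * deg Q + n)" if "Q \<noteq> 0"
      using that m0 by (intro has_pole_order_mult has_pole_order_poly[OF F_ord] G_ord) auto
    let ?h = "\<lambda>x y. poly P (F x y) + poly Q (F x y) * G x y"
    have h': "has_pole_order a b ?h r"
      using has_pole_order_cong[of "\<lambda>x y. poly P (F x y) + poly Q (F x y) * G x y" h r] rep h
      by blast
    consider "P = 0" "Q = 0" | "P \<noteq> 0" "Q = 0" | "P = 0" "Q \<noteq> 0" | "P \<noteq> 0" "Q \<noteq> 0" by blast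
    then show ?thesis
    proof cases
      case 1
      then have "represents a b (\<lambda>x y. poly P (F x y) + poly Q (F x y) * G x y) 0 0"
        by (simp add: represents_def)
      with h' not_has_pole_order_zero show ?thesis by blast
    next
      case 2
      then have "has_pole_order a b ?h (m * deg P)" using P by simp
      then have "r = m * deg P" by (rule has_pole_order_unique[OF h'])
      then show ?thesis using k by simp
    next
      case 3
      then have "has_pole_order a b ?h (m * deg Q + n)" using Q by simp
      then have "r = m * deg Q + n" by (rule has_pole_order_unique[OF h'])
      then show ?thesis using k by simp
    next
      case 4
      \<comment> \<open>These are \<open>k\<close> times an even and \<open>k\<close> times an odd
        number, so the poles of the two summands cannot cancel.\<close>
      have "m * deg P \<noteq> m * deg Q + n"
      proof
        assume "m * deg P = m * deg Q + n"
        then have "k * (2 * deg P) = k * (2 * deg Q + 3)"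
          by (simp add: k algebra_simps)
        then have "2 * deg P = 2 * deg Q + 3" using m0 k by simp
        then show False by presburger
      qed
      then consider "m * deg P < m * deg Q + n"
        | "m * deg Q + n < m * deg P" by linarith
      then show ?thesis
      proof cases
        case 1
        from has_pole_order_add[OF Q[OF 4(2)] P[OF 4(1)] this]
        have "has_pole_order a b ?h (m * deg Q + n)" by (simp add: add.commute)
        then have "r = m * deg Q + n" by (rule has_pole_order_unique[OF h'])
        then show ?thesis using k by simp
      next
        case 2
        from has_pole_order_add[OF P[OF 4(1)] Q[OF 4(2)] this]
        have "r = m * deg P" by (rule has_pole_order_unique[OF h'])
        then show ?thesis using k by simp
      qed
    qed
  qed
  have "k dvd 2" "k dvd 3"
    using k_dvd[OF _ has_pole_order_x] k_dvd[OF _ has_pole_order_y] inv by blast+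
  then have "k dvd 3 - 2" by (rule dvd_diff_nat[rotated])
  then have "k = 1" by simp
  then show "has_pole_order a b F 2" "has_pole_order a b G 3"
    using F_ord G_ord k by simp_all
qed

text \<open>The pole orders 2 and 3 leave \<open>F = \<beta> + \<alpha> x\<close> and
  \<open>G = \<epsilon> + \<delta> x + \<gamma> y\<close>. Substituting into the second equation and
  comparing normal forms kills \<beta>, \<delta> and \<epsilon>, where 2 and 3 have to be
  invertible, and gives \<open>\<gamma>^2 = \<alpha>^3\<close>.\<close>

lemma isomorphic_short_curves:
  fixes a' b' :: 'a
  assumes six: "(2 :: 'a) \<noteq> 0" "(3 :: 'a) \<noteq> 0"
    and iso: "isomorphic_curves (short_weierstrass a b) (short_weierstrass a' b')"
  obtains u where "u \<noteq> 0" "a' = u ^ 4 * a" "b' = u ^ 6 * b"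
proof -
  obtain \<phi> \<psi> where "polynomial_map \<phi>" "polynomial_map \<psi>"
    and inv: "inverse_maps \<phi> \<psi> (affine_points (short_weierstrass a b)) (affine_points (short_weierstrass a' b'))"
    using iso unfolding isomorphic_curves_iff by auto
  then obtain f g f' g' where \<phi>: "\<phi> = (\<lambda>z. (eval2 f z, eval2 g z))"
    and \<psi>: "\<psi> = (\<lambda>z. (eval2 f' z, eval2 g' z))"
    unfolding polynomial_map_def by blast
  have V: "(x, y) \<in> affine_points (short_weierstrass a b) \<longleftrightarrow> y\<^sup>2 = x ^ 3 + a * x + b"
    and W: "(x, y) \<in> affine_points (short_weierstrass a' b') \<longleftrightarrow> y\<^sup>2 = x ^ 3 + a' * x + b'" for x y
    by (simp_all add: affine_points_def)
  define F where "F x y = eval2 f (x, y)" for x y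
  define G where "G x y = eval2 g (x, y)" for x y
  obtain p1 q1 where F: "represents a b F p1 q1"
    using represents_exists[of a b f] unfolding F_def[abs_def] by blast
  obtain p2 q2 where G: "represents a b G p2 q2"
    using represents_exists[of a b g] unfolding G_def[abs_def] by blast
  obtain A B where AB: "represents a' b' (\<lambda>x y. eval2 f' (x, y)) A B"
    using represents_exists by blast
  obtain C D where CD: "represents a' b' (\<lambda>x y. eval2 g' (x, y)) C D"
    using represents_exists by blast
  have cub: "(G x y)\<^sup>2 = (F x y) ^ 3 + a' * F x y + b'" if "y\<^sup>2 = x ^ 3 + a * x + b" for x y
  proof -
    have "\<phi> (x, y) \<in> affine_points (short_weierstrass a' b')"
      using inv that V unfolding inverse_maps_def by blast
    then show ?thesis by (simp only: \<phi> W F_def G_def)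
  qed
  have pull: "poly A (F x y) + poly B (F x y) * G x y = x \<and> poly C (F x y) + poly D (F x y) * G x y = y"
    if "y\<^sup>2 = x ^ 3 + a * x + b" for x y
  proof -
    have "\<psi> (\<phi> (x, y)) = (x, y)"
      using inv that V unfolding inverse_maps_def by blast
    then have "eval2 f' (F x y, G x y) = x \<and> eval2 g' (F x y, G x y) = y"
      by (simp add: \<phi> \<psi> F_def G_def)
    then show ?thesis using AB CD cub[OF that] by (simp add: represents_def)
  qed
  note ords = polynomial_map_pole_orders[OF cub F G pull]
  have "pole_order p1 q1 = 2"
    using ords(1) represents_unique[OF F] unfolding has_pole_order_def by blast
  then have "q1 = 0" "deg p1 = 1"
    by (auto simp: pole_order_def max_def split: if_splits)
  then obtain \<beta> \<alpha> where p1: "p1 = [:\<beta>, \<alpha>:]" and \<alpha>: "\<alpha> \<noteq> 0"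
    using degree1_coeffs by blast
  have "pole_order p2 q2 = 3"
    using ords(2) represents_unique[OF G] unfolding has_pole_order_def by blast
  moreover have "2 * deg p2 \<noteq> 3" by presburger
  ultimately have "q2 \<noteq> 0" "deg q2 = 0" and p2_deg: "deg p2 \<le> 1"
    by (auto simp: pole_order_def max_def split: if_splits)
  then obtain \<gamma> where q2: "q2 = [:\<gamma>:]" and \<gamma>: "\<gamma> \<noteq> 0"
    by (auto elim: degree_eq_zeroE)
  obtain \<epsilon> \<delta> where p2: "p2 = [:\<epsilon>, \<delta>:]"
  proof -
    obtain \<epsilon> r where r: "p2 = pCons \<epsilon> r" by (cases p2)
    then have "deg r = 0" using p2_deg by (auto split: if_splits)
    then obtain \<delta> where "r = [:\<delta>:]" by (rule degree_eq_zeroE)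
    then show ?thesis using r that by blast
  qed
  \<comment> \<open>The normal form of \<open>G^2 - (F^3 + a' F + b')\<close> after
    \<open>y^2\<close> is eliminated by the first curve equation.\<close>
  let ?P = "[:\<gamma>\<^sup>2 * b + \<epsilon>\<^sup>2 - \<beta> ^ 3 - a' * \<beta> - b', \<gamma>\<^sup>2 * a + 2 * \<epsilon> * \<delta> - 3 * \<alpha> * \<beta>\<^sup>2 - a' * \<alpha>,
    \<delta>\<^sup>2 - 3 * \<alpha>\<^sup>2 * \<beta>, \<gamma>\<^sup>2 - \<alpha> ^ 3:]" and ?Q = "[:2 * \<gamma> * \<epsilon>, 2 * \<gamma> * \<delta>:]"
  have zero: "0 = poly ?P x + poly ?Q x * y" if "y\<^sup>2 = x ^ 3 + a * x + b" for x y
  proof -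
    have Fxy: "F x y = \<beta> + \<alpha> * x" and Gxy: "G x y = \<epsilon> + \<delta> * x + \<gamma> * y"
      using F G that \<open>q1 = 0\<close> by (simp_all add: represents_def p1 p2 q2 algebra_simps)
    have "poly ?P x + poly ?Q x * y = ((\<epsilon> + \<delta> * x + \<gamma> * y)\<^sup>2
        - ((\<beta> + \<alpha> * x) ^ 3 + a' * (\<beta> + \<alpha> * x) + b')) - \<gamma>\<^sup>2 * (y\<^sup>2 - (x ^ 3 + a * x + b))"
      unfolding poly_pCons poly_0 by Groebner_Basis.algebra
    then show ?thesis
      using cub[OF that] that unfolding Fxy Gxy by simp
  qed
  have "represents a b (\<lambda>_ _. 0) ?P ?Q"
    unfolding represents_def by (intro allI impI zero)
  from represents_zero[OF this] have PQ: "?P = 0" "?Q = 0" by auto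
  then have "\<epsilon> = 0" "\<delta> = 0" using six \<gamma> by auto
  with PQ six \<alpha> have "\<beta> = 0" by auto
  with PQ \<open>\<epsilon> = 0\<close> \<open>\<delta> = 0\<close> have eqs: "b' = \<gamma>\<^sup>2 * b" "a' * \<alpha> = \<gamma>\<^sup>2 * a" "\<gamma>\<^sup>2 = \<alpha> ^ 3" by auto
  \<comment> \<open>From \<open>\<gamma>^2 = \<alpha>^3\<close> it follows that
    \<open>\<alpha> = u^2\<close> and \<open>\<gamma> = u^3\<close>.\<close>
  define u where "u = \<gamma> / \<alpha>"
  have "u\<^sup>2 = \<alpha> ^ 3 / \<alpha>\<^sup>2" by (simp add: u_def power_divide eqs(3))
  then have u2: "\<alpha> = u\<^sup>2" using \<alpha> by (simp add: power2_eq_square power3_eq_cube)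
  have "\<alpha> * a' = \<alpha> * (\<alpha>\<^sup>2 * a)"
    using eqs(2) unfolding eqs(3) by (simp add: power2_eq_square power3_eq_cube mult.commute mult.left_commute)
  then have "a' = \<alpha>\<^sup>2 * a" using \<alpha> by simp
  then have "a' = u ^ 4 * a" by (simp add: u2 flip: power_mult)
  moreover have "b' = u ^ 6 * b" unfolding eqs(1,3) by (simp add: u2 flip: power_mult)
  ultimately show ?thesis using that[of u] \<alpha> \<gamma> by (simp add: u_def)
qed

end

section \<open>From general to short Weierstrass equations\<close>

lemma mem_affine_points_short:
  "(x, y) \<in> affine_points (short_weierstrass a b) \<longleftrightarrow> y\<^sup>2 = x ^ 3 + a * x + b"
  by (simp add: affine_points_def)

text \<open>The classical model \<open>y^2 = x^3 - 27 c4 x - 54 c6\<close>, reached by completing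
  the square and the cube with denominators cleared. Its coefficients are integer polynomials in
  those of \<open>V\<close>, so they lie in every field that contains the latter.\<close>

lemma isomorphic_curves_to_short:
  fixes V :: "'a::alg_closed_field weierstrass"
  assumes six: "(2 :: 'a) \<noteq> 0" "(3 :: 'a) \<noteq> 0"
  defines "b2 \<equiv> (a1 V)\<^sup>2 + 4 * a2 V" and "b4 \<equiv> 2 * a4 V + a1 V * a3 V"
    and "b6 \<equiv> (a3 V)\<^sup>2 + 4 * a6 V"
  shows "isomorphic_curves V
    (short_weierstrass (- 27 * (b2\<^sup>2 - 24 * b4)) (- 54 * (- (b2 ^ 3) + 36 * b2 * b4 - 216 * b6)))"
    (is "isomorphic_curves V ?W")
proof -
  let ?\<phi> = "\<lambda>z. (36 * fst z + 3 * b2, 108 * (2 * snd z + a1 V * fst z + a3 V))"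
  let ?x = "\<lambda>z. (fst z - 3 * b2) / 36"
  let ?\<psi> = "\<lambda>z. (?x z, (snd z / 108 - a1 V * ?x z - a3 V) / 2)"
  have "(36 :: 'a) = 2 * 2 * (3 * 3)" "(108 :: 'a) = 2 * 2 * (3 * 3 * 3)" by simp_all
  then have nz: "(36 :: 'a) \<noteq> 0" "(108 :: 'a) \<noteq> 0" using six by (simp_all only: mult_eq_0_iff) auto
  have "polynomial_map ?\<phi>"
    unfolding polynomial_map_def
    by (rule exI[of _ "[:[:3 * b2, 36:]:]"], rule exI[of _ "[:[:108 * a3 V, 108 * a1 V:], [:216:]:]"])
      (simp add: eval2_def fun_eq_iff algebra_simps)
  moreover have "polynomial_map ?\<psi>"
    unfolding polynomial_map_def
    by (rule exI[of _ "[:[:- 3 * b2 / 36, 1 / 36:]:]"],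
        rule exI[of _ "[:[:(a1 V * 3 * b2 / 36 - a3 V) / 2, - a1 V / 36 / 2:], [:1 / 108 / 2:]:]"])
      (simp add: eval2_def fun_eq_iff diff_divide_distrib add_divide_distrib algebra_simps)
  moreover have "inverse_maps ?\<phi> ?\<psi> (affine_points V) (affine_points ?W)"
  proof -
    have "(46656 :: 'a) = 36 * 36 * 36" by simp
    then have nz': "(46656 :: 'a) \<noteq> 0" using nz(1) by (simp only: mult_eq_0_iff simp_thms)
    \<comment> \<open>The substitution multiplies the equation by \<open>46656 = 6^6\<close>, which
      is nonzero, so membership transfers in both directions at once.\<close>
    have "(108 * (2 * y + a1 V * x + a3 V))\<^sup>2 - ((36 * x + 3 * b2) ^ 3
        + - 27 * (b2\<^sup>2 - 24 * b4) * (36 * x + 3 * b2) + - 54 * (- (b2 ^ 3) + 36 * b2 * b4 - 216 * b6)) =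
        46656 * (y\<^sup>2 + a1 V * x * y + a3 V * y - (x ^ 3 + a2 V * x\<^sup>2 + a4 V * x + a6 V))" for x y
      unfolding b2_def b4_def b6_def by Groebner_Basis.algebra
    then have "?\<phi> (x, y) \<in> affine_points ?W \<longleftrightarrow>
        46656 * (y\<^sup>2 + a1 V * x * y + a3 V * y - (x ^ 3 + a2 V * x\<^sup>2 + a4 V * x + a6 V)) = 0" for x y
      unfolding fst_conv snd_conv mem_affine_points_short by (subst eq_iff_diff_eq_0) simp
    then have "?\<phi> (x, y) \<in> affine_points ?W \<longleftrightarrow> (x, y) \<in> affine_points V" for x y
      unfolding affine_points_def[of V] using nz'
      by (simp only: mem_Collect_eq prod.case mult_eq_0_iff simp_thms right_minus_eq)
    then have mem: "?\<phi> z \<in> affine_points ?W \<longleftrightarrow> z \<in> affine_points V" for z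
      by (cases z) blast
    have half: "2 * (t / 2) = t" for t :: 'a using six by simp
    have *: "(c * x + m - m) / c = x" "((k * (2 * y + p * x + q)) / k - p * x - q) / 2 = y"
      "c * ((x - m) / c) + m = x" "k * (2 * ((y / k - p * x - q) / 2) + p * x + q) = y"
      if "c \<noteq> 0" "k \<noteq> 0" for c k m p q x y :: 'a
      using that six by (simp_all only: half) simp_all
    have 1: "?\<psi> (?\<phi> z) = z" for z
      unfolding prod_eq_iff fst_conv snd_conv *(1)[OF nz] using *(2)[OF nz] by blast
    have 2: "?\<phi> (?\<psi> z) = z" for z
      unfolding prod_eq_iff fst_conv snd_conv using *(3,4)[OF nz] by blast
    have "z \<in> affine_points ?W \<Longrightarrow> ?\<psi> z \<in> affine_points V" for z
      using mem[of "?\<psi> z"] 2[of z] by simp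
    with mem 1 2 show ?thesis unfolding inverse_maps_def by blast
  qed
  ultimately show ?thesis unfolding isomorphic_curves_iff by blast
qed

lemma two_three_alg_closure: "(2 :: 'k::field_char_0 alg_closure) \<noteq> 0" "(3 :: 'k alg_closure) \<noteq> 0"
  using to_ac_eq_0_iff[of "2 :: 'k"] to_ac_eq_0_iff[of "3 :: 'k"] by (simp_all del: to_ac_eq_0_iff)

lemma map_curve: "map_weierstrass to_ac (curve d) = short_weierstrass 1 ((to_ac d)\<^sup>2)"
  by (simp add: curve_def)

text \<open>The coefficient 1 of \<open>x\<close> on both sides forces \<open>u^4 = 1\<close>, hence
  \<open>e'^4 = u^12 e^4 = e^4\<close>, and \<zeta> is the quotient, or 1 if both vanish. Conversely
  \<open>(x, y) \<mapsto> (\<zeta>^2 x, \<zeta> y)\<close> is an isomorphism, and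
  \<open>\<zeta>^2\<close> is its own inverse.\<close>

lemma isomorphic_over_closure_curve_iff:
  fixes e e' :: "'k::field_char_0"
  shows "isomorphic_over_closure (curve e) (curve e') \<longleftrightarrow>
    (\<exists>\<zeta> :: 'k alg_closure. \<zeta> ^ 4 = 1 \<and> to_ac e = to_ac e' * \<zeta>)"
proof
  assume "isomorphic_over_closure (curve e) (curve e')"
  then obtain u :: "'k alg_closure" where u: "1 = u ^ 4" "(to_ac e')\<^sup>2 = u ^ 6 * (to_ac e)\<^sup>2"
    using isomorphic_short_curves[OF infinite_alg_closure two_three_alg_closure, of 1 "(to_ac e)\<^sup>2" 1 "(to_ac e')\<^sup>2"]
    unfolding isomorphic_over_closure_def map_curve by auto
  have "(to_ac e') ^ 4 = (u ^ 4) ^ 3 * (to_ac e) ^ 4"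
    using arg_cong[OF u(2), of "\<lambda>x. x\<^sup>2"] by (simp add: power_mult_distrib flip: power_mult)
  then have eq: "(to_ac e') ^ 4 = (to_ac e) ^ 4" by (simp flip: u(1))
  show "\<exists>\<zeta> :: 'k alg_closure. \<zeta> ^ 4 = 1 \<and> to_ac e = to_ac e' * \<zeta>"
  proof (cases "e' = 0")
    case True
    then show ?thesis using eq by (intro exI[of _ 1]) simp
  next
    case False
    then show ?thesis
      by (intro exI[of _ "to_ac e / to_ac e'"]) (simp add: power_divide flip: eq)
  qed
next
  assume "\<exists>\<zeta> :: 'k alg_closure. \<zeta> ^ 4 = 1 \<and> to_ac e = to_ac e' * \<zeta>"
  then obtain \<zeta> :: "'k alg_closure" where \<zeta>: "\<zeta> ^ 4 = 1" and e: "to_ac e = to_ac e' * \<zeta>" by blast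
  define i where "i = \<zeta>\<^sup>2"
  have i: "i\<^sup>2 = 1" using \<zeta> by (simp add: i_def flip: power_mult)
  have e2: "(to_ac e)\<^sup>2 = i * (to_ac e')\<^sup>2" by (simp add: e i_def power_mult_distrib)
  let ?f = "[:[:0, i:]:]" and ?g = "[:0, [:\<zeta>:]:]"
  have i3: "i ^ 3 = i" using i by (simp add: power3_eq_cube power2_eq_square)
  have "inverse_maps (\<lambda>z. (eval2 ?f z, eval2 ?g z)) (\<lambda>z. (eval2 ?f z, eval2 [:0, [:1 / \<zeta>:]:] z))
      (affine_points (short_weierstrass 1 ((to_ac e)\<^sup>2))) (affine_points (short_weierstrass 1 ((to_ac e')\<^sup>2)))"
  proof -
    have j0: "\<zeta> \<noteq> 0" and i0: "i \<noteq> 0" using i \<zeta> by auto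
    have ii: "i * (i * x) = x" for x using i by (simp add: power2_eq_square flip: mult.assoc)
    have mem: "(\<zeta> * y)\<^sup>2 = (i * x) ^ 3 + i * x + (to_ac e')\<^sup>2 \<longleftrightarrow> y\<^sup>2 = x ^ 3 + x + (to_ac e)\<^sup>2" for x y
    proof -
      have "(\<zeta> * y)\<^sup>2 - ((i * x) ^ 3 + i * x + (to_ac e')\<^sup>2) = i * (y\<^sup>2 - (x ^ 3 + x + (to_ac e)\<^sup>2))"
        unfolding e2 power_mult_distrib i3 i_def[symmetric] by (simp add: algebra_simps ii)
      then show ?thesis using i0 by (metis eq_iff_diff_eq_0 mult_eq_0_iff)
    qed
    have "(y / \<zeta>)\<^sup>2 = (i * x) ^ 3 + i * x + (to_ac e)\<^sup>2" if "y\<^sup>2 = x ^ 3 + x + (to_ac e')\<^sup>2" for x y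
      using mem[of "y / \<zeta>" "i * x"] that j0 by (simp add: ii)
    moreover have "eval2 ?f z = i * fst z" "eval2 ?g z = \<zeta> * snd z" "eval2 [:0, [:1 / \<zeta>:]:] z = snd z / \<zeta>" for z
      by (simp_all add: eval2_def)
    ultimately show ?thesis
      using mem j0 by (auto simp: inverse_maps_def mem_affine_points_short ii)
  qed
  then show "isomorphic_over_closure (curve e) (curve e')"
    unfolding isomorphic_over_closure_def map_curve isomorphic_curves_iff polynomial_map_def
    by blast
qed

section \<open>Fields of definition\<close>

lemma subfield_closed:
  fixes F :: "'k::field set"
  assumes "subfield F ring_of_type_algebra"
  shows "1 \<in> F" "x \<in> F \<Longrightarrow> - x \<in> F" "x \<in> F \<Longrightarrow> y \<in> F \<Longrightarrow> x + y \<in> F"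
    "x \<in> F \<Longrightarrow> y \<in> F \<Longrightarrow> x - y \<in> F" "x \<in> F \<Longrightarrow> y \<in> F \<Longrightarrow> x * y \<in> F"
    "x \<in> F \<Longrightarrow> x ^ n \<in> F" "numeral m \<in> F" "x \<in> F \<Longrightarrow> inverse x \<in> F"
proof -
  let ?R = "ring_of_type_algebra :: 'k ring"
  interpret R: field ?R by (rule field_from_type_algebra)
  have [simp]: "x \<otimes>\<^bsub>?R\<^esub> y = x * y" "x \<oplus>\<^bsub>?R\<^esub> y = x + y" "\<one>\<^bsub>?R\<^esub> = 1" "\<zero>\<^bsub>?R\<^esub> = 0" "carrier ?R = UNIV" for x y
    by (simp_all add: ring_of_type_algebra_def)
  have "\<ominus>\<^bsub>?R\<^esub> x + x = 0" for x
    using R.l_neg[of x] by simp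
  then have [simp]: "\<ominus>\<^bsub>?R\<^esub> x = - x" for x
    by (simp add: eq_neg_iff_add_eq_0)
  note sub = subringE[OF subfieldE(1)[OF assms]]
  show one: "1 \<in> F" and minus: "x \<in> F \<Longrightarrow> - x \<in> F" for x using sub(3) sub(5)[of x] by simp_all
  show add: "x \<in> F \<Longrightarrow> y \<in> F \<Longrightarrow> x + y \<in> F" and mult: "x \<in> F \<Longrightarrow> y \<in> F \<Longrightarrow> x * y \<in> F" for x y
    using sub(6,7)[of x y] by simp_all
  show "x - y \<in> F" if "x \<in> F" "y \<in> F" using add[OF that(1) minus[OF that(2)]] by simp
  show "x ^ n \<in> F" if "x \<in> F" using that by (induction n) (simp_all add: one mult)
  have "of_nat n \<in> F" for n
    using sub(2) by (induction n) (simp_all add: one add)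
  from this[of "numeral m"] show "numeral m \<in> F" by simp
  show "inverse x \<in> F" if "x \<in> F"
  proof (cases "x = 0")
    case False
    then have "x \<in> F - {\<zero>\<^bsub>?R\<^esub>}" using that by simp
    from R.subfield_m_inv[OF assms this] show ?thesis
      by (simp add: inverse_unique)
  qed (use that in simp)
qed

text \<open>The quotient \<open>B^2 / A^3\<close> of a short model is invariant under isomorphism.
  It equals \<open>d^4\<close> for \<open>curve d\<close>, and for the short form of a model over
  \<open>F\<close> it lies in \<open>F\<close>. The relation \<open>1 = u^4 A\<close> shows that
  \<open>A\<close> is nonzero.\<close>

lemma power4_mem_if_curve_definable:
  fixes d :: "'k::field_char_0"
  assumes F: "subfield F ring_of_type_algebra" and "curve_definable_over F (curve d)"
  shows "d ^ 4 \<in> F"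
proof -
  obtain V where V: "set_weierstrass V \<subseteq> F" and iso: "isomorphic_over_closure V (curve d)"
    using assms(2) unfolding curve_definable_over_def by blast
  define b2 where "b2 = (a1 V)\<^sup>2 + 4 * a2 V"
  define b4 where "b4 = 2 * a4 V + a1 V * a3 V"
  define b6 where "b6 = (a3 V)\<^sup>2 + 4 * a6 V"
  define A where "A = - 27 * (b2\<^sup>2 - 24 * b4)"
  define B where "B = - 54 * (- (b2 ^ 3) + 36 * b2 * b4 - 216 * b6)"
  have "isomorphic_curves (map_weierstrass to_ac V) (short_weierstrass (to_ac A) (to_ac B))"
    using isomorphic_curves_to_short[OF two_three_alg_closure, of "map_weierstrass to_ac V"]
    by (simp add: A_def B_def b2_def b4_def b6_def weierstrass.map_sel)
  then have "isomorphic_curves (short_weierstrass (to_ac A) (to_ac B)) (short_weierstrass 1 ((to_ac d)\<^sup>2))"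
    using iso isomorphic_curves_sym isomorphic_curves_trans
    unfolding isomorphic_over_closure_def map_curve by blast
  then obtain u where u: "1 = u ^ 4 * to_ac A" "(to_ac d)\<^sup>2 = u ^ 6 * to_ac B"
    using isomorphic_short_curves[OF infinite_alg_closure two_three_alg_closure] by blast
  have "to_ac (d ^ 4 * A ^ 3) = ((to_ac d)\<^sup>2)\<^sup>2 * (to_ac A) ^ 3" by (simp flip: power_mult)
  also have "\<dots> = (u ^ 4 * to_ac A) ^ 3 * (to_ac B)\<^sup>2"
    unfolding u(2) by (simp add: power_mult_distrib flip: power_mult)
  also have "\<dots> = to_ac (B\<^sup>2)" by (simp flip: u(1))
  finally have "d ^ 4 * A ^ 3 = B\<^sup>2" by (simp only: to_ac_eq_iff)
  moreover have "A \<noteq> 0" using u(1) by auto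
  ultimately have "d ^ 4 = B\<^sup>2 * inverse (A ^ 3)" by (simp add: field_simps)
  moreover have "a1 V \<in> F" "a2 V \<in> F" "a3 V \<in> F" "a4 V \<in> F" "a6 V \<in> F"
    using V by (cases V; simp)+
  then have "B\<^sup>2 * inverse (A ^ 3) \<in> F"
    unfolding A_def B_def b2_def b4_def b6_def
    by (intro subfield_closed[OF F])
  ultimately show ?thesis by simp
qed

section \<open>The kernel of reduction\<close>

declare point_add.simps(3) [simp del]

section \<open>Valuation rings and their maximal ideals\<close>

locale valuation_ring =
  fixes A :: "'k::field set"
  assumes one_mem: "1 \<in> A"
    and diff_mem: "x \<in> A \<Longrightarrow> y \<in> A \<Longrightarrow> x - y \<in> A"
    and mult_mem: "x \<in> A \<Longrightarrow> y \<in> A \<Longrightarrow> x * y \<in> A"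
    and inverse_mem: "x \<notin> A \<Longrightarrow> inverse x \<in> A"
begin

text \<open>The maximal ideal. That its elements lie in \<open>A\<close> is not demanded, since
  \<open>inverse x \<notin> A\<close> already implies \<open>x \<in> A\<close> in a valuation
  ring.\<close>

definition M :: "'k set" where
  "M = {x. x = 0 \<or> inverse x \<notin> A}"

lemma zero_mem: "0 \<in> A"
  using diff_mem[OF one_mem one_mem] by simp

lemma minus_mem: "x \<in> A \<Longrightarrow> - x \<in> A"
  using diff_mem[OF zero_mem] by simp

lemma add_mem: "x \<in> A \<Longrightarrow> y \<in> A \<Longrightarrow> x + y \<in> A"
  using diff_mem[of x "- y"] minus_mem by simp

lemma power_mem: "x \<in> A \<Longrightarrow> x ^ n \<in> A"
  by (induction n) (simp_all add: one_mem mult_mem)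

lemma of_nat_mem: "of_nat n \<in> A"
  by (induction n) (simp_all add: zero_mem one_mem add_mem)

lemma numeral_mem: "numeral n \<in> A"
  using of_nat_mem[of "numeral n"] by simp

lemmas mem_intros = one_mem zero_mem minus_mem add_mem diff_mem mult_mem power_mem of_nat_mem numeral_mem

lemma M_mem: "x \<in> M \<Longrightarrow> x \<in> A"
  using inverse_mem[of "inverse x"] zero_mem by (auto simp: M_def)

lemma zero_M: "0 \<in> M"
  by (simp add: M_def)

lemma one_not_M: "1 \<notin> M"
  by (simp add: M_def one_mem)

lemma M_mult: "x \<in> A \<Longrightarrow> y \<in> M \<Longrightarrow> x * y \<in> M"
proof (rule ccontr)
  assume "x \<in> A" "y \<in> M" "x * y \<notin> M"
  then have "x * y \<noteq> 0" "x * inverse (x * y) \<in> A"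
    unfolding M_def by (blast intro: mult_mem)+
  moreover from this have "x * inverse (x * y) = inverse y" by simp
  ultimately have "inverse y \<in> A" "y \<noteq> 0" by (simp_all only: mult_eq_0_iff de_Morgan_disj simp_thms)
  then show False using \<open>y \<in> M\<close> by (simp add: M_def)
qed

lemma M_mult': "x \<in> M \<Longrightarrow> y \<in> A \<Longrightarrow> x * y \<in> M"
  using M_mult[of y x] by (simp add: mult.commute)

lemma M_minus: "x \<in> M \<Longrightarrow> - x \<in> M"
  using M_mult[of "- 1" x] by (simp add: minus_mem one_mem)

text \<open>One of \<open>x / y\<close> and \<open>y / x\<close> is integral, so one summand divides
  the other and can be factored out of the sum.\<close>

lemma M_add:
  assumes "x \<in> M" "y \<in> M"
  shows "x + y \<in> M"
proof (cases "x = 0 \<or> y = 0")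
  case False
  have sum: "x' + y' \<in> M" if "y' \<in> M" "y' \<noteq> 0" "x' / y' \<in> A" for x' y'
  proof -
    have "x' + y' = (x' / y' + 1) * y'" using that by (simp add: field_simps)
    then show ?thesis using that by (simp add: M_mult add_mem one_mem)
  qed
  show ?thesis
  proof (cases "x / y \<in> A")
    case True
    then show ?thesis using sum False assms by blast
  next
    case 2: False
    then have "y / x \<in> A" using inverse_mem[OF 2] by simp
    then have "y + x \<in> M" using sum False assms by blast
    then show ?thesis by (simp add: add.commute)
  qed
qed (use assms in auto)

lemma M_diff: "x \<in> M \<Longrightarrow> y \<in> M \<Longrightarrow> x - y \<in> M"
  using M_add[of x "- y"] M_minus by simp

lemma M_power: "x \<in> M \<Longrightarrow> n > 0 \<Longrightarrow> x ^ n \<in> M"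
  by (cases n) (auto intro: M_mult' power_mem M_mem)

lemmas M_intros = M_minus M_add M_diff M_mult M_mult' M_power

lemma unit_iff: "x \<in> A - M \<longleftrightarrow> x \<noteq> 0 \<and> x \<in> A \<and> inverse x \<in> A"
  by (auto simp: M_def)

lemma one_add_M: "x \<in> M \<Longrightarrow> 1 + x \<in> A - M"
  using M_diff[of "1 + x" x] one_not_M by (auto intro: add_mem one_mem M_mem)

lemma not_mem_iff: "x \<notin> A \<longleftrightarrow> x \<noteq> 0 \<and> inverse x \<in> M"
  using inverse_mem[of x] zero_mem by (auto simp: M_def)

lemma M_prime: "x \<in> A \<Longrightarrow> y \<in> A \<Longrightarrow> x * y \<in> M \<Longrightarrow> x \<in> M \<or> y \<in> M"
  using unit_iff[of x] unit_iff[of y] unit_iff[of "x * y"] mult_mem by auto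

lemma square_not_mem: "y \<notin> A \<Longrightarrow> y\<^sup>2 \<notin> A"
  using M_power[of "inverse y" 2] by (simp add: not_mem_iff power_inverse)

lemma square_M: "z\<^sup>2 \<in> M \<Longrightarrow> z \<in> M"
  using M_prime[of z z] square_not_mem[of z] M_mem[of "z\<^sup>2"] by (auto simp: power2_eq_square)

lemma M_divide: "x \<in> M \<Longrightarrow> y \<in> A - M \<Longrightarrow> x / y \<in> M"
  using M_mult'[of x "inverse y"] unit_iff[of y] by (simp add: divide_inverse)

end

text \<open>The local parameter at the origin of the group, hence 0 there. Division by zero also
  gives 0 for affine points with ordinate 0, but these are not in the kernel of reduction.\<close>

fun formal_parameter :: "'a::field point \<Rightarrow> 'a" where
  "formal_parameter Infinity = 0"
| "formal_parameter (Affine x y) = - x / y"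

section \<open>Points that reduce to infinity\<close>

locale integral_cubic = valuation_ring A + nonsingular_cubic a b for A :: "'a::field set"
  and a b :: 'a +
  assumes ab_mem: "a \<in> A" "b \<in> A"
begin

fun in_kernel :: "'a point \<Rightarrow> bool" where
  "in_kernel Infinity \<longleftrightarrow> True"
| "in_kernel (Affine x y) \<longleftrightarrow> x \<notin> A"

lemma in_kernel_if_ordinate:
  assumes "on (Affine x y)" "y \<notin> A"
  shows "x \<notin> A"
proof
  assume "x \<in> A"
  then have "y\<^sup>2 \<in> A" using assms(1) ab_mem by (simp add: mem_intros)
  with square_not_mem[OF assms(2)] show False ..
qed

text \<open>With \<open>t = 1 / x\<close> in \<open>M\<close>, the curve equation reads
  \<open>y^2 = x^3 e\<close> with \<open>e \<in> 1 + M\<close> a unit. So \<open>z^2 = t / e\<close>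
  lies in \<open>M\<close>, and therefore \<open>z\<close> does.\<close>

lemma formal_coordinates:
  assumes on: "on (Affine x y)" and x: "x \<notin> A"
  defines "z \<equiv> - x / y" and "w \<equiv> - 1 / y"
  shows "y \<noteq> 0" "z \<in> M" "z \<noteq> 0" "\<exists>t\<in>M. w = z * t" "w = z ^ 3 + a * z * w\<^sup>2 + b * w ^ 3"
proof -
  define t where "t = inverse x"
  have t: "t \<in> M" "x * t = 1" "x \<noteq> 0" using x by (simp_all add: t_def not_mem_iff)
  define e where "e = 1 + (a * t\<^sup>2 + b * t ^ 3)"
  have e: "e \<in> A - M"
    unfolding e_def using t(1) ab_mem by (intro one_add_M M_intros) auto
  have y2: "y\<^sup>2 = x ^ 3 * e"
  proof -
    have "y\<^sup>2 - x ^ 3 * e = (x ^ 3 + a * x + b) - x ^ 3 * e" using on by simp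
    also have "\<dots> = 0"
      using diff_eq_0[OF t(2)] unfolding e_def by Groebner_Basis.algebra
    finally show ?thesis by simp
  qed
  then show y: "y \<noteq> 0" using t(3) e zero_M by auto
  have "z\<^sup>2 = t / e"
    using t(3) e unfolding z_def power_divide y2 t_def
    by (simp add: power2_eq_square power3_eq_cube field_simps unit_iff)
  then show "z \<in> M" using M_divide[OF t(1) e] square_M by simp
  show "z \<noteq> 0" using t(3) y by (simp add: z_def)
  have "w = z * t" using t(3) y by (simp add: z_def w_def t_def field_simps)
  with t(1) show "\<exists>t\<in>M. w = z * t" by blast
  define v where "v = 1 / y"
  have v: "v * y = 1" using y by (simp add: v_def)
  have z: "z = - (x * v)" and w: "w = - v" by (simp_all add: z_def w_def v_def)
  have "y\<^sup>2 = x ^ 3 + a * x + b" using on by simp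
  then show "w = z ^ 3 + a * z * w\<^sup>2 + b * w ^ 3"
    using diff_eq_0[OF v] unfolding z w using diff_eq_0[of "y\<^sup>2"] by Groebner_Basis.algebra
qed

text \<open>\<open>- l / c\<close> is the slope of the line in the coordinates
  \<open>(z, w)\<close>. Subtracting the equations of two points there gives
  \<open>(w2 - w1) \<kappa> = (z2 - z1) N\<close> with \<open>N \<in> M\<close> and \<kappa> a unit,
  so the slope is \<open>N / \<kappa>\<close>; the tangent yields the same formula. The equation is
  stated as \<open>l \<kappa> + c N = 0\<close>, which also rules out \<open>c = 0\<close>.\<close>

lemma formal_slope:
  assumes S: "on (Affine x1 y1)" "x1 \<notin> A" and X: "on (Affine x2 y2)" "x2 \<notin> A"
    and ne: "\<not> (x1 = x2 \<and> y1 + y2 = 0)"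
    and line: "y1 = l * x1 + c" "y2 = l * x2 + c"
    and tangent: "x1 = x2 \<Longrightarrow> l * (2 * y1) = 3 * x1\<^sup>2 + a"
  shows "c \<noteq> 0" "- l / c \<in> M"
proof -
  define z1 w1 where "z1 = - x1 / y1" and "w1 = - 1 / y1"
  define z2 w2 where "z2 = - x2 / y2" and "w2 = - 1 / y2"
  note f1 = formal_coordinates[OF S, folded z1_def w1_def]
    and f2 = formal_coordinates[OF X, folded z2_def w2_def]
  have w1: "w1 \<in> M" and w2: "w2 \<in> M" using f1(2,4) f2(2,4) M_mult M_mem by metis+
  have zw: "x1 = z1 / w1" "y1 = - 1 / w1" "x2 = z2 / w2" "y2 = - 1 / w2" "w1 \<noteq> 0" "w2 \<noteq> 0"
    using f1(1) f2(1) by (simp_all add: z1_def w1_def z2_def w2_def)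
  have "l * (- x / y) + c * (- 1 / y) + 1 = 0" if "y = l * x + c" "y \<noteq> 0" for x y
  proof -
    have "l * (- x / y) + c * (- 1 / y) + 1 = (y - (l * x + c)) / y"
      using that(2) by (simp add: diff_divide_distrib add_divide_distrib)
    with that(1) show ?thesis by simp
  qed
  then have l1: "l * z1 + c * w1 + 1 = 0" and l2: "l * z2 + c * w2 + 1 = 0"
    using line f1(1) f2(1) unfolding z1_def w1_def z2_def w2_def by blast+
  define \<kappa> where "\<kappa> = 1 + (- (a * z1 * (w1 + w2)) - b * (w1\<^sup>2 + w1 * w2 + w2\<^sup>2))"
  define N where "N = z1\<^sup>2 + z1 * z2 + z2\<^sup>2 + a * w2\<^sup>2"
  note mems = f1(2) f2(2) w1 w2 M_mem ab_mem
  have \<kappa>: "\<kappa> \<in> A - M"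
    unfolding \<kappa>_def by (intro one_add_M M_intros mem_intros) (auto intro: mems)
  have N: "N \<in> M"
    unfolding N_def by (intro M_intros) (auto intro: mems)
  have key: "l * \<kappa> + c * N = 0"
  proof (cases "x1 = x2")
    case True
    then have "(y2 - y1) * (y2 + y1) = 0" using S X by (simp add: algebra_simps power2_eq_square)
    then have y: "y2 = y1" using ne True by (auto simp: add.commute)
    then have same: "z2 = z1" "w2 = w1" using True by (simp_all add: z1_def w1_def z2_def w2_def)
    have "y1\<^sup>2 = x1 ^ 3 + a * x1 + b" using S by simp
    note eqs = diff_eq_0[OF this] diff_eq_0[OF tangent[OF True]] diff_eq_0[OF line(1)]
    have "l * (y1\<^sup>2 - 2 * a * x1 - 3 * b) + c * (3 * x1\<^sup>2 + a) = 0"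
      using eqs by Groebner_Basis.algebra
    moreover have "y1\<^sup>2 * (l * \<kappa> + c * N) = l * (y1\<^sup>2 - 2 * a * x1 - 3 * b) + c * (3 * x1\<^sup>2 + a)"
      using f1(1) unfolding \<kappa>_def N_def same unfolding z1_def w1_def by
        (simp add: field_simps power2_eq_square)
    ultimately show ?thesis using f1(1) by simp
  next
    case False
    \<comment> \<open>Since \<kappa> is a unit, \<open>z\<close> determines \<open>w\<close> near
      infinity.\<close>
    have "z1 \<noteq> z2"
    proof
      assume z: "z1 = z2"
      have "(w2 - w1) * \<kappa> = (z2 - z1) * N"
        using diff_eq_0[OF f1(5)] diff_eq_0[OF f2(5)] unfolding \<kappa>_def N_def
        by Groebner_Basis.algebra
      then have "w1 = w2" using z \<kappa> zero_M by auto
      with z zw False show False by simp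
    qed
    have "(w2 - w1) * \<kappa> - (z2 - z1) * N = 0"
      using diff_eq_0[OF f1(5)] diff_eq_0[OF f2(5)] unfolding \<kappa>_def N_def by Groebner_Basis.algebra
    then have "(z2 - z1) * (l * \<kappa> + c * N) = 0"
      using l1 l2 by Groebner_Basis.algebra
    then show ?thesis using \<open>z1 \<noteq> z2\<close> by simp
  qed
  show c: "c \<noteq> 0"
  proof
    assume "c = 0"
    with key \<kappa> zero_M have "l = 0" by auto
    with l1 \<open>c = 0\<close> show False by simp
  qed
  have "\<kappa> \<noteq> 0" using \<kappa> zero_M by auto
  with c key have "- l / c = N / \<kappa>"
    by (simp add: field_simps) (metis add_eq_0_iff minus_minus)
  then show "- l / c \<in> M" using M_divide[OF N \<kappa>] by simp
qed

text \<open>In the coordinates \<open>z = - x / y\<close>, \<open>w = - 1 / y\<close> the line is \<open>w = \<mu> z + \<nu>\<close>, and Vieta's formula for the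
  cubic that it cuts out gives \<open>z\<close> of the sum.\<close>

lemma formal_parameter_add:
  assumes S: "on S" "in_kernel S" "S \<noteq> Infinity" and Q: "on Q" "in_kernel Q"
    and v: "v \<in> A" "formal_parameter Q = formal_parameter S * v"
  shows "in_kernel (Q \<^bold>+ S)" "\<exists>m\<in>M. formal_parameter (Q \<^bold>+ S) = formal_parameter S * (v + 1 + m)"
proof -
  obtain x1 y1 where S_eq: "S = Affine x1 y1" using S(3) by (cases S) auto
  have on1: "on (Affine x1 y1)" and x1: "x1 \<notin> A" using S S_eq by simp_all
  note f1 = formal_coordinates[OF on1 x1]
  have goal: "in_kernel (Q \<^bold>+ S) \<and> (\<exists>m\<in>M. formal_parameter (Q \<^bold>+ S) = formal_parameter S * (v + 1 + m))"
  proof (cases Q)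
    case Infinity
    then have "v = 0" using v(2) f1(3) S_eq by simp
    then show ?thesis using Infinity S zero_M by (auto intro!: bexI[of _ 0])
  next
    case Q_eq: (Affine x2 y2)
    have on2: "on (Affine x2 y2)" and x2: "x2 \<notin> A" using Q Q_eq by simp_all
    note f2 = formal_coordinates[OF on2 x2]
    show ?thesis
    proof (cases "x1 = x2 \<and> y1 + y2 = 0")
      case True
      then have y2: "y2 = - y1" by (simp add: add_eq_0_iff)
      then have "Q \<^bold>+ S = Infinity" using True by (simp add: add_eq_Infinity_iff S_eq Q_eq)
      moreover have "formal_parameter S * (v + 1) = 0"
      proof -
        have "formal_parameter Q = - formal_parameter S" using True by (simp add: S_eq Q_eq y2)
        then show ?thesis using v(2) unfolding distrib_left mult_1_right by (metis add.left_inverse)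
      qed
      then have "v + 1 = 0" using f1(3) S_eq by simp
      ultimately show ?thesis using zero_M by (auto intro!: bexI[of _ 0])
    next
      case False
      obtain l c x3 where line: "line_meets a b l c x1 x2 x3" "y1 = l * x1 + c" "y2 = l * x2 + c"
        "x1 = x2 \<Longrightarrow> l * (2 * y1) = 3 * x1\<^sup>2 + a"
        using line_through[OF on1 on2 False] by blast
      note slope = formal_slope[OF on1 x1 on2 x2 False line(2-4)]
      define y3 where "y3 = l * x3 + c"
      have sum: "Q \<^bold>+ S = Affine x3 (- y3)"
      proof -
        have "line_meets a b l c x2 x1 x3" using line(1) line_meets_swap by blast
        moreover have "\<not> (x2 = x1 \<and> l * x2 + c = 0)"
          using False line(2,3) by (metis add_0)
        ultimately show ?thesis
          using add_line[of l c x2 x1 x3] line(2,3) by (simp add: S_eq Q_eq y3_def)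
      qed
      define \<mu> where "\<mu> = - l / c"
      have lc: "l = - c * \<mu>" using slope(1) by (simp add: \<mu>_def)
      define u where "u = 1 + (a * \<mu>\<^sup>2 + b * \<mu> ^ 3)"
      have \<mu>: "\<mu> \<in> M" using slope(2) by (simp add: \<mu>_def)
      have u: "u \<in> A - M"
        unfolding u_def using \<mu> ab_mem by (intro one_add_M M_intros) auto
      note vieta = line_meetsD[OF line(1)]
      have prod: "y1 * y2 * y3 = c ^ 3 * u"
        using vieta unfolding line(2,3) y3_def u_def lc by Groebner_Basis.algebra
      then have y3: "y3 \<noteq> 0" using slope(1) u zero_M by auto
      define \<nu> where "\<nu> = - 1 / c"
      have \<nu>: "\<nu> * c + 1 = 0" using slope(1) by (simp add: \<nu>_def)
      have w_eq: "- 1 / y = \<mu> * (- x / y) + \<nu>" if "y = l * x + c" "y \<noteq> 0" for x y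
      proof -
        define r where "r = 1 / y"
        have "r * y - 1 = 0" using that(2) by (simp add: r_def)
        then have "c * (\<mu> * (- (x * r)) + \<nu> + r) = 0"
          using \<nu> diff_eq_0[OF that(1)] unfolding lc by Groebner_Basis.algebra
        then show ?thesis using slope(1) by (simp add: r_def add_eq_0_iff2)
      qed
      define z1 z2 z3 where "z1 = - x1 / y1" and "z2 = - x2 / y2" and "z3 = - x3 / y3"
      have z: "z1 * y1 + x1 = 0" "z2 * y2 + x2 = 0" "z3 * y3 + x3 = 0"
        using f1(1) f2(1) y3 by (simp_all add: z1_def z2_def z3_def)
      have z2: "z2 - z1 * v = 0" using v(2) by (simp add: S_eq Q_eq z1_def z2_def)
      obtain t where t: "t \<in> M" "- 1 / y1 = z1 * t" using f1(4) unfolding z1_def by blast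
      have \<nu>_eq: "\<nu> = z1 * (t - \<mu>)"
        using w_eq[OF line(2) f1(1)] unfolding t(2) z1_def[symmetric] by (simp add: algebra_simps)
      \<comment> \<open>Substituting \<open>w = \<mu> z + \<nu>\<close> into the equation in
        \<open>(z, w)\<close> gives a cubic in \<open>z\<close> with leading coefficient
        \<open>u\<close> and next coefficient \<open>\<nu> K\<close>. Hence
        \<open>z1 + z2 + z3 = - \<nu> K / u\<close>, and \<nu> is a multiple of \<open>z1\<close>,
        which allows \<open>z1\<close> to be factored out of \<open>- z3\<close>.\<close>
      define K where "K = 2 * a * \<mu> + 3 * b * \<mu>\<^sup>2"
      have "x1 * y2 * y3 + x2 * y1 * y3 + x3 * y1 * y2 + c\<^sup>2 * K = 0"
        using vieta unfolding line(2,3) y3_def lc K_def by Groebner_Basis.algebra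
      then have "c\<^sup>2 * ((z1 + z2 + z3) * c * u - K) = 0"
        using z diff_eq_0[OF prod] by Groebner_Basis.algebra
      then have sum_z: "(z1 + z2 + z3) * c * u - K = 0" using slope(1) by simp
      define m where "m = K * (t - \<mu>) / u"
      have u0: "u \<noteq> 0" using u zero_M by auto
      then have m_eq: "m * u - K * (t - \<mu>) = 0" by (simp add: m_def)
      have "u * (- z3 - z1 * (v + 1 + m)) = 0"
        using sum_z \<nu> diff_eq_0[OF \<nu>_eq] z2 m_eq by Groebner_Basis.algebra
      then have z3: "- z3 = z1 * (v + 1 + m)" using u0 by simp
      have z1_M: "z1 \<in> M" using f1(2) by (simp add: z1_def)
      have m: "m \<in> M"
        unfolding m_def K_def using t(1) \<mu> ab_mem u
        by (intro M_divide M_intros mem_intros) (auto intro: M_mem)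
      have "z1 * (v + 1 + m) \<in> M"
        using z1_M v(1) m by (intro M_mult' mem_intros M_mem[of m])
      then have "z3 \<in> M" using M_minus[of "- z3"] unfolding z3[symmetric] by simp
      moreover have "- 1 / y3 = \<mu> * z3 + \<nu>"
        using w_eq[OF y3_def y3] by (simp add: z3_def)
      moreover have "\<nu> \<in> M"
        unfolding \<nu>_eq using z1_M t(1) \<mu> by (intro M_mult' M_mem[OF M_diff])
      ultimately have "- 1 / y3 \<in> M" using \<mu> by (simp add: M_add M_mult' M_mem)
      then have "- y3 \<notin> A" using y3 unfolding not_mem_iff by (simp add: divide_inverse)
      then have "x3 \<notin> A"
        using in_kernel_if_ordinate[of x3 "- y3"] on_add[OF Q(1) S(1)] sum by simp
      moreover have "formal_parameter (Q \<^bold>+ S) = formal_parameter S * (v + 1 + m)"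
        using z3 unfolding sum unfolding S_eq formal_parameter.simps z1_def z3_def by simp
      ultimately show ?thesis using m sum by auto
    qed
  qed
  then show "in_kernel (Q \<^bold>+ S)" "\<exists>m\<in>M. formal_parameter (Q \<^bold>+ S) = formal_parameter S * (v + 1 + m)"
    by blast+
qed

text \<open>Only the recursion of the power is used for it, so everything about
  \<open>multiple\<close> here holds without associativity.\<close>

definition multiple :: "nat \<Rightarrow> 'a point \<Rightarrow> 'a point" where
  "multiple n P = P [^]\<^bsub>rational_points (short_weierstrass a b)\<^esub> n"

lemma multiple_0: "multiple 0 P = Infinity"
  and multiple_Suc: "multiple (Suc n) P = multiple n P \<^bold>+ P"
  by (simp_all add: multiple_def nat_pow_def rational_points_def)

lemma on_multiple: "on P \<Longrightarrow> on (multiple n P)"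
  by (induction n) (simp_all add: multiple_0 multiple_Suc on_add)

text \<open>The factor \<open>z(S)\<close> is kept exactly, and each addition of \<open>S\<close>
  changes the cofactor by 1 up to an element of \<open>M\<close>. No powers of \<open>M\<close> have
  to be compared.\<close>

lemma formal_parameter_multiple:
  assumes S: "on S" "in_kernel S" "S \<noteq> Infinity"
  shows "in_kernel (multiple n S) \<and>
    (\<exists>v\<in>A. v - of_nat n \<in> M \<and> formal_parameter (multiple n S) = formal_parameter S * v)"
proof (induction n)
  case 0
  show ?case using zero_mem zero_M by (auto simp: multiple_0)
next
  case (Suc n)
  then obtain v where v: "v \<in> A" "v - of_nat n \<in> M" "formal_parameter (multiple n S) = formal_parameter S * v"
    by blast
  from formal_parameter_add[OF S on_multiple[OF S(1)] _ v(1,3)] Suc obtain m where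
    m: "in_kernel (multiple (Suc n) S)" "m \<in> M" "formal_parameter (multiple (Suc n) S) = formal_parameter S * (v + 1 + m)"
    unfolding multiple_Suc by blast
  have "v + 1 + m - of_nat (Suc n) = (v - of_nat n) + m" by simp
  also have "\<dots> \<in> M" using v m by (intro M_add)
  finally show ?case
    using m v(1) by (intro conjI bexI[of _ "v + 1 + m"]) (auto intro: mem_intros M_mem)
qed

text \<open>\<open>z(n S) = 0\<close> while \<open>z(S)\<close> is nonzero, so the cofactor, which
  is congruent to \<open>n\<close>, vanishes.\<close>

lemma of_nat_M_if_torsion_in_kernel:
  assumes S: "on S" "in_kernel S" "S \<noteq> Infinity" and n: "multiple n S = Infinity"
  shows "of_nat n \<in> M"
proof -
  obtain v where v: "v - of_nat n \<in> M" "formal_parameter (multiple n S) = formal_parameter S * v"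
    using formal_parameter_multiple[OF S] by blast
  have "formal_parameter S \<noteq> 0"
    using S formal_coordinates(3) by (cases S) auto
  then have "v = 0" using v(2) n by simp
  then show ?thesis using v(1) M_minus by fastforce
qed

text \<open>This replaces the homomorphism property of reduction. The line joins the first point to
  the negative of the second. If its slope is not integral, neither is the abscissa
  \<open>l^2 - x1 - x2\<close> of the difference.\<close>

lemma diff_in_kernel_if_congruent:
  assumes good: "2 * (4 * a ^ 3 + 27 * b\<^sup>2) \<notin> M"
    and on: "on (Affine x1 y1)" "on (Affine x2 y2)"
    and integral: "x1 \<in> A" "y1 \<in> A" "x2 \<in> A" "y2 \<in> A"
    and cong: "x1 - x2 \<in> M" "y1 - y2 \<in> M"
  shows "in_kernel (Affine x1 y1 \<^bold>+ point_neg (Affine x2 y2))"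
proof -
  have disc_M: "4 * a ^ 3 + 27 * b\<^sup>2 \<notin> M"
    using good M_mult[OF numeral_mem] by blast
  have two_M: "2 \<notin> M"
  proof
    assume "2 \<in> M"
    then have "2 * (4 * a ^ 3 + 27 * b\<^sup>2) \<in> M" using ab_mem by (intro M_mult' mem_intros)
    with good show False ..
  qed
  have smooth: "3 * x1\<^sup>2 + a \<in> A - M" if "y1 \<in> M"
  proof -
    have "x1 ^ 3 + a * x1 + b \<in> M" using M_power[OF that, of 2] on(1) by simp
    then have "(27 * b - 18 * a * x1) * (x1 ^ 3 + a * x1 + b) \<in> M"
      using ab_mem integral by (intro M_mult mem_intros)
    moreover have "4 * a ^ 3 + 27 * b\<^sup>2 = (6 * a * x1\<^sup>2 - 9 * b * x1 + 4 * a\<^sup>2) * (3 * x1\<^sup>2 + a)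
      + (27 * b - 18 * a * x1) * (x1 ^ 3 + a * x1 + b)"
      by Groebner_Basis.algebra
    moreover have "6 * a * x1\<^sup>2 - 9 * b * x1 + 4 * a\<^sup>2 \<in> A"
      using ab_mem integral by (intro mem_intros)
    ultimately have "3 * x1\<^sup>2 + a \<notin> M"
      using disc_M by (metis M_add M_mult)
    then show ?thesis using ab_mem integral by (auto intro: mem_intros)
  qed
  show ?thesis
  proof (cases "x1 = x2 \<and> y1 + - y2 = 0")
    case True
    then have "Affine x1 y1 \<^bold>+ point_neg (Affine x2 y2) = Infinity"
      unfolding add_eq_Infinity_iff by simp
    then show ?thesis by simp
  next
    case False
    have on2': "on (Affine x2 (- y2))" using on(2) by simp
    obtain l c x3 where line: "line_meets a b l c x1 x2 x3" "y1 = l * x1 + c" "- y2 = l * x2 + c"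
      "x1 = x2 \<Longrightarrow> l * (2 * y1) = 3 * x1\<^sup>2 + a"
      using line_through[OF on(1) on2' False] by blast
    have "\<not> (x1 = x2 \<and> l * x1 + c = 0)" using False line(2,3) by (metis add_0)
    from add_line[OF line(1) this]
    have sum: "Affine x1 y1 \<^bold>+ point_neg (Affine x2 y2) = Affine x3 (- (l * x3 + c))"
      using line(2,3) by simp
    have y2: "y2 = - (l * x2 + c)" using line(3) by (metis minus_minus)
    \<comment> \<open>An integral slope would give \<open>y1 + y2 = l (x1 - x2) \<in> M\<close>,
      hence \<open>2 y1 \<in> M\<close> and \<open>y1 \<in> M\<close>; then
      \<open>l (y1 - y2) \<in> M\<close> puts \<open>3 x1^2 + a\<close> into \<open>M\<close> as
      well, a singular reduction.\<close>
    have "l \<notin> A"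
    proof
      assume l: "l \<in> A"
      have "y1 + y2 = l * (x1 - x2)" unfolding line(2) y2 by (simp add: algebra_simps)
      then have "y1 + y2 \<in> M" using M_mult[OF l cong(1)] by simp
      then have "2 * y1 \<in> M" using M_add[OF _ cong(2)] by
        (metis add_diff_eq add.commute add_diff_cancel_left' mult_2)
      then have y1: "y1 \<in> M" using M_prime[of 2 y1] two_M integral by (auto intro: mem_intros)
      \<comment> \<open>One formula for chord and tangent: for the chord it is the difference of the
        curve equations divided by \<open>x1 - x2\<close>, for the tangent
        \<open>y2 = - y1\<close>.\<close>
      have tangent: "l * (y1 - y2) = x1\<^sup>2 + x1 * x2 + x2\<^sup>2 + a"
      proof (cases "x1 = x2")
        case True
        have "(y1 - y2) * (y1 + y2) = 0" using on True by (simp add: algebra_simps power2_eq_square)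
        then have "y2 = - y1" using False True by (auto simp: add_eq_0_iff)
        with line(4)[OF True] True show ?thesis by (simp add: power2_eq_square algebra_simps)
      next
        case ne: False
        have "(x1 - x2) * (l * (y1 - y2)) = (x1 - x2) * (x1\<^sup>2 + x1 * x2 + x2\<^sup>2 + a)"
          using diff_eq_0[OF \<open>y1 + y2 = l * (x1 - x2)\<close>] diff_eq_0[OF on(1)[unfolded on_curve.simps]]
            diff_eq_0[OF on(2)[unfolded on_curve.simps]] by Groebner_Basis.algebra
        then show ?thesis using ne by simp
      qed
      have "3 * x1\<^sup>2 + a = l * (y1 - y2) + (x1 - x2) * (2 * x1 + x2)"
        unfolding tangent by Groebner_Basis.algebra
      also have "\<dots> \<in> M"
        using l cong integral by (intro M_add M_mult[OF l] M_mult'[OF cong(1)] mem_intros)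
      finally show False using smooth[OF y1] by blast
    qed
    have "x3 \<notin> A"
    proof
      assume "x3 \<in> A"
      then have "l\<^sup>2 \<in> A" using line(1) integral by (auto simp: line_meets_def intro: mem_intros)
      with square_not_mem[OF \<open>l \<notin> A\<close>] show False ..
    qed
    then show ?thesis using sum by simp
  qed
qed

end

section \<open>Localizations of rings of integers\<close>

lemma algebraic_if_number_field:
  assumes "number_field TYPE('k::field_char_0)"
  shows "algebraic (x :: 'k)"
proof -
  obtain B where "finite_dimensional_vector_space (\<lambda>(r::rat) (x::'k). of_rat r * x) B"
    using assms unfolding number_field_def by blast
  then interpret V: finite_dimensional_vector_space "\<lambda>(r::rat) (x::'k). of_rat r * x" B .
  let ?n = "V.dimension"
  show ?thesis
  \<comment> \<open>If two powers of \<open>x\<close> coincide they do not provide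
    \<open>n + 1\<close> vectors, but then \<open>x\<close> is a root of a difference of two
    monomials.\<close>
  proof (cases "inj_on (\<lambda>i. x ^ i) {..?n}")
    case False
    then obtain i j where ij: "i < j" "x ^ i = x ^ j"
      by (metis (no_types, lifting) inj_onI nat_neq_iff)
    let ?p = "Polynomial.monom 1 j - Polynomial.monom 1 i :: 'k poly"
    have "poly.coeff ?p j = 1" using ij by simp
    then have "?p \<noteq> 0" by force
    moreover have "poly ?p x = 0" using ij by (simp add: poly_monom)
    moreover have "poly.coeff ?p k \<in> \<int>" for k by simp
    ultimately show ?thesis by (rule algebraicI[rotated])
  next
    case True
    let ?S = "(\<lambda>i. x ^ i) ` {..?n}"
    have "card ?S = ?n + 1" using True by (simp add: card_image)
    moreover have "V.independent ?S \<Longrightarrow> card ?S \<le> ?n"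
      using V.independent_bound_general[of ?S] V.dim_subset_UNIV[of ?S] by simp
    ultimately have "V.dependent ?S" by linarith
    then obtain u where u: "\<exists>v\<in>?S. u v \<noteq> 0" "(\<Sum>v\<in>?S. of_rat (u v) * v) = 0"
      by (auto simp: V.dependent_finite)
    define p :: "'k poly" where "p = (\<Sum>i\<le>?n. Polynomial.monom (of_rat (u (x ^ i))) i)"
    have coeff: "poly.coeff p k = (if k \<le> ?n then of_rat (u (x ^ k)) else 0)" for k
      by (simp add: p_def coeff_sum)
    from u(1) obtain k where "k \<le> ?n" "u (x ^ k) \<noteq> 0" by auto
    then have "poly.coeff p k \<noteq> 0" by (simp add: coeff)
    then have "p \<noteq> 0" by force
    moreover have "poly p x = 0"
      using u(2) True by (simp add: p_def poly_sum poly_monom sum.reindex)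
    moreover have "poly.coeff p k \<in> \<rat>" for k by (simp add: coeff)
    ultimately show ?thesis by (rule algebraicI'[rotated])
  qed
qed

text \<open>The determinant trick: \<open>b\<close> is a root of the characteristic polynomial of an
  integer matrix, which is monic with integer coefficients.\<close>

lemma algebraic_int_if_eigenvalue:
  fixes b :: "'k::field_char_0" and v :: "nat \<Rightarrow> 'k" and C :: "nat \<Rightarrow> nat \<Rightarrow> int"
  assumes ev: "\<And>i. i < n \<Longrightarrow> b * v i = (\<Sum>j<n. of_int (C i j) * v j)"
    and "k < n" "v k \<noteq> 0"
  shows "algebraic_int b"
proof -
  define T where "T = mat n n (\<lambda>(i, j). C i j)"
  have T: "T \<in> carrier_mat n n" by (simp add: T_def)
  let ?T = "map_mat (of_int :: int \<Rightarrow> 'k) T"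
  have "?T *\<^sub>v vec n v = b \<cdot>\<^sub>v vec n v"
    by (rule eq_vecI) (auto simp: T_def scalar_prod_def ev atLeast0LessThan)
  moreover have "vec n v \<noteq> 0\<^sub>v n"
    using assms(2,3) by (metis index_vec index_zero_vec(1))
  ultimately have "eigenvalue ?T b"
    unfolding eigenvalue_def eigenvector_def by (intro exI[of _ "vec n v"]) (simp add: T_def)
  then have "poly (char_poly ?T) b = 0"
    using eigenvalue_root_char_poly[of ?T n] T by simp
  then have "poly (map_poly of_int (char_poly T)) b = 0"
    by (simp add: of_int_hom.char_poly_hom[OF T])
  moreover have "Polynomial.lead_coeff (char_poly T) = 1"
    using degree_monic_char_poly[OF T] by simp
  ultimately show ?thesis
    unfolding algebraic_int_altdef_ipoly by blast
qed

text \<open>Multiplication by this element maps the \<int>-span of \<open>1, x, ..., x^(n-1)\<close>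
  into itself, although \<open>x\<close> need not be integral, so it is an eigenvalue of an integer
  matrix.\<close>

lemma algebraic_int_horner:
  fixes x :: "'k::field_char_0" and c :: "nat \<Rightarrow> int"
  assumes root: "(\<Sum>i\<le>n. of_int (c i) * x ^ i) = 0" and m: "m < n"
  shows "algebraic_int (\<Sum>i\<in>{m<..n}. of_int (c i) * x ^ (i - m))"
proof -
  let ?b = "\<Sum>i\<in>{m<..n}. of_int (c i) * x ^ (i - m) :: 'k"
  \<comment> \<open>Row \<open>j\<close> expands the product with \<open>x^j\<close>. For
    \<open>j < m\<close> all exponents stay below \<open>n\<close>. For \<open>j \<ge> m\<close> the
    equation of \<open>x\<close> replaces the upper part of the polynomial by minus the lower part,
    of exponents \<open>j - m\<close> to \<open>j\<close>.\<close>
  define C where "C j e = (if j < m then (if j < e \<and> e \<le> n + j - m then c (e + m - j) else 0)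
    else (if j - m \<le> e \<and> e \<le> j then - c (e + m - j) else 0))" for j e
  have "?b * x ^ j = (\<Sum>e<n. of_int (C j e) * x ^ e)" if j: "j < n" for j
  proof (cases "j < m")
    case True
    have "?b * x ^ j = (\<Sum>i\<in>{m<..n}. of_int (c i) * x ^ (i + j - m))"
      unfolding sum_distrib_right by (intro sum.cong) (auto simp: mult.assoc simp flip: power_add)
    also have "\<dots> = (\<Sum>e\<in>{j<..n + j - m}. of_int (c (e + m - j)) * x ^ e)"
      by (rule sum.reindex_bij_witness[of _ "\<lambda>e. e + m - j" "\<lambda>i. i + j - m"]) (use True m in auto)
    also have "\<dots> = (\<Sum>e<n. of_int (C j e) * x ^ e)"
      by (rule sum.mono_neutral_cong_left) (use True m in \<open>auto simp: C_def\<close>)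
    finally show ?thesis .
  next
    case False
    have "{..n} = {..m} \<union> {m<..n}" "{..m} \<inter> {m<..n} = {}" using m by auto
    then have split: "(\<Sum>i\<in>{m<..n}. of_int (c i) * x ^ i) = - (\<Sum>i\<le>m. of_int (c i) * x ^ i)"
      using root by (simp add: sum.union_disjoint add_eq_0_iff)
    have "?b * x ^ j = (\<Sum>i\<in>{m<..n}. of_int (c i) * x ^ i) * x ^ (j - m)"
      unfolding sum_distrib_right using False
      by (intro sum.cong) (auto simp: mult.assoc simp flip: power_add)
    also have "\<dots> = (\<Sum>i\<le>m. of_int (- c i) * x ^ (i + (j - m)))"
      unfolding split by (simp add: sum_distrib_right mult.assoc power_add sum_negf)
    also have "\<dots> = (\<Sum>e\<in>{j - m..j}. of_int (- c (e + m - j)) * x ^ e)"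
      by (rule sum.reindex_bij_witness[of _ "\<lambda>e. e + m - j" "\<lambda>i. i + (j - m)"]) (use False in auto)
    also have "\<dots> = (\<Sum>e<n. of_int (C j e) * x ^ e)"
      by (rule sum.mono_neutral_cong_left) (use False j in \<open>auto simp: C_def\<close>)
    finally show ?thesis .
  qed
  then show ?thesis
    by (rule algebraic_int_if_eigenvalue[where v = "\<lambda>j. x ^ j" and C = C and n = n and k = 0])
      (use m in auto)
qed

section \<open>The local ring at a prime of degree one\<close>

locale residue_prime =
  fixes P :: "'k::field_char_0 set" and p :: nat
  assumes number_field: "number_field TYPE('k)"
    and prime_ideal: "primeideal P (ring_of_integers :: 'k ring)"
    and p: "Factorial_Ring.prime p"
    and residue_field: "(ring_of_integers :: 'k ring) Quot P \<simeq> ZFact (int p)"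
begin

abbreviation \<O> :: "'k ring" where "\<O> \<equiv> ring_of_integers"

sublocale primeideal P \<O>
  by (rule prime_ideal)

lemma ring_simps [simp]:
  "carrier \<O> = {x. algebraic_int x}" "x \<otimes>\<^bsub>\<O>\<^esub> y = x * y" "x \<oplus>\<^bsub>\<O>\<^esub> y = x + y" "\<one>\<^bsub>\<O>\<^esub> = 1" "\<zero>\<^bsub>\<O>\<^esub> = 0"
  by (simp_all add: ring_of_integers_def ring_of_type_algebra_def)

lemma int_add: "algebraic_int x \<Longrightarrow> algebraic_int y \<Longrightarrow> algebraic_int (x + y)" for x y :: 'k
  using a_closed[of x y] by simp

lemma int_mult: "algebraic_int x \<Longrightarrow> algebraic_int y \<Longrightarrow> algebraic_int (x * y)" for x y :: 'k
  using m_closed[of x y] by simp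

lemma int_diff: "algebraic_int x \<Longrightarrow> algebraic_int y \<Longrightarrow> algebraic_int (x - y)" for x y :: 'k
  using int_add[of x "- y"] algebraic_int_minus[of y] by simp

lemma P_zero: "0 \<in> P"
  using additive_subgroup.zero_closed[OF additive_subgroup_axioms] by simp

lemma P_add: "x \<in> P \<Longrightarrow> y \<in> P \<Longrightarrow> x + y \<in> P"
  using additive_subgroup.a_closed[OF additive_subgroup_axioms, of x y] by simp

lemma P_mult: "algebraic_int x \<Longrightarrow> y \<in> P \<Longrightarrow> x * y \<in> P"
  using I_l_closed[of y x] by simp

lemma P_diff: "x \<in> P \<Longrightarrow> y \<in> P \<Longrightarrow> x - y \<in> P"
  using P_add[of x "- 1 * y"] P_mult[of "- 1" y] by simp

lemma one_not_P: "1 \<notin> P"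
proof
  assume "1 \<in> P"
  then have "carrier \<O> = P" using one_imp_carrier by simp
  with I_notcarr show False by simp
qed

lemma P_prime: "algebraic_int x \<Longrightarrow> algebraic_int y \<Longrightarrow> x * y \<in> P \<Longrightarrow> x \<in> P \<or> y \<in> P"
  using I_prime[of x y] by simp

text \<open>The isomorphism of the residue field with \<int>/p is arbitrary, but it preserves 1, so
  by induction it sends the class of an integer to the class of the same integer. Every class
  therefore contains an integer, and the class of \<open>p\<close> is zero.\<close>

lemma residue: "of_nat p \<in> P" "algebraic_int x \<Longrightarrow> \<exists>n::int. x - of_int n \<in> P"
proof -
  let ?Q = "\<O> Quot P" and ?J = "Idl\<^bsub>\<Z>\<^esub> {int p}"
  obtain h where h: "h \<in> Ring.ring_hom ?Q (ZFact (int p))"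
    and bij: "bij_betw h (carrier ?Q) (carrier (ZFact (int p)))"
    using residue_field unfolding is_ring_iso_def ring_iso_def by blast
  interpret J: ideal ?J \<Z> by (simp add: int.genideal_ideal)
  interpret S: ring "ZFact (int p)" using ZFact_is_cring cring.axioms(1) by blast
  have f: "(\<lambda>a. h (P +>\<^bsub>\<O>\<^esub> a)) \<in> Ring.ring_hom \<O> (ZFact (int p))"
    using ring_hom_trans[OF rcos_ring_hom h] by (simp add: comp_def)
  have g: "(\<lambda>n. ?J +>\<^bsub>\<Z>\<^esub> n) \<in> Ring.ring_hom \<Z> (ZFact (int p))"
    using J.rcos_ring_hom by (simp add: ZFact_def)
  have zeroS: "\<zero>\<^bsub>ZFact (int p)\<^esub> = ?J" and zeroQ: "\<zero>\<^bsub>?Q\<^esub> = P" by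
    (simp_all add: ZFact_defs FactRing_def)
  have agree: "h (P +>\<^bsub>\<O>\<^esub> of_int n) = ?J +>\<^bsub>\<Z>\<^esub> n" for n
  proof -
    have f0: "h (P +>\<^bsub>\<O>\<^esub> 0) = \<zero>\<^bsub>ZFact (int p)\<^esub>"
      using ring_hom_zero[OF f ring_axioms S.ring_axioms] by simp
    have g0: "?J +>\<^bsub>\<Z>\<^esub> 0 = \<zero>\<^bsub>ZFact (int p)\<^esub>"
      using ring_hom_zero[OF g int.ring_axioms S.ring_axioms] by simp
    have f1: "h (P +>\<^bsub>\<O>\<^esub> (x + 1)) = h (P +>\<^bsub>\<O>\<^esub> x) \<oplus>\<^bsub>ZFact (int p)\<^esub> \<one>\<^bsub>ZFact (int p)\<^esub>"
      if "algebraic_int x" for x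
      using ring_hom_add[OF f, of x 1] ring_hom_one[OF f] that by simp
    have g1: "?J +>\<^bsub>\<Z>\<^esub> (n + 1) = (?J +>\<^bsub>\<Z>\<^esub> n) \<oplus>\<^bsub>ZFact (int p)\<^esub> \<one>\<^bsub>ZFact (int p)\<^esub>" for n
      using ring_hom_add[OF g, of n 1] ring_hom_one[OF g] by simp
    have fc: "h (P +>\<^bsub>\<O>\<^esub> of_int n) \<in> carrier (ZFact (int p))" for n
      using ring_hom_closed[OF f] by simp
    have gc: "?J +>\<^bsub>\<Z>\<^esub> n \<in> carrier (ZFact (int p))" for n
      using ring_hom_closed[OF g] by simp
    show ?thesis
    proof (induction n rule: int_induct[where k = 0])
      case base
      show ?case using f0 g0 by simp
    next
      case (step1 n)
      then show ?case using f1[of "of_int n"] g1[of n] by simp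
    next
      case (step2 n)
      have "h (P +>\<^bsub>\<O>\<^esub> of_int (n - 1)) \<oplus>\<^bsub>ZFact (int p)\<^esub> \<one>\<^bsub>ZFact (int p)\<^esub> =
          (?J +>\<^bsub>\<Z>\<^esub> (n - 1)) \<oplus>\<^bsub>ZFact (int p)\<^esub> \<one>\<^bsub>ZFact (int p)\<^esub>"
        using f1[OF algebraic_int_of_int, of "n - 1"] g1[of "n - 1"] step2 by simp
      then show ?case
        using fc gc S.one_closed S.add.right_cancel by blast
    qed
  qed
  have mem_Q: "P +>\<^bsub>\<O>\<^esub> a \<in> carrier ?Q" if "algebraic_int a" for a
    using ring_hom_closed[OF rcos_ring_hom] that by simp
  have inj: "P +>\<^bsub>\<O>\<^esub> a = P +>\<^bsub>\<O>\<^esub> b"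
    if "algebraic_int a" "algebraic_int b" "h (P +>\<^bsub>\<O>\<^esub> a) = h (P +>\<^bsub>\<O>\<^esub> b)" for a b
    using bij mem_Q that unfolding bij_betw_def inj_on_def by blast
  have coset: "a - b \<in> P" if "algebraic_int a" "P +>\<^bsub>\<O>\<^esub> a = P +>\<^bsub>\<O>\<^esub> b" for a b
  proof -
    have "a \<in> P +>\<^bsub>\<O>\<^esub> b" using a_rcos_self[of a] that by simp
    then obtain i where "i \<in> P" "a = i + b" unfolding a_r_coset_def' by auto
    then show ?thesis by simp
  qed
  have "int p \<in> ?J" using int.genideal_self'[of "int p"] by simp
  then have "?J +>\<^bsub>\<Z>\<^esub> int p = ?J +>\<^bsub>\<Z>\<^esub> 0"
    using J.a_rcos_const[of "int p"] J.a_rcos_const[OF J.zero_closed] by simp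
  then have "h (P +>\<^bsub>\<O>\<^esub> of_int (int p)) = h (P +>\<^bsub>\<O>\<^esub> of_int 0)" by (simp only: agree)
  from coset[OF _ inj[OF _ _ this]] show "of_nat p \<in> P" by simp
  show "\<exists>n::int. x - of_int n \<in> P" if x: "algebraic_int x"
  proof -
    have "h (P +>\<^bsub>\<O>\<^esub> x) \<in> carrier (ZFact (int p))"
      using ring_hom_closed[OF f, of x] x by simp
    then obtain n where "h (P +>\<^bsub>\<O>\<^esub> x) = ?J +>\<^bsub>\<Z>\<^esub> n"
      by (auto simp: ZFact_defs A_RCOSETS_def')
    then have "h (P +>\<^bsub>\<O>\<^esub> x) = h (P +>\<^bsub>\<O>\<^esub> of_int n)" by (simp only: agree)
    from coset[OF x inj[OF x _ this]] show ?thesis by auto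
  qed
qed

lemma of_int_P_iff: "of_int n \<in> P \<longleftrightarrow> int p dvd n"
proof
  assume "int p dvd n"
  then obtain k where "n = int p * k" by (rule dvdE)
  then have "n = k * int p" by (simp only: mult.commute)
  then show "of_int n \<in> P" using P_mult[OF algebraic_int_of_int residue(1), of k] by simp
next
  assume n: "of_int n \<in> P"
  show "int p dvd n"
  proof (rule ccontr)
    assume "\<not> int p dvd n"
    then have "Rings.coprime (int p) n" using p by (simp add: prime_imp_coprime)
    then obtain u v where "u * int p + v * n = 1" using bezout_int[of "int p" n] by
      (auto simp: coprime_iff_gcd_eq_1)
    then have "(of_int u * of_nat p + of_int v * of_int n :: 'k) = 1"
      by (metis of_int_1 of_int_add of_int_mult of_int_of_nat_eq)
    then show False
      using P_add[OF P_mult[OF algebraic_int_of_int residue(1)] P_mult[OF algebraic_int_of_int n]] one_not_P by metis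
  qed
qed

definition local_ring :: "'k set" where
  "local_ring = {a / b | a b. algebraic_int a \<and> algebraic_int b \<and> b \<notin> P}"

lemma local_ringI: "algebraic_int a \<Longrightarrow> algebraic_int b \<Longrightarrow> b \<notin> P \<Longrightarrow> a / b \<in> local_ring"
  by (auto simp: local_ring_def)

lemma int_local_ring: "algebraic_int a \<Longrightarrow> a \<in> local_ring"
  using local_ringI[of a 1] one_not_P by simp

text \<open>If \<open>f(x) = 0\<close> for a primitive integer polynomial \<open>f\<close> with Horner values \<open>B\<^sub>m\<close>, then the \<open>B\<^sub>m\<close> and
  the \<open>x B\<^sub>m\<close> are integral.  The coefficients of \<open>f\<close> are differences of these, so not all of
  them lie in \<open>P\<close>; and \<open>x\<close> is the quotient of \<open>x B\<^sub>m\<close> by \<open>B\<^sub>m\<close>.\<close>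

lemma inverse_local_ring:
  assumes "x \<notin> local_ring"
  shows "inverse x \<in> local_ring"
proof -
  have x: "x \<noteq> 0" using assms int_local_ring by auto
  obtain g where g: "g \<noteq> 0" "poly (map_poly of_int g) x = 0"
    using algebraic_if_number_field[OF number_field] by (metis algebraicE')
  define f where "f = primitive_part g"
  have "g = Polynomial.smult (content g) f" by (simp add: f_def)
  then have "poly (map_poly of_int g) x = of_int (content g) * poly (map_poly of_int f) x"
    by (metis of_int_hom.map_poly_hom_smult poly_smult)
  then have root: "poly (map_poly of_int f) x = 0" using g by simp
  have "content f = 1" using g by (simp add: f_def)
  define n where "n = Polynomial.degree f"
  define c where "c = poly.coeff f"
  have sum0: "(\<Sum>i\<le>n. of_int (c i) * x ^ i) = 0"
    using root by (simp add: poly_altdef n_def c_def)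
  define B where "B m = (\<Sum>i\<in>{m..n}. of_int (c i) * x ^ (i - m))" for m
  have xB: "x * B (Suc m) = (\<Sum>i\<in>{m<..n}. of_int (c i) * x ^ (i - m))" if "m < n" for m
  proof -
    have "x * (of_int (c i) * x ^ (i - Suc m)) = of_int (c i) * x ^ (i - m)" if "i \<in> {m<..n}" for i
      using that by (simp add: Suc_diff_Suc mult.left_commute flip: power_Suc)
    then show ?thesis
      unfolding B_def sum_distrib_left by (intro sum.cong) auto
  qed
  have xB_int: "algebraic_int (x * B (Suc m))" if "m < n" for m
    unfolding xB[OF that] using algebraic_int_horner[OF sum0 that] .
  have B_rec: "B m = of_int (c m) + x * B (Suc m)" if "m < n" for m
  proof -
    have "{m..n} = insert m {m<..n}" using that by auto
    then show ?thesis unfolding xB[OF that] by (simp add: B_def)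
  qed
  have B_n: "B n = of_int (c n)" by (simp add: B_def)
  have B_int: "algebraic_int (B m)" if "m \<le> n" for m
    using that B_n B_rec[of m] int_add[OF algebraic_int_of_int xB_int, of m] by (cases "m = n") auto
  have B0: "B 0 = 0" using sum0 by (simp add: B_def atMost_atLeast0)
  have "\<exists>m<n. B (Suc m) \<notin> P \<or> x * B (Suc m) \<notin> P"
  proof (rule ccontr)
    assume "\<not> ?thesis"
    then have all: "B (Suc m) \<in> P" "x * B (Suc m) \<in> P" if "m < n" for m using that by blast+
    have "of_int (c m) \<in> P" if "m \<le> n" for m
    proof (cases "m = n")
      case True
      show ?thesis
      proof (cases n)
        case 0
        then show ?thesis using True B_n B0 P_zero by simp
      next
        case (Suc k)
        then show ?thesis using True all(1)[of k] B_n by simp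
      qed
    next
      case False
      then have m: "m < n" using that by simp
      have "B m \<in> P" using B0 P_zero all(1)[of "m - 1"] m by (cases m) auto
      then have "B m - x * B (Suc m) \<in> P" using all(2)[OF m] by (rule P_diff)
      then show ?thesis using B_rec[OF m] by simp
    qed
    then have "int p dvd c m" for m
      using of_int_P_iff by (cases "m \<le> n") (auto simp: c_def n_def coeff_eq_0)
    then have "[:int p:] dvd f" by (simp add: c_def const_poly_dvd_iff)
    then have "int p dvd content f" by (simp only: const_poly_dvd_iff_dvd_content)
    with \<open>content f = 1\<close> show False using p by (auto dest: prime_gt_1_nat)
  qed
  then obtain m where m: "m < n" "B (Suc m) \<notin> P \<or> x * B (Suc m) \<notin> P" by blast
  have int: "algebraic_int (B (Suc m))" "algebraic_int (x * B (Suc m))"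
    using B_int xB_int m by auto
  have B: "B (Suc m) \<noteq> 0" using m P_zero by auto
  show ?thesis
  proof (cases "B (Suc m) \<in> P")
    case False
    then have "(x * B (Suc m)) / B (Suc m) \<in> local_ring" using int by (intro local_ringI)
    with assms B show ?thesis by simp
  next
    case True
    then have "B (Suc m) / (x * B (Suc m)) \<in> local_ring" using int m by (intro local_ringI) auto
    with B x show ?thesis by (simp add: field_simps)
  qed
qed

sublocale local: valuation_ring local_ring
proof
  show "1 \<in> local_ring" by (rule int_local_ring) simp
  fix x y assume "x \<in> local_ring" "y \<in> local_ring"
  then obtain a b c d where ab: "x = a / b" "algebraic_int a" "algebraic_int b" "b \<notin> P"
    and cd: "y = c / d" "algebraic_int c" "algebraic_int d" "d \<notin> P" by (auto simp: local_ring_def)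
  have "b \<noteq> 0" "d \<noteq> 0" using ab cd P_zero by auto
  then have "x - y = (a * d - c * b) / (b * d)" "x * y = (a * c) / (b * d)"
    by (simp_all add: ab cd field_simps)
  moreover have "b * d \<notin> P" using P_prime ab cd by blast
  ultimately show "x - y \<in> local_ring" "x * y \<in> local_ring"
    using ab cd int_mult int_diff by (auto intro!: local_ringI)
qed (rule inverse_local_ring)

lemma P_in_M: "x \<in> P \<Longrightarrow> x \<in> local.M"
proof (rule ccontr)
  assume x: "x \<in> P" "x \<notin> local.M"
  then have "x \<noteq> 0" "inverse x \<in> local_ring" by (auto simp: local.M_def)
  then obtain a b where "inverse x = a / b" "algebraic_int a" "algebraic_int b" "b \<notin> P"
    by (auto simp: local_ring_def)
  moreover from this \<open>x \<noteq> 0\<close> have "b = a * x" using P_zero by (auto simp: field_simps)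
  ultimately show False using P_mult x by simp
qed

lemma int_M_iff: "algebraic_int x \<Longrightarrow> x \<in> local.M \<longleftrightarrow> x \<in> P"
  using P_in_M local_ringI[of 1 x] P_zero by (auto simp: local.M_def divide_inverse)

lemma of_int_M_iff: "of_int n \<in> local.M \<longleftrightarrow> int p dvd n"
  by (simp add: int_M_iff of_int_P_iff)

text \<open>If \<open>a\<close> and \<open>b\<close> are congruent to integers \<open>n\<close> and
  \<open>k\<close>, and \<open>v\<close> inverts \<open>k\<close> modulo \<open>p\<close>, then
  \<open>a / b\<close> is congruent to \<open>n v\<close>.\<close>

lemma local_residue:
  assumes "x \<in> local_ring"
  shows "\<exists>n::int. x - of_int n \<in> local.M"
proof -
  obtain a b where ab: "x = a / b" "algebraic_int a" "algebraic_int b" "b \<notin> P"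
    using assms by (auto simp: local_ring_def)
  obtain n k :: int where n: "a - of_int n \<in> P" and k: "b - of_int k \<in> P"
    using residue(2) ab by blast
  have "\<not> int p dvd k"
    using P_add[OF k, of "of_int k"] of_int_P_iff ab(4) by auto
  then have "Rings.coprime (int p) k" using p by (simp add: prime_imp_coprime)
  then obtain u v where "u * int p + v * k = 1" using bezout_int[of "int p" k] by
    (auto simp: coprime_iff_gcd_eq_1)
  then have "1 - v * k = u * int p" by linarith
  then have vk: "of_int (1 - v * k) \<in> P" unfolding of_int_P_iff by simp
  have "a - of_int (n * v) * b = (a - of_int n) + of_int n * of_int (1 - v * k) - of_int (n * v) * (b - of_int k)"
    by (simp add: algebra_simps)
  also have "\<dots> \<in> P"
    by (intro P_diff P_add P_mult algebraic_int_of_int n k vk)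
  finally have "(a - of_int (n * v) * b) * (1 / b) \<in> local.M"
    using ab by (intro local.M_mult' P_in_M local_ringI) auto
  moreover have "(a - of_int (n * v) * b) * (1 / b) = x - of_int (n * v)"
  proof -
    have "b \<noteq> 0" using ab P_zero by auto
    then show ?thesis by (simp add: ab(1) diff_divide_distrib)
  qed
  ultimately show ?thesis by metis
qed

end

section \<open>Hasse's bound\<close>

lemma prime_elem_dvd_if_not_coprime:
  fixes p :: "'a::field_gcd poly"
  assumes "\<not> is_unit p"
  obtains r where "prime_elem r" "r dvd p"
proof (cases "p = 0")
  case True
  have "prime_elem [:0, 1 :: 'a:]"
    by (rule prime_elem_linear_field_poly) simp
  with True show ?thesis using that by simp
next
  case False
  from prime_divisor_exists[OF this assms] show ?thesis
    using that by (auto simp: Factorial_Ring.prime_def)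
qed

text \<open>The entries are the coefficients of a binary quadratic form whose roots are two
  abscissae. Primitivity fixes such a triple up to a constant, so that degrees can be read off from
  equations in the function field.\<close>

definition primitive3 :: "'a::field_gcd poly \<Rightarrow> 'a poly \<Rightarrow> 'a poly \<Rightarrow> bool" where
  "primitive3 A B C \<longleftrightarrow> (\<forall>r. prime_elem r \<longrightarrow> \<not> (r dvd A \<and> r dvd B \<and> r dvd C))"

lemma primitive3_dvd:
  fixes u w :: "'a::field_gcd poly"
  assumes "primitive3 A B C" "u dvd w * A" "u dvd w * B" "u dvd w * C"
  shows "u dvd w"
proof -
  let ?g = "gcd A (gcd B C)"
  have "is_unit ?g"
  proof (rule ccontr)
    assume "\<not> is_unit ?g"
    then obtain r where "prime_elem r" "r dvd ?g" by (rule prime_elem_dvd_if_not_coprime)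
    then show False using assms(1) unfolding primitive3_def by (auto elim: dvd_trans)
  qed
  then have g: "?g = 1" by (simp only: is_unit_gcd coprime_iff_gcd_eq_1)
  obtain x y where xy: "x * A + y * gcd B C = 1"
    using bezout_coefficients_fst_snd[of A "gcd B C"] g by metis
  obtain z v where zv: "z * B + v * C = gcd B C"
    using bezout_coefficients_fst_snd[of B C] by metis
  have "w = w * (x * A + y * (z * B + v * C))" using xy zv by simp
  also have "\<dots> = x * (w * A) + y * z * (w * B) + y * v * (w * C)" by (simp add: algebra_simps)
  finally show ?thesis using assms(2-4) by (metis dvd_add dvd_mult)
qed

text \<open>By primitivity the factors \<open>u\<close> and \<open>w\<close> divide each other, so
  they have the same degree.\<close>

lemma primitive3_proportional_degree:
  fixes u w :: "'a::field_gcd poly"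
  assumes prim: "primitive3 A B C" "primitive3 A' B' C'"
    and nz: "u \<noteq> 0" "w \<noteq> 0"
    and eq: "u * A = w * A'" "u * B = w * B'" "u * C = w * C'"
  shows "A = 0 \<longleftrightarrow> A' = 0" "deg A = deg A'" "deg B = deg B'"
proof -
  have "u dvd w" using primitive3_dvd[OF prim(2)] eq by (metis dvd_triv_left)
  moreover have "w dvd u" using primitive3_dvd[OF prim(1)] eq by (metis dvd_triv_left)
  ultimately have deg: "deg u = deg w"
    using nz by (meson dvd_imp_degree_le le_antisym)
  show zero: "A = 0 \<longleftrightarrow> A' = 0" using eq(1) nz by auto
  have "deg p = deg p'" if "u * p = w * p'" for p p'
  proof (cases "p = 0")
    case True
    then show ?thesis using that nz by auto
  next
    case False
    then have "p' \<noteq> 0" using that nz by auto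
    with False that deg show ?thesis
      using degree_mult_eq[of u p] degree_mult_eq[of w p'] nz by simp
  qed
  then show "deg A = deg A'" "deg B = deg B'"
    using eq by blast+
qed

text \<open>Gauss's lemma for a product of two linear forms.\<close>

lemma primitive3_product:
  fixes f g f' g' :: "'a::field_gcd poly"
  assumes "Rings.coprime f g" "Rings.coprime f' g'"
  shows "primitive3 (f * f') (f * g' + f' * g) (g * g')"
  unfolding primitive3_def
proof (intro allI impI notI, elim conjE)
  fix r assume r: "prime_elem r" "r dvd f * f'" "r dvd f * g' + f' * g" "r dvd g * g'"
  have no: "\<not> (r dvd f \<and> r dvd g)" "\<not> (r dvd f' \<and> r dvd g')"
    using assms r(1) by (meson coprime_common_divisor prime_elem_not_unit)+
  have "r dvd f \<or> r dvd f'" "r dvd g \<or> r dvd g'"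
    using r prime_elem_dvd_mult_iff by blast+
  then consider "r dvd f" "r dvd g'" | "r dvd f'" "r dvd g" using no by blast
  then show False
  proof cases
    case 1
    then have "r dvd f' * g" using r(3) by (metis dvd_add_right_iff dvd_mult2)
    then show False using 1 no r(1) prime_elem_dvd_mult_iff by blast
  next
    case 2
    then have "r dvd f * g'" using r(3) by (metis dvd_add_left_iff dvd_mult2)
    then show False using 2 no r(1) prime_elem_dvd_mult_iff by blast
  qed
qed

abbreviation T :: "'a::comm_ring_1 poly" where "T \<equiv> [:0, 1:]"

lemma cubic_eq: "cubic a b = T ^ 3 + [:a:] * T + [:b:]"
  by (simp add: power3_eq_cube)

text \<open>The classical formulas for the product and, in \<open>add_sub_sum\<close>, the sum of
  the abscissae of \<open>S + P\<close> and \<open>S - P\<close>, made homogeneous in the abscissa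
  \<open>f / g\<close> of \<open>S\<close>. Here \<open>t\<close> is the abscissa of
  \<open>P\<close>, and the common denominator is \<open>(f - t g)^2\<close>.\<close>

definition add_sub_product :: "'a::comm_ring_1 \<Rightarrow> 'a \<Rightarrow> 'a \<Rightarrow> 'a \<Rightarrow> 'a \<Rightarrow> 'a" where
  "add_sub_product \<alpha> \<beta> t f g = (f * t - \<alpha> * g)\<^sup>2 - 4 * \<beta> * g * (f + t * g)"

definition add_sub_sum :: "'a::comm_ring_1 \<Rightarrow> 'a \<Rightarrow> 'a \<Rightarrow> 'a \<Rightarrow> 'a \<Rightarrow> 'a" where
  "add_sub_sum \<alpha> \<beta> t f g = 2 * ((f * t + \<alpha> * g) * (f + t * g) + 2 * \<beta> * g\<^sup>2)"

text \<open>A common prime factor \<open>r\<close> divides \<open>f - T g\<close> but not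
  \<open>g\<close>. Modulo \<open>r\<close> the sum becomes \<open>4 g^2 \<Lambda>\<close> and the
  product \<open>g^2 (\<Lambda>'^2 - 8 T \<Lambda>)\<close>, with \<Lambda> the cubic. So
  \<open>r\<close> divides \<Lambda> and its derivative, hence the discriminant, which is a nonzero
  constant.\<close>

lemma primitive3_add_sub:
  fixes a b :: "'a::field_gcd"
  assumes two: "(2 :: 'a) \<noteq> 0" and disc: "4 * a ^ 3 + 27 * b\<^sup>2 \<noteq> 0" and cop: "Rings.coprime f g"
  shows "primitive3 (add_sub_product [:a:] [:b:] T f g) (add_sub_sum [:a:] [:b:] T f g) ((f - T * g)\<^sup>2)"
  unfolding primitive3_def
proof (intro allI impI notI, elim conjE)
  fix r :: "'a poly"
  define \<alpha> \<beta> t where "\<alpha> = [:a:]" and "\<beta> = [:b:]" and "t = (T :: 'a poly)"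
  assume r: "prime_elem r" "r dvd add_sub_product [:a:] [:b:] T f g"
    "r dvd add_sub_sum [:a:] [:b:] T f g" "r dvd (f - T * g)\<^sup>2"
  define e where "e = f - t * g"
  have f: "f = e + t * g" by (simp add: e_def)
  have e: "r dvd e" using r(1,4) prime_elem_dvd_power unfolding e_def t_def by blast
  have g: "\<not> r dvd g"
  proof
    assume "r dvd g"
    moreover from this have "r dvd f" using e unfolding f by simp
    ultimately show False using cop r(1) by (meson coprime_common_divisor prime_elem_not_unit)
  qed
  define \<Lambda> where "\<Lambda> = t ^ 3 + \<alpha> * t + \<beta>"
  have "add_sub_sum \<alpha> \<beta> t f g = e * (2 * (t * (e + 2 * t * g) + (t\<^sup>2 + \<alpha>) * g)) + 4 * (g\<^sup>2 * \<Lambda>)"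
    unfolding add_sub_sum_def f \<Lambda>_def by Groebner_Basis.algebra
  then have "r dvd 4 * (g\<^sup>2 * \<Lambda>)"
    using r(3) e unfolding \<alpha>_def \<beta>_def t_def by (metis dvd_add_right_iff dvd_mult2)
  moreover have "is_unit (4 :: 'a poly)"
  proof -
    have "(4 :: 'a) = 2 * 2" by simp
    then have "(4 :: 'a) \<noteq> 0" using two by (simp only: mult_eq_0_iff simp_thms)
    then have "is_unit [:4 :: 'a:]" by (simp add: is_unit_const_poly_iff dvd_field_iff)
    then show ?thesis by (simp only: numeral_poly)
  qed
  ultimately have "r dvd g\<^sup>2 * \<Lambda>" by (simp add: dvd_mult_unit_iff')
  then have \<Lambda>: "r dvd \<Lambda>"
    using g r(1) prime_elem_dvd_mult_iff prime_elem_dvd_power by blast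
  have "add_sub_product \<alpha> \<beta> t f g =
      e * (t\<^sup>2 * (e + t * g) + t * g * t\<^sup>2 - 2 * \<alpha> * g * t - 4 * \<beta> * g) + g\<^sup>2 * ((3 * t\<^sup>2 + \<alpha>)\<^sup>2 - 8 * t * \<Lambda>)"
    unfolding add_sub_product_def f \<Lambda>_def by Groebner_Basis.algebra
  then have "r dvd g\<^sup>2 * ((3 * t\<^sup>2 + \<alpha>)\<^sup>2 - 8 * t * \<Lambda>)"
    using r(2) e unfolding \<alpha>_def \<beta>_def t_def by (metis dvd_add_right_iff dvd_mult2)
  then have "r dvd (3 * t\<^sup>2 + \<alpha>)\<^sup>2 - 8 * t * \<Lambda>"
    using g r(1) prime_elem_dvd_mult_iff prime_elem_dvd_power by blast
  then have "r dvd (3 * t\<^sup>2 + \<alpha>)\<^sup>2"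
    using \<Lambda> dvd_diff_left_iff[of r "8 * t * \<Lambda>"] by simp
  then have \<Lambda>': "r dvd 3 * t\<^sup>2 + \<alpha>" using r(1) prime_elem_dvd_power by blast
  have "4 * \<alpha> ^ 3 + 27 * \<beta>\<^sup>2 = (6 * \<alpha> * t\<^sup>2 - 9 * \<beta> * t + 4 * \<alpha>\<^sup>2) * (3 * t\<^sup>2 + \<alpha>) + (27 * \<beta> - 18 * \<alpha> * t) * \<Lambda>"
    unfolding \<Lambda>_def by Groebner_Basis.algebra
  then have "r dvd 4 * \<alpha> ^ 3 + 27 * \<beta>\<^sup>2" using \<Lambda> \<Lambda>' by simp
  also have "4 * \<alpha> ^ 3 + 27 * \<beta>\<^sup>2 = [:4 * a ^ 3 + 27 * b\<^sup>2:]"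
    by (simp add: \<alpha>_def \<beta>_def numeral_poly power2_eq_square power3_eq_cube)
  finally have "r dvd [:4 * a ^ 3 + 27 * b\<^sup>2:]" .
  moreover have "is_unit [:4 * a ^ 3 + 27 * b\<^sup>2:]"
    using disc by (simp add: is_unit_const_poly_iff dvd_field_iff)
  ultimately have "is_unit r" by (rule dvd_trans)
  with r(1) show False using prime_elem_not_unit by blast
qed

text \<open>The fraction \<open>f / g\<close> tends to infinity at the infinite place.\<close>

definition improper :: "'a::zero poly \<Rightarrow> 'a poly \<Rightarrow> bool" where
  "improper f g \<longleftrightarrow> f \<noteq> 0 \<and> (g = 0 \<or> deg g < deg f)"

text \<open>The square of \<open>f T\<close> dominates the product, because \<open>g\<close> is of
  smaller degree than \<open>f\<close> or zero. The strict drop in the degree of the sum is what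
  later transfers \<open>improper\<close> to the next point.\<close>

lemma degree_add_sub:
  fixes a b :: "'a::field"
  assumes "improper f g"
  shows "deg (add_sub_product [:a:] [:b:] T f g) = 2 * deg f + 2"
    and "deg (add_sub_sum [:a:] [:b:] T f g) \<le> 2 * deg f + 1"
proof -
  let ?d = "deg f"
  have f: "f \<noteq> 0" and g: "deg g \<le> ?d" "g = 0 \<or> deg g < ?d"
    using assms by (auto simp: improper_def)
  have T: "deg (f * T) = ?d + 1" using f by (subst degree_mult_eq) auto
  have c: "deg ([:x:] * p) \<le> deg p" for x and p :: "'a poly" by simp
  have Tg: "deg (T * g) \<le> ?d"
    using g(2) by (cases "g = 0") (auto simp: degree_mult_eq simp del: mult_pCons_left)
  have fTg: "deg (f + T * g) \<le> ?d" using Tg by (intro degree_add_le) auto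
  have lin: "deg (f * T - [:a:] * g) = ?d + 1"
  proof -
    have "deg ([:- a:] * g) < deg (f * T)"
      using c[of "- a" g] g(1) T by linarith
    from degree_add_eq_left[OF this] T show ?thesis by simp
  qed
  then have "f * T - [:a:] * g \<noteq> 0" by force
  then have sq: "deg ((f * T - [:a:] * g)\<^sup>2) = 2 * ?d + 2"
    using lin by (simp add: power2_eq_square degree_mult_eq del: mult_pCons_left mult_pCons_right)
  have four: "4 * [:b:] * g = [:4 * b:] * g" by (simp add: numeral_poly mult.commute)
  have "deg (4 * [:b:] * g * (f + T * g)) \<le> 2 * ?d"
  proof -
    have "deg ([:4 * b:] * g * (f + T * g)) \<le> deg ([:4 * b:] * g) + deg (f + T * g)"
      by (rule degree_mult_le)
    also have "\<dots> \<le> 2 * ?d" using c[of "4 * b" g] g(1) fTg by linarith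
    finally show ?thesis unfolding four .
  qed
  then have "deg (- (4 * [:b:] * g * (f + T * g))) < deg ((f * T - [:a:] * g)\<^sup>2)"
    unfolding sq degree_minus by linarith
  from degree_add_eq_left[OF this]
  show "deg (add_sub_product [:a:] [:b:] T f g) = 2 * ?d + 2"
    unfolding add_sub_product_def sq by (simp only: add_uminus_conv_diff)
  have "deg (f * T + [:a:] * g) \<le> ?d + 1"
    using T c[of a g] g(1) by (intro degree_add_le) auto
  then have "deg ((f * T + [:a:] * g) * (f + T * g)) \<le> 2 * ?d + 1"
    using fTg degree_mult_le[of "f * T + [:a:] * g" "f + T * g"] by linarith
  moreover have "deg (2 * [:b:] * g\<^sup>2) \<le> 2 * ?d + 1"
  proof -
    have "2 * [:b:] * g\<^sup>2 = [:2 * b:] * (g * g)" by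
      (simp add: numeral_poly power2_eq_square mult.commute)
    then show ?thesis using c[of "2 * b" "g * g"] degree_mult_le[of g g] g(1) by simp
  qed
  ultimately have le: "deg ((f * T + [:a:] * g) * (f + T * g) + 2 * [:b:] * g\<^sup>2) \<le> 2 * ?d + 1"
    by (rule degree_add_le)
  have eq: "add_sub_sum [:a:] [:b:] T f g = [:2:] * ((f * T + [:a:] * g) * (f + T * g) + 2 * [:b:] * g\<^sup>2)"
    unfolding add_sub_sum_def numeral_poly[symmetric] ..
  show "deg (add_sub_sum [:a:] [:b:] T f g) \<le> 2 * ?d + 1"
    unfolding eq by (rule order_trans[OF c le])
qed

text \<open>Both triples are primitive and proportional, so their entries have equal degrees; the
  first entry gives the recurrence.\<close>

lemma add_sub_step:
  fixes a b :: "'a::field_gcd"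
  assumes two: "(2 :: 'a) \<noteq> 0" and disc: "4 * a ^ 3 + 27 * b\<^sup>2 \<noteq> 0"
    and cop: "Rings.coprime f g" "Rings.coprime f1 g1" "Rings.coprime f2 g2"
    and impr: "improper f g" "improper f1 g1"
    and nz: "u \<noteq> 0" "w \<noteq> 0"
    and eq: "u * add_sub_product [:a:] [:b:] T f g = w * (f1 * f2)"
      "u * add_sub_sum [:a:] [:b:] T f g = w * (f1 * g2 + f2 * g1)" "u * (f - T * g)\<^sup>2 = w * (g1 * g2)"
  shows "improper f2 g2" "deg f1 + deg f2 = 2 * deg f + 2"
proof -
  note prp = primitive3_proportional_degree[OF primitive3_add_sub[OF two disc cop(1)] primitive3_product[OF cop(2,3)] nz eq]
  have d1: "deg (f1 * f2) = 2 * deg f + 2"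
    using prp(2) degree_add_sub(1)[OF impr(1), of a b] by simp
  have d2: "deg (f1 * g2 + f2 * g1) \<le> 2 * deg f + 1"
    using prp(3) degree_add_sub(2)[OF impr(1), of a b] by simp
  have f12: "f1 * f2 \<noteq> 0" using d1 by force
  then show sum: "deg f1 + deg f2 = 2 * deg f + 2"
    using d1 by (simp add: degree_mult_eq)
  show "improper f2 g2"
  proof (rule ccontr)
    assume "\<not> improper f2 g2"
    then have g2: "g2 \<noteq> 0" "deg f2 \<le> deg g2" using f12 by (auto simp: improper_def)
    \<comment> \<open>Then the middle entry has degree \<open>deg f1 + deg g2\<close>, at least
      \<open>deg f1 + deg f2 = 2 deg f + 2\<close>, which exceeds the bound
      \<open>2 deg f + 1\<close>.\<close>
    have "deg (f2 * g1) < deg (f1 * g2)"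
    proof (cases "g1 = 0")
      case True
      then show ?thesis using f12 g2 sum by (simp add: degree_mult_eq) linarith
    next
      case False
      then show ?thesis using f12 g2 impr(2) by (auto simp: degree_mult_eq improper_def)
    qed
    then have "deg (f1 * g2 + f2 * g1) = deg f1 + deg g2"
      using degree_add_eq_left f12 g2 by (metis degree_mult_eq mult_eq_0_iff)
    then show False using d2 sum g2 by linarith
  qed
qed

text \<open>The quadratic twist \<open>L y\<^sup>2 = x\<^sup>3 + \<alpha> x + \<beta>\<close> in the coordinates \<open>(L x, L\<^sup>2 y)\<close>, in which \<open>P\<close> is
  the point \<open>(\<tau>, 1)\<close>.\<close>

locale twisted_cubic =
  fixes \<alpha> \<beta> \<tau> L :: "'a::field"
  assumes two_\<tau>: "(2 :: 'a) \<noteq> 0" and disc_\<tau>: "4 * \<alpha> ^ 3 + 27 * \<beta>\<^sup>2 \<noteq> 0"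
    and L_eq: "L = \<tau> ^ 3 + \<alpha> * \<tau> + \<beta>" and L_nonzero: "L \<noteq> 0"
begin

sublocale nonsingular_cubic "\<alpha> * L\<^sup>2" "\<beta> * L ^ 3"
proof
  have "4 * (\<alpha> * L\<^sup>2) ^ 3 + 27 * (\<beta> * L ^ 3)\<^sup>2 = L ^ 6 * (4 * \<alpha> ^ 3 + 27 * \<beta>\<^sup>2)"
    by Groebner_Basis.algebra
  then show "4 * (\<alpha> * L\<^sup>2) ^ 3 + 27 * (\<beta> * L ^ 3)\<^sup>2 \<noteq> 0" using L_nonzero disc_\<tau> by simp
qed (rule two_\<tau>)

notation add (infixl "\<oplus>\<^sub>L" 65)

definition P :: "'a point" where "P = Affine (L * \<tau>) (L\<^sup>2)"

lemma on_P: "on P"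
proof -
  have "(L\<^sup>2)\<^sup>2 = (L * \<tau>) ^ 3 + \<alpha> * L\<^sup>2 * (L * \<tau>) + \<beta> * L ^ 3"
    using diff_eq_0[OF L_eq] by Groebner_Basis.algebra
  then show ?thesis by (simp add: P_def)
qed

text \<open>\<open>f / g\<close> is the abscissa on the twist itself, before multiplication by
  \<open>L\<close>; infinity has a ratio with denominator 0.\<close>

definition has_ratio :: "'a point \<Rightarrow> 'a \<Rightarrow> 'a \<Rightarrow> bool" where
  "has_ratio S f g \<longleftrightarrow>
    (case S of Infinity \<Rightarrow> g = 0 \<and> f \<noteq> 0 | Affine x y \<Rightarrow> g \<noteq> 0 \<and> x * g = L * f)"

lemma double_P:
  obtains x y where "P \<oplus>\<^sub>L P = Affine x y" "4 * x = (\<tau>\<^sup>2 - \<alpha>)\<^sup>2 - 8 * \<beta> * \<tau>"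
proof -
  define l where "l = (3 * \<tau>\<^sup>2 + \<alpha>) / 2"
  have l: "2 * l = 3 * \<tau>\<^sup>2 + \<alpha>" using two_\<tau> by (simp add: l_def)
  have "l * (2 * L\<^sup>2) = 3 * (L * \<tau>)\<^sup>2 + \<alpha> * L\<^sup>2"
    using diff_eq_0[OF l] by Groebner_Basis.algebra
  moreover have "l\<^sup>2 = L * \<tau> + L * \<tau> + (l\<^sup>2 - 2 * L * \<tau>)" by simp
  ultimately have "P \<oplus>\<^sub>L P = Affine (l\<^sup>2 - 2 * L * \<tau>) (- (l * (l\<^sup>2 - 2 * L * \<tau> - L * \<tau>) + L\<^sup>2))"
    unfolding P_def using L_nonzero by (intro add_tangent) auto
  moreover have "4 * (l\<^sup>2 - 2 * L * \<tau>) = (\<tau>\<^sup>2 - \<alpha>)\<^sup>2 - 8 * \<beta> * \<tau>"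
    using diff_eq_0[OF l] diff_eq_0[OF L_eq] by Groebner_Basis.algebra
  ultimately show ?thesis by (rule that)
qed

text \<open>The sign \<open>e\<close> treats \<open>P\<close> and \<open>- P\<close> in one
  computation; they are \<open>(L \<tau>, L^2 e)\<close> for \<open>e = 1\<close> and
  \<open>e = - 1\<close>.\<close>

lemma add_P_affine:
  assumes "x \<noteq> L * \<tau>" and on: "on (Affine x (L\<^sup>2 * \<eta>))" and x: "x = L * \<xi>"
    and e: "e\<^sup>2 = 1"
  obtains x2 y2 where "Affine x (L\<^sup>2 * \<eta>) \<oplus>\<^sub>L Affine (L * \<tau>) (L\<^sup>2 * e) = Affine (L * x2) y2"
    "(\<xi> - \<tau>)\<^sup>2 * x2 = (\<xi> + \<tau>) * (\<xi> * \<tau> + \<alpha>) + 2 * \<beta> - 2 * L * \<eta> * e"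
    "L * \<eta>\<^sup>2 = \<xi> ^ 3 + \<alpha> * \<xi> + \<beta>"
proof -
  have D: "\<xi> - \<tau> \<noteq> 0" using assms(1) x by auto
  have "L ^ 3 * (L * \<eta>\<^sup>2) = L ^ 3 * (\<xi> ^ 3 + \<alpha> * \<xi> + \<beta>)"
  proof -
    have "(L\<^sup>2 * \<eta>)\<^sup>2 - (x ^ 3 + \<alpha> * L\<^sup>2 * x + \<beta> * L ^ 3) = 0" using on by simp
    then show ?thesis unfolding x by Groebner_Basis.algebra
  qed
  then have \<eta>: "L * \<eta>\<^sup>2 = \<xi> ^ 3 + \<alpha> * \<xi> + \<beta>" using L_nonzero by simp
  define m where "m = (e - \<eta>) / (\<tau> - \<xi>)"
  have m: "m * (\<tau> - \<xi>) = e - \<eta>" using D by (simp add: m_def)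
  define x2 where "x2 = L * m\<^sup>2 - \<xi> - \<tau>"
  have "Affine x (L\<^sup>2 * \<eta>) \<oplus>\<^sub>L Affine (L * \<tau>) (L\<^sup>2 * e) =
      Affine (L * x2) (- (L * m * (L * x2 - x) + L\<^sup>2 * \<eta>))"
  proof (rule add_chord)
    show "L * m * (L * \<tau> - x) = L\<^sup>2 * e - L\<^sup>2 * \<eta>"
      using diff_eq_0[OF m] unfolding x by Groebner_Basis.algebra
    show "(L * m)\<^sup>2 = x + L * \<tau> + L * x2"
      unfolding x x2_def by Groebner_Basis.algebra
  qed (rule assms(1))
  moreover have "(\<xi> - \<tau>)\<^sup>2 * x2 = (\<xi> + \<tau>) * (\<xi> * \<tau> + \<alpha>) + 2 * \<beta> - 2 * L * \<eta> * e"
  proof -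
    have "(\<xi> - \<tau>)\<^sup>2 * x2 = L * (m * (\<tau> - \<xi>))\<^sup>2 - (\<xi> + \<tau>) * (\<xi> - \<tau>)\<^sup>2"
      unfolding x2_def by Groebner_Basis.algebra
    also have "\<dots> = L * e\<^sup>2 + L * \<eta>\<^sup>2 - 2 * L * \<eta> * e - (\<xi> + \<tau>) * (\<xi> - \<tau>)\<^sup>2"
      unfolding m by Groebner_Basis.algebra
    also have "\<dots> = (\<xi> + \<tau>) * (\<xi> * \<tau> + \<alpha>) + 2 * \<beta> - 2 * L * \<eta> * e"
      unfolding e \<eta> using diff_eq_0[OF L_eq] by Groebner_Basis.algebra
    finally show ?thesis .
  qed
  ultimately show ?thesis using \<eta> by (rule that)
qed

text \<open>The triples are compared only up to a common factor, so that \<open>S\<close>,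
  \<open>S + P\<close> or \<open>S - P\<close> may be infinity.\<close>

lemma add_sub_ratio:
  assumes S: "on S" and r: "has_ratio S f g" "has_ratio (S \<oplus>\<^sub>L point_neg P) f1 g1" "has_ratio (S \<oplus>\<^sub>L P) f2 g2"
  obtains u w where "u \<noteq> 0" "w \<noteq> 0" "u * add_sub_product \<alpha> \<beta> \<tau> f g = w * (f1 * f2)"
      "u * add_sub_sum \<alpha> \<beta> \<tau> f g = w * (f1 * g2 + f2 * g1)" "u * (f - \<tau> * g)\<^sup>2 = w * (g1 * g2)"
proof (cases S)
  case Infinity
  then have *: "g = 0" "f \<noteq> 0" "g1 \<noteq> 0" "g2 \<noteq> 0" "f1 = \<tau> * g1" "f2 = \<tau> * g2"
    using r L_nonzero by (auto simp: P_def has_ratio_def)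
  show ?thesis
  proof (rule that)
    show "g1 * g2 \<noteq> 0" "f\<^sup>2 \<noteq> 0" using * by simp_all
  qed (simp_all add: * add_sub_product_def add_sub_sum_def algebra_simps power2_eq_square)
next
  case (Affine x y)
  have g: "g \<noteq> 0" and xg: "x * g = L * f" using r(1) Affine by (auto simp: has_ratio_def)
  have four: "4 * g\<^sup>2 * L \<noteq> 0"
  proof -
    have "4 * g\<^sup>2 * L = 2 * 2 * (g\<^sup>2 * L)" by simp
    moreover have "2 * 2 * (g\<^sup>2 * L) \<noteq> 0" using two_\<tau> g L_nonzero by
      (simp only: mult_eq_0_iff power_eq_0_iff simp_thms)
    ultimately show ?thesis by (simp only: simp_thms)
  qed
  show ?thesis
  proof (cases "x = L * \<tau>")
    \<comment> \<open>Here \<open>S\<close> is \<open>P\<close> or \<open>- P\<close>: one of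
      \<open>S + P\<close> and \<open>S - P\<close> is infinity, the other one is plus or minus
      \<open>2 P\<close>.\<close>
    case True
    then have f: "f = \<tau> * g" using xg L_nonzero by simp
    have prod: "add_sub_product \<alpha> \<beta> \<tau> f g = g\<^sup>2 * ((\<tau>\<^sup>2 - \<alpha>)\<^sup>2 - 8 * \<beta> * \<tau>)"
      unfolding add_sub_product_def f by Groebner_Basis.algebra
    have sum: "add_sub_sum \<alpha> \<beta> \<tau> f g = 4 * g\<^sup>2 * L"
      unfolding add_sub_sum_def f L_eq by Groebner_Basis.algebra
    obtain x2 y2 where PP: "P \<oplus>\<^sub>L P = Affine x2 y2" "4 * x2 = (\<tau>\<^sup>2 - \<alpha>)\<^sup>2 - 8 * \<beta> * \<tau>"
      by (rule double_P)
    have key: "f' * g'' \<noteq> 0 \<and> f' * g'' * add_sub_product \<alpha> \<beta> \<tau> f g = 4 * g\<^sup>2 * L * (f' * f'')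
        \<and> f' * g'' * add_sub_sum \<alpha> \<beta> \<tau> f g = 4 * g\<^sup>2 * L * (f' * g'')"
      if "f' \<noteq> 0" "g'' \<noteq> 0" "x2 * g'' = L * f''" for f' f'' g''
    proof (intro conjI)
      have "4 * L * f'' = g'' * (4 * x2)" using that(3) by (simp add: mult_ac)
      then have "4 * L * f'' = g'' * ((\<tau>\<^sup>2 - \<alpha>)\<^sup>2 - 8 * \<beta> * \<tau>)" unfolding PP(2) .
      from diff_eq_0[OF this] show "f' * g'' * add_sub_product \<alpha> \<beta> \<tau> f g = 4 * g\<^sup>2 * L * (f' * f'')"
        unfolding prod by Groebner_Basis.algebra
    qed (use that in \<open>simp_all add: sum\<close>)
    note add_0_simps = mult_zero_left mult_zero_right add_0_right add_0_left diff_self power_zero_numeral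
      simp_thms mult_ac
    have "S = P \<or> S = point_neg P"
      using same_abscissa[of "L * \<tau>" "L\<^sup>2" y] S on_P Affine True by (auto simp: P_def)
    then show ?thesis
    proof
      assume SP: "S = P"
      have 1: "g1 = 0" "f1 \<noteq> 0" "g2 \<noteq> 0" "x2 * g2 = L * f2"
        using r(2,3) PP(1) unfolding SP by (simp_all add: has_ratio_def)
      note k = key[OF 1(2-4)]
      show ?thesis by (rule that[of "f1 * g2" "4 * g\<^sup>2 * L"])
        (use k 1 four f in \<open>simp_all only: add_0_simps\<close>)
    next
      assume SP: "S = point_neg P"
      have "S \<oplus>\<^sub>L point_neg P = Affine x2 (- y2)"
        unfolding SP using neg_add_distrib[OF on_P on_P] PP(1) by simp
      then have 1: "g2 = 0" "f2 \<noteq> 0" "g1 \<noteq> 0" "x2 * g1 = L * f1"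
        using r(2,3) unfolding SP by (simp_all add: has_ratio_def)
      note k = key[OF 1(2-4)]
      show ?thesis by (rule that[of "f2 * g1" "4 * g\<^sup>2 * L"])
        (use k 1 four f in \<open>simp_all only: add_0_simps\<close>)
    qed
  next
    case False
    define \<xi> \<eta> where "\<xi> = f / g" and "\<eta> = y / L\<^sup>2"
    have f: "f = \<xi> * g" using g by (simp add: \<xi>_def)
    have x: "x = L * \<xi>" using xg g unfolding f by simp
    have y: "y = L\<^sup>2 * \<eta>" using L_nonzero by (simp add: \<eta>_def)
    have D: "\<xi> - \<tau> \<noteq> 0" using False x by auto
    have on: "on (Affine x (L\<^sup>2 * \<eta>))" using S Affine y by simp
    define H where "H = (\<xi> + \<tau>) * (\<xi> * \<tau> + \<alpha>) + 2 * \<beta>"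
    obtain x2 y2 where 2: "S \<oplus>\<^sub>L P = Affine (L * x2) y2" "(\<xi> - \<tau>)\<^sup>2 * x2 = H - 2 * L * \<eta>"
      and \<eta>: "L * \<eta>\<^sup>2 = \<xi> ^ 3 + \<alpha> * \<xi> + \<beta>"
      using add_P_affine[OF False on x, of 1] unfolding Affine y P_def H_def by
        (auto simp del: point_add.simps)
    have "\<exists>x1 y1. S \<oplus>\<^sub>L point_neg P = Affine (L * x1) y1 \<and> (\<xi> - \<tau>)\<^sup>2 * x1 = H + 2 * L * \<eta>"
      unfolding Affine y P_def H_def
      by (rule add_P_affine[OF False on x, of "- 1"]) (auto simp del: point_add.simps)
    then obtain x1 y1 where 1: "S \<oplus>\<^sub>L point_neg P = Affine (L * x1) y1" "(\<xi> - \<tau>)\<^sup>2 * x1 = H + 2 * L * \<eta>"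
      by blast
    have r': "g1 \<noteq> 0" "g2 \<noteq> 0" "f1 = x1 * g1" "f2 = x2 * g2"
      using r(2,3) L_nonzero unfolding 1(1) 2(1) by (simp_all add: has_ratio_def)
    define E where "E = (\<xi> - \<tau>)\<^sup>2"
    have E: "E \<noteq> 0" using D by (simp add: E_def)
    have "E * (E * (x1 * x2)) = ((\<xi> - \<tau>)\<^sup>2 * x1) * ((\<xi> - \<tau>)\<^sup>2 * x2)" by (simp add: E_def)
    also have "\<dots> = H\<^sup>2 - 4 * L * (L * \<eta>\<^sup>2)" unfolding 1(2) 2(2) by Groebner_Basis.algebra
    also have "\<dots> = E * add_sub_product \<alpha> \<beta> \<tau> \<xi> 1"
      unfolding \<eta> unfolding L_eq H_def E_def add_sub_product_def by Groebner_Basis.algebra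
    finally have pr: "E * (x1 * x2) = add_sub_product \<alpha> \<beta> \<tau> \<xi> 1" using E by simp
    have su: "E * (x1 + x2) = add_sub_sum \<alpha> \<beta> \<tau> \<xi> 1"
      unfolding E_def distrib_left 1(2) 2(2) unfolding H_def add_sub_sum_def power_one mult_1_right
      by Groebner_Basis.algebra
    have hom: "add_sub_product \<alpha> \<beta> \<tau> f g = g\<^sup>2 * (E * (x1 * x2))" "add_sub_sum \<alpha> \<beta> \<tau> f g = g\<^sup>2 * (E * (x1 + x2))"
      unfolding pr su unfolding add_sub_product_def add_sub_sum_def f power_one mult_1_right
      by Groebner_Basis.algebra+
    show ?thesis
    proof (rule that[of "g1 * g2" "g\<^sup>2 * E"])
      show "g1 * g2 * (f - \<tau> * g)\<^sup>2 = g\<^sup>2 * E * (g1 * g2)" unfolding f E_def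
        by Groebner_Basis.algebra
    qed (use r' E g in \<open>simp_all add: hom algebra_simps\<close>)
  qed
qed

end


section \<open>Degrees along an arithmetic progression of points\<close>

locale manin =
  fixes a b :: "'a::field_gcd"
  assumes two_a: "(2 :: 'a) \<noteq> 0" and disc_a: "4 * a ^ 3 + 27 * b\<^sup>2 \<noteq> 0"
begin

definition L :: "'a poly fract" where "L = to_fract (cubic a b)"

abbreviation \<tau> :: "'a poly fract" where "\<tau> \<equiv> to_fract T"
abbreviation \<alpha> :: "'a poly fract" where "\<alpha> \<equiv> to_fract [:a:]"
abbreviation \<beta> :: "'a poly fract" where "\<beta> \<equiv> to_fract [:b:]"

lemma to_fract_numeral: "to_fract (numeral n :: 'a poly) = numeral n"
proof -
  have "to_fract (of_nat n :: 'a poly) = of_nat n" for n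
    by (induction n) simp_all
  from this[of "numeral n"] show ?thesis by simp
qed

lemma to_fract_power: "to_fract (f ^ n :: 'a poly) = to_fract f ^ n"
  by (induction n) simp_all

lemmas to_fract_hom = to_fract_add to_fract_diff to_fract_mult to_fract_power to_fract_numeral

lemma to_fract_L: "L = \<tau> ^ 3 + \<alpha> * \<tau> + \<beta>"
  unfolding L_def cubic_eq by (simp only: to_fract_hom)

sublocale curve: twisted_cubic \<alpha> \<beta> \<tau> L
proof
  have "(2 :: 'a poly) \<noteq> 0" using two_a by (simp add: numeral_poly)
  then have "to_fract (2 :: 'a poly) \<noteq> 0" by simp
  then show "(2 :: 'a poly fract) \<noteq> 0" by (simp only: to_fract_numeral not_False_eq_True)
  have "4 * [:a:] ^ 3 + 27 * [:b:]\<^sup>2 = [:4 * a ^ 3 + 27 * b\<^sup>2:]"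
    by (simp add: numeral_poly power2_eq_square power3_eq_cube)
  then have "4 * [:a:] ^ 3 + 27 * [:b:]\<^sup>2 \<noteq> 0" using disc_a by (metis pCons_eq_0_iff)
  then have "to_fract (4 * [:a:] ^ 3 + 27 * [:b:]\<^sup>2) \<noteq> 0" by
    (simp only: to_fract_eq_0_iff not_False_eq_True)
  then show "4 * \<alpha> ^ 3 + 27 * \<beta>\<^sup>2 \<noteq> 0"
    by (simp only: to_fract_hom not_False_eq_True)
  have "cubic a b \<noteq> 0" by simp
  then show "L \<noteq> 0" unfolding L_def by (simp only: to_fract_eq_0_iff not_False_eq_True)
qed (rule to_fract_L)

definition has_fraction :: "'a poly fract point \<Rightarrow> 'a poly \<Rightarrow> 'a poly \<Rightarrow> bool" where
  "has_fraction S f g \<longleftrightarrow> Rings.coprime f g \<and> curve.has_ratio S (to_fract f) (to_fract g)"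

lemma has_fraction_exists: "\<exists>f g. has_fraction S f g"
proof (cases S)
  case Infinity
  then show ?thesis by (intro exI[of _ 1] exI[of _ 0])
    (simp add: has_fraction_def curve.has_ratio_def)
next
  case (Affine x y)
  define q where "q = quot_of_fract (x / L)"
  have "x / L = to_fract (fst q) / to_fract (snd q)" "snd q \<noteq> 0"
    using Fract_quot_of_fract[of "x / L"] by (simp_all add: q_def Fract_conv_to_fract)
  moreover have "Rings.coprime (fst q) (snd q)" unfolding q_def by (rule coprime_quot_of_fract)
  ultimately show ?thesis
    using curve.L_nonzero
    by (intro exI[of _ "fst q"] exI[of _ "snd q"])
      (simp add: has_fraction_def curve.has_ratio_def Affine field_simps)
qed

text \<open>The proportionality factors lie in the function field; clearing their denominators turns
  it into one between polynomial triples.\<close>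

lemma add_sub_fraction:
  assumes S: "curve.on S"
    and fr: "has_fraction S f g" "has_fraction (curve.add S (point_neg curve.P)) f1 g1"
      "has_fraction (curve.add S curve.P) f2 g2"
    and impr: "improper f g" "improper f1 g1"
  shows "improper f2 g2" "deg f1 + deg f2 = 2 * deg f + 2"
proof -
  have cop: "Rings.coprime f g" "Rings.coprime f1 g1" "Rings.coprime f2 g2"
    using fr by (simp_all add: has_fraction_def)
  obtain u w where uw: "u \<noteq> 0" "w \<noteq> 0"
    and eq: "u * add_sub_product \<alpha> \<beta> \<tau> (to_fract f) (to_fract g) = w * (to_fract f1 * to_fract f2)"
      "u * add_sub_sum \<alpha> \<beta> \<tau> (to_fract f) (to_fract g) = w * (to_fract f1 * to_fract g2 + to_fract f2 * to_fract g1)"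
      "u * (to_fract f - \<tau> * to_fract g)\<^sup>2 = w * (to_fract g1 * to_fract g2)"
    using curve.add_sub_ratio[OF S] fr unfolding has_fraction_def by metis
  have "\<exists>p q. z = to_fract p / to_fract q \<and> q \<noteq> 0" for z :: "'a poly fract"
    by (cases z) (auto simp: Fract_conv_to_fract)
  then obtain u1 u2 w1 w2 where u: "u = to_fract u1 / to_fract u2" "u2 \<noteq> 0"
    and w: "w = to_fract w1 / to_fract w2" "w2 \<noteq> 0"
    by metis
  have clear: "u1 * w2 * p = w1 * u2 * q" if "u * to_fract p = w * to_fract q" for p q
  proof -
    have "to_fract u1 * to_fract w2 * to_fract p = to_fract w1 * to_fract u2 * to_fract q"
      using that u(2) w(2) unfolding u(1) w(1) by (simp add: field_simps)
    then have "to_fract (u1 * w2 * p) = to_fract (w1 * u2 * q)" by (simp only: to_fract_mult)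
    then show ?thesis by (simp only: to_fract_eq_iff)
  qed
  have nz: "u1 * w2 \<noteq> 0" "w1 * u2 \<noteq> 0" using uw u w by auto
  have "u1 * w2 * add_sub_product [:a:] [:b:] T f g = w1 * u2 * (f1 * f2)"
    by (rule clear) (use eq(1) in \<open>simp only: add_sub_product_def to_fract_hom\<close>)
  moreover have "u1 * w2 * add_sub_sum [:a:] [:b:] T f g = w1 * u2 * (f1 * g2 + f2 * g1)"
    by (rule clear) (use eq(2) in \<open>simp only: add_sub_sum_def to_fract_hom\<close>)
  moreover have "u1 * w2 * (f - T * g)\<^sup>2 = w1 * u2 * (g1 * g2)"
    by (rule clear) (use eq(3) in \<open>simp only: to_fract_hom\<close>)
  ultimately show "improper f2 g2" "deg f1 + deg f2 = 2 * deg f + 2"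
    using add_sub_step[OF two_a disc_a cop impr nz] by blast+
qed

text \<open>The degrees \<open>\<delta>(k)\<close> of the numerators along \<open>P\<^sub>0 + k P\<close> satisfy
  \<open>\<delta>(k) + \<delta>(k+2) = 2 \<delta>(k+1) + 2\<close>, hence \<open>\<delta>(k+1) = k\<^sup>2 + (\<delta>(1) - \<delta>(0) + 1) k + \<delta>(1)\<close>.\<close>

lemma degree_quadratic_nonneg:
  assumes on: "curve.on S0"
    and fr: "has_fraction S0 f g" "has_fraction (curve.add S0 (point_neg curve.P)) f' g'"
    and impr: "improper f g" "improper f' g'"
  shows "0 \<le> (int k)\<^sup>2 + (int (deg f) - int (deg f') + 1) * int k + int (deg f)"
proof -
  define R where "R = rec_nat (curve.add S0 (point_neg curve.P)) (\<lambda>_ S. curve.add S curve.P)"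
  have R0: "R 0 = curve.add S0 (point_neg curve.P)"
    and R_Suc: "R (Suc n) = curve.add (R n) curve.P" for n
    by (simp_all add: R_def)
  have onP: "curve.on curve.P" by (rule curve.on_P)
  have onR: "curve.on (R n)" for n
    by (induction n) (simp_all only: R0 R_Suc curve.on_add on onP curve.on_neg)
  have R1: "R 1 = S0"
  proof -
    have "curve.on (point_neg curve.P)" using onP by simp
    from curve.add_diff_cancel[OF on this] show ?thesis by (simp add: R0 R_Suc)
  qed
  have sub_P: "curve.add (R (Suc n)) (point_neg curve.P) = R n" for n
    unfolding R_Suc by (rule curve.add_diff_cancel[OF onR onP])
  have "\<forall>n. \<exists>r. has_fraction (R n) (fst r) (snd r)" using has_fraction_exists by simp
  from choice[OF this] obtain r where r: "\<forall>n. has_fraction (R n) (fst (r n)) (snd (r n))" ..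
  \<comment> \<open>Fractions are chosen for all points, but the first two must be the given ones,
    whose degrees occur in the claim.\<close>
  define F' where "F' = (\<lambda>n. fst (r n))(0 := f', 1 := f)"
  define G' where "G' = (\<lambda>n. snd (r n))(0 := g', 1 := g)"
  have FG: "has_fraction (R n) (F' n) (G' n)" for n
    using r fr R1 R0 by (auto simp: F'_def G'_def)
  have F01: "F' 0 = f'" "G' 0 = g'" "F' (Suc 0) = f" "G' (Suc 0) = g" by
    (simp_all add: F'_def G'_def)
  have step: "improper (F' (Suc (Suc n))) (G' (Suc (Suc n)))"
      "deg (F' n) + deg (F' (Suc (Suc n))) = 2 * deg (F' (Suc n)) + 2"
    if "improper (F' n) (G' n)" "improper (F' (Suc n)) (G' (Suc n))" for n
    using add_sub_fraction[OF onR FG, of "Suc n" "F' n" "G' n" "F' (Suc (Suc n))" "G' (Suc (Suc n))"]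
      FG[of n] FG[of "Suc (Suc n)"] that unfolding sub_P R_Suc[symmetric] by blast+
  have im: "improper (F' n) (G' n) \<and> improper (F' (Suc n)) (G' (Suc n))" for n
    by (induction n) (use impr step in \<open>auto simp: F01\<close>)
  have rec: "int (deg (F' (Suc (Suc n)))) = 2 * int (deg (F' (Suc n))) + 2 - int (deg (F' n))" for n
    using step(2)[of n] im[of n] by linarith
  define \<delta> where "\<delta> n = int (deg (F' n))" for n
  \<comment> \<open>The recurrence is of second order, so two consecutive values are carried along.
    At \<open>n = 0\<close> the first formula is evaluated at \<open>- 1\<close>, where it gives
    \<open>\<delta> 0\<close>.\<close>
  have "\<delta> n = (int n - 1)\<^sup>2 + (\<delta> 1 - \<delta> 0 + 1) * (int n - 1) + \<delta> 1 \<and>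
      \<delta> (Suc n) = (int n)\<^sup>2 + (\<delta> 1 - \<delta> 0 + 1) * int n + \<delta> 1" for n
  proof (induction n)
    case (Suc n)
    then have "\<delta> n = (int n - 1)\<^sup>2 + (\<delta> 1 - \<delta> 0 + 1) * (int n - 1) + \<delta> 1"
      "\<delta> (Suc n) = (int n)\<^sup>2 + (\<delta> 1 - \<delta> 0 + 1) * int n + \<delta> 1" by blast+
    moreover have "\<delta> (Suc (Suc n)) = 2 * \<delta> (Suc n) + 2 - \<delta> n" unfolding \<delta>_def by (rule rec)
    ultimately show ?case by (simp add: algebra_simps power2_eq_square)
  qed simp
  then have "\<delta> (Suc k) = (int k)\<^sup>2 + (\<delta> 1 - \<delta> 0 + 1) * int k + \<delta> 1" by blast
  moreover have "\<delta> (Suc k) \<ge> 0" by (simp add: \<delta>_def)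
  ultimately show ?thesis by (simp add: \<delta>_def F01)
qed

end

text \<open>A divisor of a product of linear factors splits into linear factors; they are removed
  one root at a time.\<close>

lemma degree_le_sum_order:
  fixes h :: "'a::field_gcd poly"
  assumes "finite S" "h dvd (\<Prod>c\<in>S. [:- c, 1:] ^ k)"
  shows "deg h \<le> (\<Sum>c\<in>S. order c h)"
  using assms
proof (induction S arbitrary: h rule: finite_induct)
  case empty
  then show ?case by (cases "h = 0") (simp_all add: is_unit_iff_degree)
next
  case (insert c S)
  have "(\<Prod>c\<in>insert c S. [:- c, 1:] ^ k) \<noteq> 0" using insert.hyps by simp
  then have h: "h \<noteq> 0" using insert.prems by force
  obtain e h' where h': "h = [:- c, 1:] ^ e * h'" "\<not> [:- c, 1:] dvd h'" and e: "e = order c h"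
    using order_decomp[OF h] by blast
  have "prime_elem [:- c, 1:]" by (rule prime_elem_linear_field_poly) simp
  then have "Rings.coprime h' ([:- c, 1:] ^ k)"
    using h'(2) by (simp add: prime_elem_imp_coprime coprime_commute[of h'])
  moreover have "h' dvd [:- c, 1:] ^ k * (\<Prod>c\<in>S. [:- c, 1:] ^ k)"
  proof (rule dvd_mult_right)
    show "[:- c, 1:] ^ e * h' dvd [:- c, 1:] ^ k * (\<Prod>c\<in>S. [:- c, 1:] ^ k)"
      using insert.prems insert.hyps unfolding h'(1) by simp
  qed
  ultimately have "h' dvd (\<Prod>c\<in>S. [:- c, 1:] ^ k)" by (simp add: coprime_dvd_mult_right_iff)
  then have "deg h' \<le> (\<Sum>c\<in>S. order c h')" by (rule insert.IH)
  also have "\<dots> \<le> (\<Sum>c\<in>S. order c h)"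
    by (rule sum_mono) (rule dvd_imp_order_le[OF h], simp add: h'(1))
  finally have "deg h' \<le> (\<Sum>c\<in>S. order c h)" .
  moreover have "deg h = e + deg h'"
    using h unfolding h'(1) by (auto simp: degree_mult_eq degree_power_eq)
  ultimately show ?case using insert.hyps by (simp add: e)
qed

text \<open>The quadratic is evaluated at the integer nearest below its vertex \<open>B / 2\<close>.
  For odd \<open>B = 2 k + 1\<close> this gives only \<open>B^2 \<le> 4 p + 1\<close>; parity
  improves it, since \<open>k (k + 1)\<close> is even and \<open>p\<close> is odd.\<close>

lemma le_2_sqrt_if_quadratic_nonneg:
  fixes p :: nat and B :: int
  assumes "odd p" "\<And>k::nat. 0 \<le> (int k)\<^sup>2 - B * int k + int p"
  shows "of_int B \<le> 2 * sqrt (real p)"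
proof (cases "B \<le> 0")
  case True
  then show ?thesis using order_trans[of "of_int B" 0 "2 * sqrt (real p)"] by simp
next
  case False
  define k where "k = nat (B div 2)"
  have k: "int k = B div 2" using False by (simp add: k_def)
  have q: "0 \<le> (int k)\<^sup>2 - B * int k + int p" by (rule assms(2))
  have "B\<^sup>2 \<le> 4 * int p"
  proof (cases "even B")
    case True
    then have "B = 2 * int k" using k by simp
    then show ?thesis using q by (simp add: power2_eq_square)
  next
    case False
    then have B: "B = 2 * int k + 1" using k by simp
    have "even (int k * (int k + 1))" by simp
    moreover have "odd (int p)" using assms(1) by simp
    moreover have "int k * (int k + 1) \<le> int p" using q B by
      (simp add: power2_eq_square algebra_simps)
    ultimately have "int k * (int k + 1) < int p" by (metis order_le_less)
    then show ?thesis using B by (simp add: power2_eq_square algebra_simps)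
  qed
  then have "real_of_int (B\<^sup>2) \<le> real_of_int (4 * int p)" by (simp only: of_int_le_iff)
  then have "(of_int B)\<^sup>2 \<le> (4 * real p)" by simp
  then have "of_int B \<le> sqrt (4 * real p)" by (rule real_le_rsqrt)
  then show ?thesis by (simp add: real_sqrt_mult)
qed

section \<open>The Frobenius point and the count of points\<close>

locale manin_finite = manin a b for a b :: "'p::prime_card mod_ring"
begin

definition m :: nat where "m = (CARD('p) - 1) div 2"

lemma odd_card: "odd CARD('p)"
proof
  assume "even CARD('p)"
  then have "CARD('p) = 2" using prime_card[where 'a='p] by
    (metis primes_dvd_imp_eq two_is_prime_nat)
  then have "of_nat 2 = (0 :: 'p mod_ring)" by
    (simp add: of_nat_eq_0_iff_char_dvd del: of_nat_numeral)
  then show False using two_a by simp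
qed

lemma card_eq: "CARD('p) = 2 * m + 1"
  using odd_card unfolding m_def by simp

lemma m_pos: "m \<ge> 1"
  using card_eq prime_gt_1_nat[OF prime_card[where 'a='p]] by linarith

lemma power_card [simp]: "(c :: 'p mod_ring) ^ CARD('p) = c"
  using finite_field_power_card_eq_same[of c] by simp

text \<open>Raising to the \<open>p\<close>-th power is additive in characteristic \<open>p\<close>
  and fixes the coefficients, which lie in the prime field.\<close>

lemma frobenius: "(cubic a b) ^ CARD('p) = (T ^ CARD('p)) ^ 3 + [:a:] * T ^ CARD('p) + [:b:]"
proof -
  have char: "CHAR('p mod_ring poly) = CARD('p)" by simp
  have add: "(f + g) ^ CARD('p) = f ^ CARD('p) + g ^ CARD('p)" for f g :: "'p mod_ring poly"
    by (rule freshmans_dream) (simp_all only: char prime_card)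
  have const: "[:c:] ^ CARD('p) = [:c:]" for c :: "'p mod_ring"
    by (simp add: poly_const_pow)
  have "(T ^ 3) ^ CARD('p) = (T ^ CARD('p) :: 'p mod_ring poly) ^ 3"
    unfolding power_mult[symmetric] by (rule arg_cong[OF mult.commute])
  then show ?thesis unfolding cubic_eq add power_mult_distrib const by (rule arg_cong)
qed

definition D :: "'p mod_ring poly" where "D = T ^ CARD('p) - T"

text \<open>\<open>N / D\<^sup>2\<close> is the abscissa, up to the factor \<open>L\<close>, of \<open>P\<^sub>0 - P\<close>, where \<open>P\<^sub>0\<close> is the image of
  \<open>P = (T, 1)\<close> under the \<open>p\<close>-power Frobenius.\<close>

definition N :: "'p mod_ring poly" where
  "N = (T ^ CARD('p) + T) * (T ^ CARD('p) * T + [:a:]) + 2 * [:b:] + 2 * cubic a b * cubic a b ^ m"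

definition h :: "'p mod_ring poly" where "h = gcd N (D\<^sup>2)"

lemma T_power: "(T :: 'p mod_ring poly) ^ n = Polynomial.monom 1 n"
  by (simp only: monom_altdef smult_1_left)

lemma degree_T_power: "deg ((T :: 'p mod_ring poly) ^ n) = n"
  unfolding T_power by (rule degree_monom_eq) simp

lemma degree_D: "deg D = CARD('p)" and coeff_D: "poly.coeff D CARD('p) = 1"
proof -
  have "deg (- T :: 'p mod_ring poly) < CARD('p)"
    using m_pos by (simp add: card_eq)
  then have "deg (- T :: 'p mod_ring poly) < deg ((T :: 'p mod_ring poly) ^ CARD('p))"
    unfolding degree_T_power .
  from degree_add_eq_left[OF this] show "deg D = CARD('p)"
    unfolding D_def degree_T_power by (simp only: add_uminus_conv_diff)
  have "deg (T :: 'p mod_ring poly) < CARD('p)"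
    using m_pos by (simp add: card_eq)
  from coeff_eq_0[OF this] show "poly.coeff D CARD('p) = 1"
    unfolding D_def T_power coeff_diff by (simp only: coeff_monom refl if_True diff_zero)
qed

lemma D_nonzero: "D \<noteq> 0"
  using coeff_D by auto

lemma D_eq_prod: "D = (\<Prod>c\<in>UNIV. [:- c, 1:])"
proof (rule poly_eqI_degree_lead_coeff)
  have deg: "deg (\<Prod>c\<in>(UNIV :: 'p mod_ring set). [:- c, 1:]) = CARD('p)"
    by (subst degree_prod_eq_sum_degree) simp_all
  then show "deg (\<Prod>c\<in>(UNIV :: 'p mod_ring set). [:- c, 1:]) \<le> CARD('p)" by simp
  have "Polynomial.lead_coeff (\<Prod>c\<in>(UNIV :: 'p mod_ring set). [:- c, 1:]) = 1"
    by (simp add: lead_coeff_prod)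
  then show "poly.coeff D CARD('p) = poly.coeff (\<Prod>c\<in>UNIV. [:- c, 1:]) CARD('p)"
    using deg coeff_D by simp
  show "poly D z = poly (\<Prod>c\<in>UNIV. [:- c, 1:]) z" if "z \<in> UNIV" for z
    by (simp add: D_def poly_prod)
qed (simp_all add: degree_D)

lemma order_D: "order c D = 1"
proof -
  define R where "R = (\<Prod>d\<in>UNIV - {c}. [:- d, 1 :: 'p mod_ring:])"
  have D: "D = [:- c, 1:] * R"
    unfolding D_eq_prod R_def by (rule prod.remove) simp_all
  have "poly R c \<noteq> 0" by (simp add: R_def poly_prod)
  then have "order c R = 0" by (rule order_0I)
  moreover have "order c [:- c, 1:] = 1" using order_power_n_n[of c 1] by
    (simp only: power_one_right)
  moreover have "order c D = order c [:- c, 1:] + order c R"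
    using D_nonzero unfolding D by (rule order_mult)
  ultimately show ?thesis by simp
qed

text \<open>The chord formula before simplification: slope squared minus the two abscissae. It rests
  on \<open>\<Lambda>^(2 m + 1) = \<Lambda>^p = \<Lambda>(T^p)\<close>, and it exhibits
  \<open>N\<close> modulo \<open>D^2\<close> as the cubic times a square.\<close>

lemma N_alt: "N = cubic a b * (cubic a b ^ m + 1)\<^sup>2 - (T ^ CARD('p) + T) * D\<^sup>2"
proof -
  define t c where "t = (T :: 'p mod_ring poly)" and "c = cubic a b"
  have c: "c - (t ^ 3 + [:a:] * t + [:b:]) = 0" unfolding c_def t_def by
    (simp only: cubic_eq diff_self)
  have "(c ^ m)\<^sup>2 * c = c ^ CARD('p)" unfolding card_eq by
    (simp only: power_add power_even_eq power_one_right)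
  also have "\<dots> = (t ^ CARD('p)) ^ 3 + [:a:] * t ^ CARD('p) + [:b:]"
    unfolding c_def t_def by (rule frobenius)
  finally have f: "(c ^ m)\<^sup>2 * c - ((t ^ CARD('p)) ^ 3 + [:a:] * t ^ CARD('p) + [:b:]) = 0"
    by (rule diff_eq_0)
  define u v where "u = c ^ m" and "v = t ^ CARD('p)"
  have "((v + t) * (v * t + [:a:]) + 2 * [:b:] + 2 * c * u) - (c * (u + 1)\<^sup>2 - (v + t) * (v - t)\<^sup>2)
      = - (u\<^sup>2 * c - (v ^ 3 + [:a:] * v + [:b:])) - (c - (t ^ 3 + [:a:] * t + [:b:]))"
    by Groebner_Basis.algebra
  also have "\<dots> = 0" unfolding u_def v_def c f by simp
  finally show ?thesis unfolding N_def D_def c_def[symmetric] unfolding t_def[symmetric] u_def v_def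
    by (rule iffD2[OF eq_iff_diff_eq_0])
qed

text \<open>The leading term is \<open>T^(2 p + 1)\<close>. The term with the power of the cubic has
  degree at most \<open>3 (m + 1)\<close>, and this is at most \<open>2 p = 4 m + 2\<close> because
  \<open>m \<ge> 1\<close>.\<close>

lemma N_nonzero_degree: "N \<noteq> 0" "deg N = 2 * CARD('p) + 1"
proof -
  let ?p = "CARD('p)"
  let ?r = "(T ^ ?p * [:a:] + T * (T ^ ?p * T + [:a:])) + (2 * [:b:] + 2 * cubic a b * cubic a b ^ m)"
  have deg_cubic: "deg (2 * cubic a b * cubic a b ^ m) \<le> 3 * (m + 1)"
  proof -
    have "2 * cubic a b * cubic a b ^ m = [:2:] * cubic a b ^ (m + 1)"
      by (simp only: numeral_poly power_add power_one_right mult_ac)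
    also have "deg \<dots> \<le> deg [:2 :: 'p mod_ring:] + deg (cubic a b ^ (m + 1))"
      by (rule degree_mult_le)
    also have "\<dots> \<le> 0 + deg (cubic a b) * (m + 1)"
      by (intro add_mono degree_power_le) simp
    finally show ?thesis by simp
  qed
  have main: "deg ((T ^ ?p * T ^ ?p * T) :: 'p mod_ring poly) = 2 * ?p + 1"
    by (simp only: power_add[symmetric] power_Suc2[symmetric] degree_T_power)
  have le: "deg ?r \<le> 2 * ?p"
  proof (intro degree_add_le)
    have T: "deg (T :: 'p mod_ring poly) = 1" by simp
    have "deg (T ^ ?p * [:a:]) \<le> ?p + 0"
      by (rule order_trans[OF degree_mult_le]) (simp only: degree_T_power degree_pCons_0 order_refl)
    then show "deg (T ^ ?p * [:a:]) \<le> 2 * ?p" by linarith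
    have "deg (T ^ ?p * T + [:a:]) \<le> ?p + 1"
      by (intro degree_add_le order_trans[OF degree_mult_le])
        (simp_all only: degree_T_power T degree_pCons_0 order_refl le0)
    then have "deg (T * (T ^ ?p * T + [:a:])) \<le> 1 + (?p + 1)"
      using degree_mult_le[of T "T ^ ?p * T + [:a:]"] unfolding T by linarith
    then show "deg (T * (T ^ ?p * T + [:a:])) \<le> 2 * ?p" using m_pos card_eq by linarith
    show "deg (2 * [:b:]) \<le> 2 * ?p" by (simp add: numeral_poly)
    show "deg (2 * cubic a b * cubic a b ^ m) \<le> 2 * ?p"
    proof (rule order_trans[OF deg_cubic])
      show "3 * (m + 1) \<le> 2 * CARD('p)" using m_pos unfolding card_eq by simp
    qed
  qed
  have N: "N = T ^ ?p * T ^ ?p * T + ?r"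
    unfolding N_def by (simp only: distrib_left distrib_right add.assoc mult.assoc add.left_commute add.commute)
  have "deg ?r
      < deg ((T ^ ?p * T ^ ?p * T) :: 'p mod_ring poly)"
    using le unfolding main by linarith
  from degree_add_eq_left[OF this] show deg: "deg N = 2 * ?p + 1" unfolding N main .
  then show "N \<noteq> 0" by (metis Polynomial.degree_0 Suc_eq_plus1 nat.distinct(1))
qed

lemma cubic_root_simple: "\<not> [:- c, 1:]\<^sup>2 dvd cubic a b"
proof
  define q where "q = [:- c, 1:]"
  have q: "poly q c = 0" by (simp add: q_def)
  assume "[:- c, 1:]\<^sup>2 dvd cubic a b"
  then obtain r where r: "cubic a b = q\<^sup>2 * r" unfolding q_def ..
  have "poly (q\<^sup>2 * r) c = 0" by (simp add: q)
  then have 1: "c ^ 3 + a * c + b = 0" unfolding r[symmetric] poly_cubic .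
  have "poly (pderiv (q\<^sup>2 * r)) c = 0" by (simp add: pderiv_mult power2_eq_square q)
  then have "poly (pderiv (cubic a b)) c = 0" unfolding r .
  then have "3 * c\<^sup>2 + a = 0" by (simp add: pderiv_pCons algebra_simps power2_eq_square)
  with 1 show False
    by (rule nonsingular_cubic.no_double_root[OF nonsingular_cubic.intro[OF two_a disc_a]])
qed

text \<open>Each point on the curve with abscissa \<open>c\<close> lowers the multiplicity of the
  cancelled factor \<open>T - c\<close> by one.\<close>

lemma order_h_le: "order c h + card {y. y\<^sup>2 = poly (cubic a b) c} \<le> 2"
proof -
  let ?l = "poly (cubic a b) c" and ?Y = "{y. y\<^sup>2 = poly (cubic a b) c}"
  have D2: "D\<^sup>2 \<noteq> 0" using D_nonzero by simp
  then have h: "h \<noteq> 0" by (simp add: h_def)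
  have "order c h \<le> order c (D\<^sup>2)" by (rule dvd_imp_order_le[OF D2]) (simp add: h_def)
  also have "\<dots> = 2" using order_mult[of D D c] D2 by (simp add: power2_eq_square order_D)
  finally have le2: "order c h \<le> 2" .
  have dvd_N: "[:- c, 1:] ^ order c h dvd N" "[:- c, 1:] ^ order c h dvd D\<^sup>2"
    by (rule dvd_trans[OF order_1], simp add: h_def)+
  consider "?Y = {}" | "?Y = {0}" "?l = 0" | y where "y \<noteq> 0" "y\<^sup>2 = ?l"
  proof (cases "\<exists>y. y \<noteq> 0 \<and> y\<^sup>2 = ?l")
    case False
    then have "?Y \<subseteq> {0}" by blast
    then consider "?Y = {}" | "?Y = {0}" by blast
    then show ?thesis
    proof cases
      case 2
      then have "0 \<in> ?Y" by simp
      then have "?l = 0" by simp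
      with 2 that show ?thesis by blast
    qed (rule that)
  qed (use that in blast)
  then show ?thesis
  proof cases
    case 1
    then show ?thesis using le2 by simp
  next
    case 2
    \<comment> \<open>Otherwise \<open>(T - c)^2\<close> divides
      \<open>cubic * (cubic^m + 1)^2\<close>. The second factor takes the value 1 at
      \<open>c\<close>, so \<open>c\<close> would be a double root of the cubic.\<close>
    have "order c h \<noteq> 2"
    proof
      assume "order c h = 2"
      then have dvd: "[:- c, 1:]\<^sup>2 dvd N" "[:- c, 1:]\<^sup>2 dvd D\<^sup>2" using dvd_N by simp_all
      have "cubic a b * (cubic a b ^ m + 1)\<^sup>2 = N + (T ^ CARD('p) + T) * D\<^sup>2" unfolding N_alt by
        (simp only: diff_add_cancel)
      then have "[:- c, 1:]\<^sup>2 dvd cubic a b * (cubic a b ^ m + 1)\<^sup>2"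
        using dvd by (simp only: dvd_add dvd_mult)
      moreover have "Rings.coprime ([:- c, 1:]\<^sup>2) ((cubic a b ^ m + 1)\<^sup>2)"
      proof -
        have "poly (cubic a b ^ m + 1) c = 1" using 2 m_pos by
          (simp only: poly_add poly_power power_0_left poly_1) simp
        then have "\<not> [:- c, 1:] dvd cubic a b ^ m + 1" by
          (simp only: poly_eq_0_iff_dvd[symmetric]) simp
        moreover have "prime_elem [:- c, 1:]" by (rule prime_elem_linear_field_poly) simp
        ultimately show ?thesis
          by (simp only: coprime_power_left_iff coprime_power_right_iff prime_elem_imp_coprime simp_thms)
      qed
      ultimately have "[:- c, 1:]\<^sup>2 dvd cubic a b" by (simp only: coprime_dvd_mult_left_iff)
      then show False using cubic_root_simple by blast
    qed
    then show ?thesis using le2 2 by simp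
  next
    case (3 y)
    \<comment> \<open>Since \<open>y\<close> is a nonzero square root of the value of the cubic at
      \<open>c\<close>, Fermat's theorem makes the \<open>m\<close>-th power of this value 1. So
      \<open>N(c)\<close> is four times the value, which is nonzero, and nothing cancels at
      \<open>c\<close>.\<close>
    have "y ^ (2 * m) * y = 1 * y" using power_card[of y] unfolding card_eq power_add by simp
    then have "y ^ (2 * m) = 1" using 3(1) by (simp only: mult_cancel_right simp_thms)
    then have m: "?l ^ m = 1" unfolding 3(2)[symmetric] by (simp only: power_mult)
    have l: "?l = c ^ 3 + a * c + b" by (rule poly_cubic)
    have "poly N c = 2 * (c ^ 3 + a * c + b) + 2 * ?l * ?l ^ m"
      unfolding N_def poly_add poly_mult poly_power by (simp add: algebra_simps power3_eq_cube)
    also have "\<dots> = 2 * 2 * ?l" unfolding l[symmetric] m by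
      (simp only: mult_1_right mult_2 distrib_right)
    finally have "poly N c \<noteq> 0" using two_a 3 by (simp only: mult_eq_0_iff) (metis power_eq_0_iff)
    then have "\<not> [:- c, 1:] dvd N" by (simp only: poly_eq_0_iff_dvd[symmetric] not_False_eq_True)
    then have "order c h = 0" using dvd_N(1) by (metis dvd_power dvd_trans gr0I)
    moreover have "?Y \<subseteq> {y, - y}"
    proof
      fix z assume "z \<in> ?Y"
      then have "z\<^sup>2 = y\<^sup>2" using 3 by simp
      then show "z \<in> {y, - y}" by (simp add: power2_eq_iff)
    qed
    then have "card ?Y \<le> card {y, - y}" by (intro card_mono) simp_all
    then have "card ?Y \<le> 2" by (rule order_trans) (simp add: card_insert_if)
    ultimately show ?thesis by simp
  qed
qed

lemma degree_h_le:
  "deg h + card {(x, y). y\<^sup>2 = x ^ 3 + a * x + b} \<le> 2 * CARD('p)"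
proof -
  have "h dvd (\<Prod>c\<in>UNIV. [:- c, 1:] ^ 2)"
    unfolding prod_power_distrib[symmetric] D_eq_prod[symmetric] by (simp add: h_def)
  then have "deg h \<le> (\<Sum>c\<in>UNIV. order c h)" by (intro degree_le_sum_order) simp_all
  moreover have "card {(x, y). y\<^sup>2 = x ^ 3 + a * x + b} = (\<Sum>c\<in>UNIV. card {y. y\<^sup>2 = poly (cubic a b) c})"
  proof -
    have "{(x, y). y\<^sup>2 = x ^ 3 + a * x + b} = Sigma UNIV (\<lambda>c. {y. y\<^sup>2 = poly (cubic a b) c})"
      unfolding poly_cubic by auto
    then show ?thesis by (simp only: card_SigmaI finite_code ball_UNIV simp_thms)
  qed
  moreover have "(\<Sum>c\<in>UNIV. order c h + card {y. y\<^sup>2 = poly (cubic a b) c}) \<le> (\<Sum>c\<in>(UNIV :: 'p mod_ring set). 2)"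
    by (rule sum_mono) (rule order_h_le)
  ultimately show ?thesis by (simp add: sum.distrib)
qed

text \<open>Frobenius takes \<open>(T, 1)\<close> to the point \<open>(T^p, 1)\<close> of the twist
  by \<open>L^p = L (L^m)^2\<close>; multiplying the ordinate by \<open>L^m\<close> returns it to
  the twist by \<open>L\<close>.\<close>

definition P0 :: "'p mod_ring poly fract point" where
  "P0 = Affine (L * \<tau> ^ CARD('p)) (L\<^sup>2 * L ^ m)"

lemma on_P0: "curve.on P0"
proof -
  have "L ^ CARD('p) = (\<tau> ^ CARD('p)) ^ 3 + \<alpha> * \<tau> ^ CARD('p) + \<beta>"
    using arg_cong[OF frobenius, of to_fract] unfolding L_def[symmetric] to_fract_hom .
  then have "(L ^ m)\<^sup>2 * L = (\<tau> ^ CARD('p)) ^ 3 + \<alpha> * \<tau> ^ CARD('p) + \<beta>"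
    unfolding card_eq by (simp only: power_add power_even_eq power_one_right)
  moreover define u v where "u = L ^ m" and "v = \<tau> ^ CARD('p)"
  ultimately have "u\<^sup>2 * L - (v ^ 3 + \<alpha> * v + \<beta>) = 0" by (simp only: diff_self)
  then have "(L\<^sup>2 * u)\<^sup>2 = (L * v) ^ 3 + \<alpha> * L\<^sup>2 * (L * v) + \<beta> * L ^ 3" by Groebner_Basis.algebra
  then show ?thesis by (simp add: P0_def u_def v_def)
qed

lemma has_fraction_P0: "has_fraction P0 (T ^ CARD('p)) 1"
  by (simp add: has_fraction_def P0_def curve.has_ratio_def to_fract_hom del: mult_pCons_left)

lemma has_fraction_P0_minus_P:
  "has_fraction (curve.add P0 (point_neg curve.P)) (N div h) (D\<^sup>2 div h)"
proof -
  have D: "to_fract D = \<tau> ^ CARD('p) - \<tau>" by (simp only: D_def to_fract_hom)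
  have D0: "to_fract D \<noteq> 0" using D_nonzero by simp
  have ne: "L * \<tau> ^ CARD('p) \<noteq> L * \<tau>" using D0 curve.L_nonzero unfolding D by simp
  have "\<exists>x2 y2. curve.add P0 (point_neg curve.P) = Affine (L * x2) y2 \<and> to_fract (D\<^sup>2) * x2 = to_fract N"
  proof (rule curve.add_P_affine[OF ne on_P0[unfolded P0_def] refl, of "- 1"])
    fix x2 y2
    assume sum: "curve.add (Affine (L * \<tau> ^ CARD('p)) (L\<^sup>2 * L ^ m)) (Affine (L * \<tau>) (L\<^sup>2 * - 1)) = Affine (L * x2) y2"
      and x2: "(\<tau> ^ CARD('p) - \<tau>)\<^sup>2 * x2 =
        (\<tau> ^ CARD('p) + \<tau>) * (\<tau> ^ CARD('p) * \<tau> + \<alpha>) + 2 * \<beta> - 2 * L * L ^ m * - 1"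
    have "curve.add P0 (point_neg curve.P) = Affine (L * x2) y2"
      using sum unfolding P0_def curve.P_def point_neg.simps by
        (simp only: mult_minus_right mult_1_right)
    moreover have "to_fract (D\<^sup>2) * x2 = to_fract N"
      unfolding N_def to_fract_hom D x2 L_def by
        (simp only: to_fract_hom mult_minus_right mult_1_right diff_minus_eq_add)
    ultimately show ?thesis by blast
  qed simp
  then obtain x2 y2 where sum: "curve.add P0 (point_neg curve.P) = Affine (L * x2) y2"
    and x2: "to_fract (D\<^sup>2) * x2 = to_fract N" by blast
  have h0: "h \<noteq> 0" using D_nonzero by (simp add: h_def)
  have N: "N div h * h = N" and D2: "D\<^sup>2 div h * h = D\<^sup>2" by (simp_all add: h_def)
  have "Rings.coprime (N div h) (D\<^sup>2 div h)"
    unfolding h_def by (rule div_gcd_coprime) (use D_nonzero in simp)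
  moreover have "D\<^sup>2 div h \<noteq> 0" using D2 D_nonzero by force
  moreover have "to_fract (D\<^sup>2 div h) * x2 = to_fract (N div h)"
  proof -
    have "to_fract h * (to_fract (D\<^sup>2 div h) * x2) = to_fract h * to_fract (N div h)"
      using x2 unfolding arg_cong[OF N, of to_fract, symmetric] arg_cong[OF D2, of to_fract, symmetric]
      by (simp only: to_fract_mult mult_ac)
    then show ?thesis using h0 by simp
  qed
  ultimately show ?thesis unfolding sum has_fraction_def curve.has_ratio_def by (simp add: mult_ac)
qed

text \<open>With initial degrees \<open>2 p + 1 - deg h\<close> and \<open>p\<close>, the
  nonnegative quadratic is \<open>k^2 - (p - deg h) k + p\<close>. Hence
  \<open>p - deg h \<le> 2 sqrt p\<close>, while \<open>deg h\<close> plus the number of affine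
  points is at most \<open>2 p\<close>.\<close>

lemma hasse_bound: "real (card {(x, y). y\<^sup>2 = x ^ 3 + a * x + b}) \<le> real CARD('p) + 2 * sqrt (real CARD('p))"
proof -
  have h0: "h \<noteq> 0" using D_nonzero by (simp add: h_def)
  have N: "N div h * h = N" and D2: "D\<^sup>2 div h * h = D\<^sup>2" by (simp_all add: h_def)
  have q0: "N div h \<noteq> 0" "D\<^sup>2 div h \<noteq> 0" using N D2 N_nonzero_degree(1) D_nonzero by force+
  have degN: "deg (N div h) + deg h = 2 * CARD('p) + 1"
    using degree_mult_eq[OF q0(1) h0] N N_nonzero_degree by simp
  have degD: "deg (D\<^sup>2 div h) + deg h = 2 * CARD('p)"
    using degree_mult_eq[OF q0(2) h0] D2 degree_D D_nonzero by (simp add: degree_power_eq)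
  have impr: "improper (T ^ CARD('p) :: 'p mod_ring poly) 1" "improper (N div h) (D\<^sup>2 div h)"
    using q0 degN degD m_pos card_eq by (simp_all add: improper_def degree_T_power)
  have "0 \<le> (int k)\<^sup>2 - (int CARD('p) - int (deg h)) * int k + int CARD('p)" for k
  proof -
    have "int CARD('p) - int (deg (N div h)) + 1 = - (int CARD('p) - int (deg h))"
      using degN by linarith
    then show ?thesis
      using degree_quadratic_nonneg[OF on_P0 has_fraction_P0 has_fraction_P0_minus_P impr, of k]
      unfolding degree_T_power by (simp only: mult_minus_left add_uminus_conv_diff)
  qed
  from le_2_sqrt_if_quadratic_nonneg[OF odd_card this]
  have "real CARD('p) - real (deg h) \<le> 2 * sqrt (real CARD('p))" by simp
  then show ?thesis using degree_h_le by linarith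
qed

end

text \<open>Affine points over \<bbbF>_p described by integer representatives, so that
  \<open>p\<close> can be a variable and not the cardinality of a type. The point at infinity is
  missing, hence \<open>p\<close> and not \<open>p + 1\<close> in \<open>hasse_weil\<close>.\<close>

definition residue_points :: "nat \<Rightarrow> int \<Rightarrow> int \<Rightarrow> (int \<times> int) set" where
  "residue_points p a b = {(x, y). x \<in> {0..<int p} \<and> y \<in> {0..<int p} \<and> int p dvd y\<^sup>2 - (x ^ 3 + a * x + b)}"

definition hasse_weil :: "nat \<Rightarrow> bool" where
  "hasse_weil p \<longleftrightarrow> (\<forall>a b. \<not> int p dvd 2 * (4 * a ^ 3 + 27 * b\<^sup>2) \<longrightarrow>
     real (card (residue_points p a b)) \<le> real p + 2 * sqrt (real p))"

lemma hasse_weil_card: "hasse_weil CARD('p::prime_card)"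
  unfolding hasse_weil_def
proof (intro allI impI)
  fix a b
  assume disc: "\<not> int CARD('p) dvd 2 * (4 * a ^ 3 + 27 * b\<^sup>2)"
  let ?f = "of_int :: int \<Rightarrow> 'p mod_ring"
  have zero: "?f z = 0 \<longleftrightarrow> int CARD('p) dvd z" for z
    by (simp add: of_int_eq_0_iff_char_dvd)
  have "?f (2 * (4 * a ^ 3 + 27 * b\<^sup>2)) \<noteq> 0" using disc unfolding zero .
  then have "2 * (4 * (?f a) ^ 3 + 27 * (?f b)\<^sup>2) \<noteq> 0"
    by (simp only: of_int_mult of_int_add of_int_power of_int_numeral not_False_eq_True)
  then interpret manin_finite "?f a" "?f b"
    by unfold_locales (simp_all only: mult_eq_0_iff de_Morgan_disj simp_thms)
  have "card (residue_points CARD('p) a b) \<le> card {(x, y). y\<^sup>2 = x ^ 3 + ?f a * x + ?f b}"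
  proof (rule card_inj_on_le)
    show "inj_on (map_prod ?f ?f) (residue_points CARD('p) a b)"
    proof (rule inj_onI)
      have inj: "z = z'" if "z \<in> {0..<int CARD('p)}" "z' \<in> {0..<int CARD('p)}" "?f z = ?f z'" for z z'
      proof -
        have "?f (z - z') = 0" using that(3) by simp
        then have "int CARD('p) dvd z - z'" unfolding zero .
        then show ?thesis using that(1,2) by
          (metis atLeastLessThan_iff mod_eq_dvd_iff mod_pos_pos_trivial)
      qed
      fix u v assume "u \<in> residue_points CARD('p) a b" "v \<in> residue_points CARD('p) a b"
        and "map_prod ?f ?f u = map_prod ?f ?f v"
      then show "u = v" by (cases u; cases v) (auto simp: residue_points_def intro: inj)
    qed
    show "map_prod ?f ?f ` residue_points CARD('p) a b \<subseteq> {(x, y). y\<^sup>2 = x ^ 3 + ?f a * x + ?f b}"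
    proof clarify
      fix x y assume "(x, y) \<in> residue_points CARD('p) a b"
      then have "int CARD('p) dvd y\<^sup>2 - (x ^ 3 + a * x + b)" by (simp add: residue_points_def)
      then have "?f (y\<^sup>2 - (x ^ 3 + a * x + b)) = 0" unfolding zero .
      then show "(?f y)\<^sup>2 = ?f x ^ 3 + ?f a * ?f x + ?f b" by simp
    qed
  qed simp
  then show "real (card (residue_points CARD('p) a b)) \<le> real CARD('p) + 2 * sqrt (real CARD('p))"
    using hasse_bound by linarith
qed

text \<open>The bound has been proved for types of prime cardinality, but the cardinality of a type cannot
  depend on the variable \<open>p\<close>.  A single type whose cardinality is a counterexample to the
  bound, if there is one, gives all primes.\<close>

definition test_prime :: nat where
  "test_prime = (if \<exists>p. Factorial_Ring.prime p \<and> \<not> hasse_weil p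
     then SOME p. Factorial_Ring.prime p \<and> \<not> hasse_weil p else 3)"

lemma test_prime: "Factorial_Ring.prime test_prime"
  and hasse_weil_test_prime: "hasse_weil test_prime \<Longrightarrow> Factorial_Ring.prime p \<Longrightarrow> hasse_weil p"
proof -
  have "Factorial_Ring.prime test_prime \<and> ((\<exists>p. Factorial_Ring.prime p \<and> \<not> hasse_weil p) \<longrightarrow> \<not> hasse_weil test_prime)"
  proof (cases "\<exists>p. Factorial_Ring.prime p \<and> \<not> hasse_weil p")
    case True
    then have "Factorial_Ring.prime test_prime \<and> \<not> hasse_weil test_prime"
      unfolding test_prime_def if_P[OF True] by (rule someI_ex)
    then show ?thesis by blast
  next
    case False
    then have "test_prime = 3" unfolding test_prime_def by (rule if_not_P)
    moreover have "Factorial_Ring.prime (3 :: nat)" by simp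
    ultimately have "Factorial_Ring.prime test_prime" by (simp only:)
    with False show ?thesis by blast
  qed
  then show "Factorial_Ring.prime test_prime" "hasse_weil test_prime \<Longrightarrow> Factorial_Ring.prime p \<Longrightarrow> hasse_weil p"
    by blast+
qed

typedef test_residue = "{0..<test_prime}"
  using prime_gt_0_nat[OF test_prime] by auto

lemma card_test_residue: "CARD(test_residue) = test_prime"
  using type_definition.card[OF type_definition_test_residue] by simp

instance test_residue :: prime_card
  by standard (simp add: card_test_residue test_prime)

lemma hasse_weil_prime:
  assumes "Factorial_Ring.prime p"
  shows "hasse_weil p"
  using hasse_weil_card[where 'p = test_residue] hasse_weil_test_prime assms
  unfolding card_test_residue by blast

section \<open>Torsion and reduction\<close>

locale residue_curve = residue_prime +
  fixes a b :: 'a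
  assumes disc_nonzero: "4 * a ^ 3 + 27 * b\<^sup>2 \<noteq> 0" and integral: "a \<in> local_ring" "b \<in> local_ring"
begin

sublocale cubic: integral_cubic local_ring a b
  by unfold_locales (use disc_nonzero integral in auto)

abbreviation G :: "'a point monoid" where "G \<equiv> rational_points (short_weierstrass a b)"

sublocale group: comm_group G
  by (rule comm_group_rational_points) (rule disc_nonzero)

lemma one_G: "\<one>\<^bsub>G\<^esub> = Infinity"
  by (simp add: rational_points_def)

text \<open>For \<open>n = p^k m\<close> with \<open>m\<close> prime to \<open>p\<close>, the point
  \<open>p^k S\<close> stays in the kernel and is killed by \<open>m\<close>. Unless it is zero,
  \<open>m\<close> would lie in the maximal ideal, that is, \<open>p\<close> would divide
  \<open>m\<close>.\<close>

lemma torsion_in_kernel: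
  assumes S: "cubic.on S" "cubic.in_kernel S" and n: "n > 0" "S [^]\<^bsub>G\<^esub> (n::nat) = Infinity"
  shows "\<exists>k. S [^]\<^bsub>G\<^esub> (p ^ k) = Infinity"
proof -
  have G: "S \<in> carrier G" using S by (simp add: mem_rational_points)
  have "p > 1" by (rule prime_gt_1_nat[OF p])
  then obtain k m where m: "n = p ^ k * m" "\<not> p dvd m"
    using multiplicity_decompose'[of n p] n(1) by
      (metis not_is_unit_0 nat_dvd_1_iff_1 neq0_conv less_irrefl)
  define S' where "S' = S [^]\<^bsub>G\<^esub> (p ^ k)"
  have S': "cubic.on S'" unfolding S'_def using G by
    (simp add: mem_rational_points[symmetric] del: mem_rational_points)
  have "S' = Infinity"
  proof (cases "S = Infinity")
    case True
    then show ?thesis using group.nat_pow_one[of "p ^ k"] by (simp add: S'_def one_G)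
  next
    case False
    have ker: "cubic.in_kernel S'"
      using cubic.formal_parameter_multiple[OF S False, of "p ^ k"] by
        (simp add: cubic.multiple_def S'_def)
    have "S' [^]\<^bsub>G\<^esub> m = Infinity" using n(2) G unfolding S'_def m(1) by
      (simp add: group.nat_pow_pow)
    show ?thesis
    proof (rule ccontr)
      assume "S' \<noteq> Infinity"
      with S' ker have "of_nat m \<in> local.M"
        by (rule cubic.of_nat_M_if_torsion_in_kernel)
          (simp add: cubic.multiple_def \<open>S' [^]\<^bsub>G\<^esub> m = Infinity\<close>)
      then show False using of_int_M_iff[of "int m"] m(2) by simp
    qed
  qed
  then show ?thesis unfolding S'_def by blast
qed

text \<open>Two of the first \<open>N + 1\<close> multiples of a point have the same reduction, where \<open>N\<close> is the
  number of affine points over the residue field, unless one of them reduces to infinity.\<close>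

lemma multiple_in_kernel:
  assumes good: "2 * (4 * a ^ 3 + 27 * b\<^sup>2) \<notin> local.M" and S: "cubic.on S"
  shows "\<exists>r > 0. real r \<le> real p + 1 + 2 * sqrt (real p) \<and> cubic.in_kernel (S [^]\<^bsub>G\<^esub> r)"
proof -
  obtain a' b' where a': "a - of_int a' \<in> local.M" and b': "b - of_int b' \<in> local.M"
    using local_residue integral by blast
  let ?R = "residue_points p a' b'"
  have int_mem: "of_int z \<in> local_ring" for z by (rule int_local_ring) simp
  \<comment> \<open>Twice the difference of the discriminants at \<open>(a, b)\<close> and
    \<open>(a', b')\<close>, factored so that membership in the ideal is visible.\<close>
  let ?t = "(a - of_int a') * (8 * (a\<^sup>2 + a * of_int a' + (of_int a')\<^sup>2))
      + (b - of_int b') * (54 * (b + of_int b'))"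
  have "\<not> int p dvd 2 * (4 * a' ^ 3 + 27 * b'\<^sup>2)"
  proof
    assume "int p dvd 2 * (4 * a' ^ 3 + 27 * b'\<^sup>2)"
    then have "of_int (2 * (4 * a' ^ 3 + 27 * b'\<^sup>2)) \<in> local.M" by (simp only: of_int_M_iff)
    moreover have "?t \<in> local.M"
      by (intro local.M_intros local.mem_intros a' b' integral int_mem)
    ultimately have "of_int (2 * (4 * a' ^ 3 + 27 * b'\<^sup>2)) + ?t \<in> local.M"
      by (rule local.M_add)
    also have "of_int (2 * (4 * a' ^ 3 + 27 * b'\<^sup>2)) + ?t
        = 2 * (4 * a ^ 3 + 27 * b\<^sup>2)"
      by (simp add: algebra_simps power2_eq_square power3_eq_cube)
    finally show False using good by blast
  qed
  then have N: "real (card ?R) \<le> real p + 2 * sqrt (real p)"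
    using hasse_weil_prime[OF p] by (simp add: hasse_weil_def)
  have fin: "finite ?R"
    by (rule finite_subset[of _ "{0..<int p} \<times> {0..<int p}"]) (auto simp: residue_points_def)
  have on: "cubic.on (S [^]\<^bsub>G\<^esub> j)" for j :: nat
    using S by (simp add: mem_rational_points[symmetric] del: mem_rational_points)
  \<comment> \<open>One multiple more than there are affine residue points makes the pigeonhole
    principle apply; this accounts for the \<open>+ 1\<close> in the bound on
    \<open>r\<close>.\<close>
  have "\<exists>r \<in> {1..card ?R + 1}. cubic.in_kernel (S [^]\<^bsub>G\<^esub> r)"
  proof (rule ccontr)
    assume "\<not> ?thesis"
    then have no: "\<not> cubic.in_kernel (S [^]\<^bsub>G\<^esub> r)" if "r \<in> {1..card ?R + 1}" for r using that
      by blast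
    let ?reduces = "\<lambda>j w. \<exists>x y. S [^]\<^bsub>G\<^esub> j = Affine x y \<and> x \<in> local_ring \<and> y \<in> local_ring \<and>
        x - of_int (fst w) \<in> local.M \<and> y - of_int (snd w) \<in> local.M"
    have "\<exists>x y u v. S [^]\<^bsub>G\<^esub> j = Affine x y \<and> x \<in> local_ring \<and> y \<in> local_ring \<and> (u, v) \<in> ?R \<and>
        x - of_int u \<in> local.M \<and> y - of_int v \<in> local.M" if j: "j \<in> {1..card ?R + 1}" for j
    proof -
      obtain x y where xy: "S [^]\<^bsub>G\<^esub> j = Affine x y" "x \<in> local_ring"
        using no[OF j] by (cases "S [^]\<^bsub>G\<^esub> j") auto
      then have y: "y \<in> local_ring" using on[of j] cubic.in_kernel_if_ordinate[of x y] by auto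
      have res: "\<exists>u\<in>{0..<int p}. x - of_int u \<in> local.M" if x: "x \<in> local_ring" for x
      proof -
        obtain n where n: "x - of_int n \<in> local.M" using local_residue[OF x] by blast
        have "of_int (n - n mod int p) \<in> local.M" unfolding of_int_M_iff by
          (simp add: minus_mod_eq_div_mult)
        from local.M_add[OF n this] have "x - of_int (n mod int p) \<in> local.M" by simp
        moreover have "n mod int p \<in> {0..<int p}" using prime_gt_0_nat[OF p] by simp
        ultimately show ?thesis by blast
      qed
      obtain u v where uv: "u \<in> {0..<int p}" "x - of_int u \<in> local.M" "v \<in> {0..<int p}" "y - of_int v \<in> local.M"
        using res[OF xy(2)] res[OF y] by blast
      have eq: "y\<^sup>2 - (x ^ 3 + a * x + b) = 0" using on[of j] xy by simp
      \<comment> \<open>The difference between the curve equation at \<open>(x, y)\<close> and the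
        one at the representatives \<open>(u, v)\<close>, again factored.\<close>
      let ?t = "(x - of_int u) * (x\<^sup>2 + x * of_int u + (of_int u)\<^sup>2 + of_int a') + (a - of_int a') * x + (b - of_int b')
          - (y - of_int v) * (y + of_int v)"
      have "?t \<in> local.M"
        by (intro local.M_intros local.mem_intros uv a' b' xy y int_mem)
      also have "?t = of_int (v\<^sup>2 - (u ^ 3 + a' * u + b')) - (y\<^sup>2 - (x ^ 3 + a * x + b))"
        by (simp add: algebra_simps power2_eq_square power3_eq_cube)
      finally have "int p dvd v\<^sup>2 - (u ^ 3 + a' * u + b')" unfolding eq diff_zero of_int_M_iff .
      then have "(u, v) \<in> ?R" using uv by (simp add: residue_points_def)
      then show ?thesis using xy y uv by blast
    qed
    then have "\<forall>j\<in>{1..card ?R + 1}. \<exists>w. w \<in> ?R \<and> ?reduces j w"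
      by fastforce
    from bchoice[OF this] obtain f where f: "\<forall>j\<in>{1..card ?R + 1}. f j \<in> ?R \<and> ?reduces j (f j)" ..
    have "\<not> inj_on f {1..card ?R + 1}"
    proof
      assume "inj_on f {1..card ?R + 1}"
      then have "card {1..card ?R + 1} \<le> card ?R" by (rule card_inj_on_le) (use f fin in auto)
      then show False by simp
    qed
    then obtain i j where ij: "i \<in> {1..card ?R + 1}" "j \<in> {1..card ?R + 1}" "i < j" "f i = f j"
      unfolding inj_on_def by (metis nat_neq_iff)
    obtain x y where xy: "S [^]\<^bsub>G\<^esub> j = Affine x y" "x \<in> local_ring" "y \<in> local_ring"
        "x - of_int (fst (f j)) \<in> local.M" "y - of_int (snd (f j)) \<in> local.M" using f ij(2) by blast
    obtain x' y' where xy': "S [^]\<^bsub>G\<^esub> i = Affine x' y'" "x' \<in> local_ring" "y' \<in> local_ring"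
        "x' - of_int (fst (f j)) \<in> local.M" "y' - of_int (snd (f j)) \<in> local.M" using f ij(1)
          unfolding ij(4)[symmetric] by blast
    have cong: "x - x' \<in> local.M" "y - y' \<in> local.M"
      using local.M_diff[OF xy(4) xy'(4)] local.M_diff[OF xy(5) xy'(5)] by simp_all
    have "cubic.in_kernel (cubic.add (Affine x y) (point_neg (Affine x' y')))"
      by (rule cubic.diff_in_kernel_if_congruent[OF good _ _ xy(2,3) xy'(2,3) cong])
        (use on[of i] on[of j] xy xy' in auto)
    \<comment> \<open>By the group law the difference of the \<open>j\<close>-th and the
      \<open>i\<close>-th multiple is the \<open>(j - i)\<close>-th, again one of the multiples
      considered.\<close>
    moreover have "S [^]\<^bsub>G\<^esub> j = cubic.add (S [^]\<^bsub>G\<^esub> (j - i)) (S [^]\<^bsub>G\<^esub> i)"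
    proof -
      have "S [^]\<^bsub>G\<^esub> (j - i) \<otimes>\<^bsub>G\<^esub> S [^]\<^bsub>G\<^esub> i = S [^]\<^bsub>G\<^esub> (j - i + i)"
        by (rule group.nat_pow_mult) (use S in \<open>simp add: mem_rational_points\<close>)
      then show ?thesis using ij(3) by (simp add: rational_points_def)
    qed
    ultimately have "cubic.in_kernel (S [^]\<^bsub>G\<^esub> (j - i))"
      using cubic.add_diff_cancel[OF on on] unfolding xy(1)[symmetric] xy'(1)[symmetric] by simp
    moreover have "j - i \<in> {1..card ?R + 1}" using ij by auto
    ultimately show False using no by blast
  qed
  then obtain r where r: "r \<in> {1..card ?R + 1}" "cubic.in_kernel (S [^]\<^bsub>G\<^esub> r)" ..
  then show ?thesis using N by (intro exI[of _ r]) auto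
qed

end

theorem theorem2p1:
  fixes \<pp> \<qq> :: "'k::field_char_0 set"
    and p q :: nat
    and d :: 'k
  assumes "number_field TYPE('k)"
    and "primeideal \<pp> ring_of_integers" and "\<pp> \<noteq> {0}"
    and "primeideal \<qq> ring_of_integers" and "\<qq> \<noteq> {0}"
    and "\<not> lies_over \<pp> (Idl\<^bsub>\<Z>\<^esub> {2})" and "\<not> lies_over \<qq> (Idl\<^bsub>\<Z>\<^esub> {2})"
    and "Factorial_Ring.prime p" and "Factorial_Ring.prime q"
    and "ring_of_integers Quot \<pp> \<simeq> ZFact (int p)"
    and "ring_of_integers Quot \<qq> \<simeq> ZFact (int q)"
    and "real q > real p + 1 + 2 * sqrt (real p)"
    and "d \<in> carrier ring_of_integers" and "d \<noteq> 0"
    and "generate_field ring_of_type_algebra {d} = UNIV"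
    and "16 * (4 + 27 * d ^ 4) \<notin> \<pp>"
    and "d \<in> \<qq>"
  shows
    "(elliptic_curve (curve d) \<and>
      Affine 0 d \<in> carrier (rational_points (curve d)) \<and>
      infinite_order (rational_points (curve d)) (Affine 0 d)) \<and>
     (\<forall>F. subfield F ring_of_type_algebra \<and> F \<noteq> UNIV \<longrightarrow>
        (d ^ 4 \<notin> F \<longrightarrow> \<not> curve_definable_over F (curve d)) \<and>
        \<not> point_defined_over F (Affine 0 d)) \<and>
     (\<forall>e \<in> carrier ring_of_integers. \<forall>e' \<in> carrier (ring_of_integers :: 'k ring).
        elliptic_curve (curve e) \<and> elliptic_curve (curve e') \<longrightarrow>
        (isomorphic_over_closure (curve e) (curve e') \<longleftrightarrow>
          (\<exists>\<zeta> :: 'k alg_closure. \<zeta> ^ 4 = 1 \<and> to_ac e = to_ac e' * \<zeta>))) \<and>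
     (\<forall>e \<in> carrier ring_of_integers. \<forall>e' \<in> carrier (ring_of_integers :: 'k ring).
        elliptic_curve (curve e) \<and> elliptic_curve (curve e') \<and>
        (\<forall>\<zeta> :: 'k alg_closure. \<zeta> ^ 4 = 1 \<longrightarrow> to_ac e \<noteq> to_ac e' * \<zeta>) \<longrightarrow>
        \<not> is_twist_of (curve e) (curve e'))"
proof (intro conjI ballI allI impI)
  interpret P: residue_prime \<pp> p by (rule residue_prime.intro) (fact assms)+
  interpret Q: residue_prime \<qq> q by (rule residue_prime.intro) (fact assms)+
  have disc: "4 * 1 ^ 3 + 27 * (d\<^sup>2)\<^sup>2 = 4 + 27 * d ^ 4"
    by (simp flip: power_mult)
  have disc_nonzero: "4 + 27 * d ^ 4 \<noteq> 0"
  proof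
    assume "4 + 27 * d ^ 4 = 0"
    from assms(16)[unfolded this] show False using P.P_zero by simp
  qed
  then show ell: "elliptic_curve (curve d)"
    unfolding elliptic_curve_def weierstrass_discriminant_curve
    by (simp only: neg_equal_0_iff_equal mult_eq_0_iff) simp
  have d: "algebraic_int d" using assms(13) by (simp add: ring_of_integers_def)
  have d2: "algebraic_int (d\<^sup>2)" using P.int_mult[OF d d] by (simp add: power2_eq_square)
  interpret PC: residue_curve \<pp> p 1 "d\<^sup>2"
    by (intro residue_curve.intro residue_curve_axioms.intro P.residue_prime_axioms)
      (use disc_nonzero d2 in \<open>simp_all only: disc not_False_eq_True P.int_local_ring algebraic_int_1\<close>)
  interpret QC: residue_curve \<qq> q 1 "d\<^sup>2"
    by (intro residue_curve.intro residue_curve_axioms.intro Q.residue_prime_axioms)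
      (use disc_nonzero d2 in \<open>simp_all only: disc not_False_eq_True Q.int_local_ring algebraic_int_1\<close>)
  have curve: "curve d = short_weierstrass 1 (d\<^sup>2)" by (simp add: curve_def)
  let ?G = "rational_points (short_weierstrass 1 (d\<^sup>2))" and ?S = "Affine 0 d"
  have on: "PC.cubic.on ?S" by simp
  show S: "?S \<in> carrier (rational_points (curve d))"
    unfolding curve mem_rational_points by (rule on)
  show "infinite_order (rational_points (curve d)) ?S"
    unfolding infinite_order_def curve PC.one_G
  proof (intro allI impI notI)
    fix n :: nat
    assume n: "n > 0" "?S [^]\<^bsub>?G\<^esub> n = Infinity"
    note G = S[unfolded curve]
    have pow: "(?S [^]\<^bsub>?G\<^esub> i) [^]\<^bsub>?G\<^esub> j = ?S [^]\<^bsub>?G\<^esub> (i * j)" for i j :: nat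
      by (rule PC.group.nat_pow_pow[OF G])
    have tors: "(?S [^]\<^bsub>?G\<^esub> i) [^]\<^bsub>?G\<^esub> n = Infinity" for i :: nat
    proof -
      have "(?S [^]\<^bsub>?G\<^esub> i) [^]\<^bsub>?G\<^esub> n = (?S [^]\<^bsub>?G\<^esub> n) [^]\<^bsub>?G\<^esub> i" unfolding pow by
        (simp only: mult.commute)
      then show ?thesis using PC.group.nat_pow_one[of i] n(2) by (simp add: PC.one_G)
    qed
    have on_pow: "PC.cubic.on (?S [^]\<^bsub>?G\<^esub> i)" for i :: nat
      unfolding mem_rational_points[symmetric] by (rule PC.group.nat_pow_closed[OF G])
    have good: "2 * (4 * 1 ^ 3 + 27 * (d\<^sup>2)\<^sup>2) \<notin> P.local.M"
    proof
      assume "2 * (4 * 1 ^ 3 + 27 * (d\<^sup>2)\<^sup>2) \<in> P.local.M"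
      \<comment> \<open>The numeral is 8, which turns twice the discriminant expression into the
        multiple by 16 of the hypothesis.\<close>
      from P.local.M_mult[OF P.local.numeral_mem this, of "num.Bit0 (num.Bit0 (num.Bit0 num.One))"]
      have "16 * (4 + 27 * d ^ 4) \<in> P.local.M" unfolding disc by
        (simp only: mult.assoc[symmetric]) simp
      moreover have "algebraic_int (16 * (4 + 27 * d ^ 4))"
        using P.int_mult[OF d2 d2] by (intro P.int_mult P.int_add) (simp_all flip: power_add)
      ultimately show False using assms(16) P.int_M_iff by blast
    qed
    obtain r where r: "r > 0" "real r \<le> real p + 1 + 2 * sqrt (real p)" "PC.cubic.in_kernel (?S [^]\<^bsub>?G\<^esub> r)"
      using PC.multiple_in_kernel[OF good on] by blast
    obtain j where j: "?S [^]\<^bsub>?G\<^esub> (r * p ^ j) = Infinity"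
      using PC.torsion_in_kernel[OF on_pow r(3) n(1) tors] unfolding pow by blast
    \<comment> \<open>The tangent at \<open>(0, d)\<close> has slope \<open>1 / (2 d)\<close>, so
      \<open>2 P\<close> has abscissa \<open>1 / (4 d^2)\<close>; this is not integral at \<qq>,
      which contains \<open>d\<close>.\<close>
    have S2: "?S [^]\<^bsub>?G\<^esub> (2::nat) = Affine ((1 / (2 * d))\<^sup>2) (- (1 / (2 * d) * ((1 / (2 * d))\<^sup>2 - 0) + d))"
    proof -
      have "?S [^]\<^bsub>?G\<^esub> (2::nat) = PC.cubic.add ?S ?S"
        by (simp add: numeral_2_eq_2 nat_pow_def rational_points_def)
      also have "\<dots> = Affine ((1 / (2 * d))\<^sup>2) (- (1 / (2 * d) * ((1 / (2 * d))\<^sup>2 - 0) + d))"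
        by (rule PC.cubic.add_tangent) (use assms(14) in simp_all)
      finally show ?thesis .
    qed
    have "QC.cubic.in_kernel (?S [^]\<^bsub>?G\<^esub> (2::nat))"
    proof -
      have "2 * d \<in> Q.local.M" by (intro Q.local.M_mult Q.local.numeral_mem Q.P_in_M assms(17))
      then have "(2 * d)\<^sup>2 \<in> Q.local.M" by (rule Q.local.M_power) simp
      then have "(1 / (2 * d))\<^sup>2 \<notin> Q.local_ring"
        unfolding Q.local.not_mem_iff using assms(14) by (simp add: power_divide)
      then show ?thesis unfolding S2 by simp
    qed
    from QC.torsion_in_kernel[OF on_pow this n(1) tors] obtain k
      where k: "?S [^]\<^bsub>?G\<^esub> (2 * q ^ k) = Infinity" unfolding pow by blast
    \<comment> \<open>Primes and positive numbers below \<open>q\<close> are coprime to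
      \<open>q\<close>, so \<open>r p^j\<close> is coprime to every power of
      \<open>q\<close>.\<close>
    have rq: "r < q" "p < q"
    proof -
      have "0 \<le> sqrt (real p)" by simp
      then show "r < q" "p < q" using r(2) assms(12) by linarith+
    qed
    then have "Rings.coprime r q" "Rings.coprime p q"
      using assms(8,9) r(1) by (auto simp: coprime_commute primes_coprime dvd_imp_le prime_imp_coprime
          nat_dvd_not_less)
    then have cop: "Rings.coprime (r * p ^ j) (q ^ k)" by simp
    \<comment> \<open>The order divides \<open>r p^j\<close> and \<open>2 q^k\<close>, hence 2; but
      \<open>2 P\<close> has just been computed as an affine point.\<close>
    let ?o = "PC.group.ord ?S"
    have "?o dvd r * p ^ j" "?o dvd 2 * q ^ k"
      using PC.group.pow_eq_id[OF G] j k by (simp_all add: PC.one_G)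
    then have "?o dvd 2" using cop by (metis coprime_divisors coprime_dvd_mult_left_iff dvd_refl)
    then have "?S [^]\<^bsub>?G\<^esub> (2::nat) = Infinity"
      using PC.group.pow_eq_id[OF G] by (simp add: PC.one_G)
    then show False unfolding S2 by simp
  qed
next
  fix F :: "'k set"
  assume F: "subfield F ring_of_type_algebra \<and> F \<noteq> UNIV"
  show "\<not> curve_definable_over F (curve d)" if "d ^ 4 \<notin> F"
    using power4_mem_if_curve_definable that F by blast
  show "\<not> point_defined_over F (Affine 0 d)"
  proof
    assume "point_defined_over F (Affine 0 d)"
    then have "{d} \<subseteq> F" by (simp add: point_defined_over_def)
    then have "generate_field ring_of_type_algebra {d} \<subseteq> F"
      using F by (intro field.generate_field_min_subfield1[OF field_from_type_algebra])
        (auto simp: ring_of_type_algebra_def)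
    then show False using F assms(15) by blast
  qed
qed (use isomorphic_over_closure_curve_iff in \<open>auto simp: is_twist_of_def\<close>)

end
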